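(* Each of the following varieties has the strong amalgamation property, and hence the ES property: (1) the variety of semiconic generalized Sugihara monoids; (2) the variety of central semiconic generalized Sugihara monoids.
   Context: A residuated lattice is an algebra $(A,\wedge,\vee,\cdot,\backslash,/,1)$ such that $(A,\wedge,\vee)$ is a lattice, $(A,\cdot,1)$ is a monoid, and $y\le x\backslash z \iff x\cdot y\le z\iff x\le z/y$ for all $x,y,z$. It is commutative if $\cdot$ is commutative (then $x\to y:=x\backslash y=y/x$ and $x^*:=x\to 1$), idempotent if it satisfies $x\cdot x=x$, conic if every $a\in A$ satisfies $a\le 1$ or $1\le a$, and semiconic if it belongs to the variety generated by all conic residuated lattices. A semiconic generalized Sugihara monoid is a commutative semiconic idempotent residuated lattice satisfying $(x\vee 1)^{**}=x\vee 1$; it is central if it moreover satisfies $1\le x^{**}\vee(x^{**}\to x)$. A class $\mathcal K$ of similar algebras has the strong amalgamation property if for all $\mathbf A,\mathbf B,\mathbf C\in\mathcal K$ and embeddings $f_B\colon\mathbf A\to\mathbf B$, $f_C\colon\mathbf A\to\mathbf C$ there are $\mathbf D\in\mathcal K$ and embeddings $g_B\colon\mathbf B\to\mathbf D$, $g_C\colon\mathbf C\to\mathbf D$ with $g_B\circ f_B=g_C\circ f_C$ and $(g_B\circ f_B)[A]=g_B[B]\cap g_C[C]$. $\mathcal K$ has the ES property (epimorphism surjectivity) if every homomorphism between members of $\mathcal K$ that is an epimorphism in $\mathcal K$ (right-cancellable with respect to homomorphisms into members of $\mathcal K$) is surjective. *)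

theory Defs
  imports "HOL-Algebra.Group"
begin

(* Universe convention. Algebras have a carrier set inside an arbitrary type 'u, and a class of
   algebras is a set of such records over a single type 'u. The theorem is stated for every
   infinite 'u. Any set of algebras lives, up to isomorphism, over a large enough infinite type.
   The operations are finitary and finitely many, so a subalgebra generated by a subset of 'u
   (or by two copies of 'u) again fits into an infinite 'u. Hence the amalgams D, the targets
   used to test epimorphisms, and the conic algebras used to test equations may all be taken
   over 'u without loss of generality. *)

record 'u rlat = "'u monoid" +
  lmeet :: "'u \<Rightarrow> 'u \<Rightarrow> 'u"
  ljoin :: "'u \<Rightarrow> 'u \<Rightarrow> 'u"
  ldiv :: "'u \<Rightarrow> 'u \<Rightarrow> 'u"  \<comment> \<open>\<open>ldiv A x z\<close> has the denominator \<open>x\<close> on the left\<close>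
  rdiv :: "'u \<Rightarrow> 'u \<Rightarrow> 'u"  \<comment> \<open>\<open>rdiv A z y\<close> is \<open>z / y\<close>\<close>

definition similar_algebra :: "'u rlat \<Rightarrow> bool" where
  "similar_algebra A \<longleftrightarrow>
     \<one>\<^bsub>A\<^esub> \<in> carrier A \<and>
     (\<forall>x\<in>carrier A. \<forall>y\<in>carrier A.
        lmeet A x y \<in> carrier A \<and> ljoin A x y \<in> carrier A \<and> x \<otimes>\<^bsub>A\<^esub> y \<in> carrier A \<and>
        ldiv A x y \<in> carrier A \<and> rdiv A x y \<in> carrier A)"

definition rle :: "'u rlat \<Rightarrow> 'u \<Rightarrow> 'u \<Rightarrow> bool" where
  "rle A x y \<longleftrightarrow> lmeet A x y = x"

definition is_lattice :: "'u rlat \<Rightarrow> bool" where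
  "is_lattice A \<longleftrightarrow>
     (\<forall>x\<in>carrier A. \<forall>y\<in>carrier A.
        lmeet A x y = lmeet A y x \<and> ljoin A x y = ljoin A y x \<and>
        lmeet A x (ljoin A x y) = x \<and> ljoin A x (lmeet A x y) = x) \<and>
     (\<forall>x\<in>carrier A. \<forall>y\<in>carrier A. \<forall>z\<in>carrier A.
        lmeet A (lmeet A x y) z = lmeet A x (lmeet A y z) \<and>
        ljoin A (ljoin A x y) z = ljoin A x (ljoin A y z))"

definition residuated_lattice :: "'u rlat \<Rightarrow> bool" where
  "residuated_lattice A \<longleftrightarrow>
     similar_algebra A \<and> is_lattice A \<and> monoid A \<and>
     (\<forall>x\<in>carrier A. \<forall>y\<in>carrier A. \<forall>z\<in>carrier A.
        (rle A y (ldiv A x z) \<longleftrightarrow> rle A (x \<otimes>\<^bsub>A\<^esub> y) z) \<and>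
        (rle A (x \<otimes>\<^bsub>A\<^esub> y) z \<longleftrightarrow> rle A x (rdiv A z y)))"

definition conic :: "'u rlat \<Rightarrow> bool" where
  "conic A \<longleftrightarrow> (\<forall>a\<in>carrier A. rle A a \<one>\<^bsub>A\<^esub> \<or> rle A \<one>\<^bsub>A\<^esub> a)"

definition idempotent :: "'u rlat \<Rightarrow> bool" where
  "idempotent A \<longleftrightarrow> (\<forall>x\<in>carrier A. x \<otimes>\<^bsub>A\<^esub> x = x)"

datatype rl_term =
    Var nat
  | One
  | Meet rl_term rl_term
  | Join rl_term rl_term
  | Mult rl_term rl_term
  | LDiv rl_term rl_term
  | RDiv rl_term rl_term

primrec eval_term :: "'u rlat \<Rightarrow> (nat \<Rightarrow> 'u) \<Rightarrow> rl_term \<Rightarrow> 'u" where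
  "eval_term A v (Var n) = v n"
| "eval_term A v One = \<one>\<^bsub>A\<^esub>"
| "eval_term A v (Meet s t) = lmeet A (eval_term A v s) (eval_term A v t)"
| "eval_term A v (Join s t) = ljoin A (eval_term A v s) (eval_term A v t)"
| "eval_term A v (Mult s t) = eval_term A v s \<otimes>\<^bsub>A\<^esub> eval_term A v t"
| "eval_term A v (LDiv s t) = ldiv A (eval_term A v s) (eval_term A v t)"
| "eval_term A v (RDiv s t) = rdiv A (eval_term A v s) (eval_term A v t)"

definition satisfies :: "'u rlat \<Rightarrow> rl_term \<times> rl_term \<Rightarrow> bool" where
  "satisfies A e \<longleftrightarrow>
     (\<forall>v. (\<forall>n. v n \<in> carrier A) \<longrightarrow> eval_term A v (fst e) = eval_term A v (snd e))"

definition variety :: "'u rlat set \<Rightarrow> bool" where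
  "variety V \<longleftrightarrow> (\<exists>E. V = {A. similar_algebra A \<and> (\<forall>e\<in>E. satisfies A e)})"

definition variety_generated :: "'u rlat set \<Rightarrow> 'u rlat set" where
  "variety_generated K = \<Inter>{V. variety V \<and> K \<subseteq> V}"

definition semiconic :: "'u rlat \<Rightarrow> bool" where
  "semiconic A \<longleftrightarrow> A \<in> variety_generated {B. residuated_lattice B \<and> conic B}"

definition star :: "'u rlat \<Rightarrow> 'u \<Rightarrow> 'u" where
  "star A x = ldiv A x \<one>\<^bsub>A\<^esub>"

definition semiconic_GSM :: "'u rlat set" where
  "semiconic_GSM =
     {A. residuated_lattice A \<and> comm_monoid A \<and> semiconic A \<and> idempotent A \<and>
         (\<forall>x\<in>carrier A. star A (star A (ljoin A x \<one>\<^bsub>A\<^esub>)) = ljoin A x \<one>\<^bsub>A\<^esub>)}"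

definition central_semiconic_GSM :: "'u rlat set" where
  "central_semiconic_GSM =
     {A \<in> semiconic_GSM.
        \<forall>x\<in>carrier A. rle A \<one>\<^bsub>A\<^esub> (ljoin A (star A (star A x)) (ldiv A (star A (star A x)) x))}"

(* Homomorphisms are total HOL functions whose values outside the carrier are irrelevant;
   they are therefore only ever compared on the carrier of their domain. *)
definition rl_hom :: "'u rlat \<Rightarrow> 'u rlat \<Rightarrow> ('u \<Rightarrow> 'u) set" where
  "rl_hom A B =
     {h \<in> hom A B. h \<one>\<^bsub>A\<^esub> = \<one>\<^bsub>B\<^esub> \<and>
        (\<forall>x\<in>carrier A. \<forall>y\<in>carrier A.
           h (lmeet A x y) = lmeet B (h x) (h y) \<and>
           h (ljoin A x y) = ljoin B (h x) (h y) \<and>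
           h (ldiv A x y) = ldiv B (h x) (h y) \<and>
           h (rdiv A x y) = rdiv B (h x) (h y))}"

definition embedding :: "'u rlat \<Rightarrow> 'u rlat \<Rightarrow> ('u \<Rightarrow> 'u) set" where
  "embedding A B = {h \<in> rl_hom A B. inj_on h (carrier A)}"

definition strong_amalgamation_property :: "'u rlat set \<Rightarrow> bool" where
  "strong_amalgamation_property K \<longleftrightarrow>
     (\<forall>A\<in>K. \<forall>B\<in>K. \<forall>C\<in>K. \<forall>fB\<in>embedding A B. \<forall>fC\<in>embedding A C.
        \<exists>D\<in>K. \<exists>gB\<in>embedding B D. \<exists>gC\<in>embedding C D.
          (\<forall>a\<in>carrier A. gB (fB a) = gC (fC a)) \<and>
          (gB \<circ> fB) ` carrier A = gB ` carrier B \<inter> gC ` carrier C)"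

definition epimorphism_in :: "'u rlat set \<Rightarrow> 'u rlat \<Rightarrow> 'u rlat \<Rightarrow> ('u \<Rightarrow> 'u) \<Rightarrow> bool" where
  "epimorphism_in K A B f \<longleftrightarrow>
     f \<in> rl_hom A B \<and>
     (\<forall>C\<in>K. \<forall>g\<in>rl_hom B C. \<forall>h\<in>rl_hom B C.
        (\<forall>x\<in>carrier A. g (f x) = h (f x)) \<longrightarrow> (\<forall>y\<in>carrier B. g y = h y))"

definition ES_property :: "'u rlat set \<Rightarrow> bool" where
  "ES_property K \<longleftrightarrow>
     (\<forall>A\<in>K. \<forall>B\<in>K. \<forall>f. epimorphism_in K A B f \<longrightarrow> f ` carrier A = carrier B)"

end

theory Submission
  imports Defs
begin

text \<open>A semiconic generalized Sugihara monoid \<open>B\<close> is studied through the prime deductive filters \<open>P\<close>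
  of \<open>B\<close>, where \<open>P = B\<close> is allowed. Modulo such a \<open>P\<close> the algebra is conic, its positive cone is
  a chain anti-isomorphic, via \<open>x \<mapsto> x\<^sup>*\<close>, to the image of the closure operator \<open>x \<mapsto> x\<^sup>*\<^sup>*\<close>
  on the negative cone, and all operations are determined by the negative cone and this operator.
  On the primes above \<open>P\<close> the operator is given by the set of nuclear primes, those closed under
  \<open>b\<^sup>*\<^sup>* \<mapsto> b\<close>; each of them is comparable with every prime above \<open>P\<close>. Conversely, a preordered set with
  a distinguished set of such nodes yields a conic algebra.

  Given a span \<open>B \<leftarrow> A \<rightarrow> C\<close>, take two primes \<open>P\<close>, \<open>Q\<close> with the same trace on \<open>A\<close>. The pairs of primes
  above \<open>(P, Q)\<close> with equal traces would amalgamate the underlying Brouwerian algebras, but too many pairs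
  are nodes. Keeping only an L-shaped path of pairs over each nuclear trace restores
  comparability, and both projections still lift inclusions of primes. The amalgam is a subalgebra of the
  product, over all \<open>(P, Q)\<close>, of the resulting conic algebras. It is strong because an inclusion between a
  negative element of \<open>B\<close> and one of \<open>C\<close> that holds at all pairs \<open>(P, Q)\<close> is interpolated by an
  element of \<open>A\<close>, and every element is recovered from its negative part and the negative part of its star.

  Surjectivity of an epimorphism \<open>f\<close> into \<open>B\<close> follows by strongly amalgamating two copies of \<open>B\<close> over the
  image of \<open>f\<close>.\<close>

section \<open>Preordered residuated lattices\<close>

text \<open>The order is only a preorder, so that a quotient by a filter can be the same operations
  under a coarser preorder, without equivalence classes. \<open>semic\<close> is the law inherited
  from conic algebras through \<open>semiconic_eq\<close>.\<close>

locale preordered_rl =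
  fixes le :: "'a \<Rightarrow> 'a \<Rightarrow> bool" (infix "\<preceq>" 50)
    and mul :: "'a \<Rightarrow> 'a \<Rightarrow> 'a" (infixl "\<odot>" 70)
    and imp :: "'a \<Rightarrow> 'a \<Rightarrow> 'a" (infixr "\<leadsto>" 65)
    and mt :: "'a \<Rightarrow> 'a \<Rightarrow> 'a"
    and jn :: "'a \<Rightarrow> 'a \<Rightarrow> 'a"
    and one :: 'a ("e")
  assumes refl [simp]: "x \<preceq> x"
    and trans [trans]: "x \<preceq> y \<Longrightarrow> y \<preceq> z \<Longrightarrow> x \<preceq> z"
    and res: "x \<odot> y \<preceq> z \<longleftrightarrow> y \<preceq> x \<leadsto> z"
    and comm: "x \<odot> y \<preceq> y \<odot> x"
    and assoc: "(x \<odot> y) \<odot> z \<preceq> x \<odot> (y \<odot> z)"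
    and unit1: "e \<odot> x \<preceq> x"
    and unit2: "x \<preceq> e \<odot> x"
    and idem1: "x \<preceq> x \<odot> x"
    and idem2: "x \<odot> x \<preceq> x"
    and mt_iff: "z \<preceq> mt x y \<longleftrightarrow> z \<preceq> x \<and> z \<preceq> y"
    and jn_iff: "jn x y \<preceq> z \<longleftrightarrow> x \<preceq> z \<and> y \<preceq> z"
    and semic: "e \<preceq> jn (mt x e) (mt (x \<leadsto> e) e)"
    and gsm: "((jn x e) \<leadsto> e) \<leadsto> e \<preceq> jn x e"
begin

definition st :: "'a \<Rightarrow> 'a" where "st x = x \<leadsto> e"

lemma mt1: "mt x y \<preceq> x" and mt2: "mt x y \<preceq> y"
  using mt_iff refl by blast+

lemma jn1: "x \<preceq> jn x y" and jn2: "y \<preceq> jn x y"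
  using jn_iff refl by blast+

lemma res': "x \<odot> y \<preceq> z \<longleftrightarrow> x \<preceq> y \<leadsto> z"
  using res comm trans by blast

lemma mul_mono: "x \<preceq> x' \<Longrightarrow> y \<preceq> y' \<Longrightarrow> x \<odot> y \<preceq> x' \<odot> y'"
proof -
  assume a: "x \<preceq> x'" "y \<preceq> y'"
  have "y' \<preceq> x' \<leadsto> x' \<odot> y'" using res refl by blast
  hence "y \<preceq> x' \<leadsto> x' \<odot> y'" using a trans by blast
  hence "x' \<preceq> y \<leadsto> x' \<odot> y'" using res res' by blast
  hence "x \<preceq> y \<leadsto> x' \<odot> y'" using a trans by blast
  thus ?thesis using res' by blast
qed

lemma assoc': "x \<odot> (y \<odot> z) \<preceq> (x \<odot> y) \<odot> z"
proof -
  have "x \<odot> (y \<odot> z) \<preceq> (z \<odot> y) \<odot> x" using comm mul_mono refl trans by meson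
  also have "\<dots> \<preceq> z \<odot> (y \<odot> x)" by (rule assoc)
  also have "\<dots> \<preceq> (x \<odot> y) \<odot> z" using comm mul_mono refl trans by meson
  finally show ?thesis .
qed

lemma unit3: "x \<odot> e \<preceq> x" and unit4: "x \<preceq> x \<odot> e"
  using comm unit1 unit2 trans by blast+

lemma mp: "x \<odot> (x \<leadsto> y) \<preceq> y" and mp': "(x \<leadsto> y) \<odot> x \<preceq> y"
  using res res' refl by blast+

lemma one_le_imp: "e \<preceq> x \<leadsto> y \<longleftrightarrow> x \<preceq> y"
  using res unit3 unit4 trans by blast

lemma imp_mono: "x' \<preceq> x \<Longrightarrow> y \<preceq> y' \<Longrightarrow> x \<leadsto> y \<preceq> x' \<leadsto> y'"
proof -
  assume a: "x' \<preceq> x" "y \<preceq> y'"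
  have "x' \<odot> (x \<leadsto> y) \<preceq> x \<odot> (x \<leadsto> y)" using a mul_mono refl by blast
  also have "\<dots> \<preceq> y" by (rule mp)
  also have "y \<preceq> y'" by (rule a)
  finally show ?thesis using res by blast
qed

lemma imp_trans: "(x \<leadsto> y) \<odot> (y \<leadsto> z) \<preceq> x \<leadsto> z"
proof -
  have "x \<odot> ((x \<leadsto> y) \<odot> (y \<leadsto> z)) \<preceq> (x \<odot> (x \<leadsto> y)) \<odot> (y \<leadsto> z)" by (rule assoc')
  also have "\<dots> \<preceq> y \<odot> (y \<leadsto> z)" using mp mul_mono refl by blast
  also have "\<dots> \<preceq> z" by (rule mp)
  finally show ?thesis using res by blast
qed

lemma curry1: "(x \<odot> y) \<leadsto> z \<preceq> y \<leadsto> (x \<leadsto> z)"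
proof -
  have "x \<odot> (y \<odot> ((x \<odot> y) \<leadsto> z)) \<preceq> z" using assoc' mp trans by blast
  thus ?thesis using res by blast
qed

lemma curry2: "y \<leadsto> (x \<leadsto> z) \<preceq> (x \<odot> y) \<leadsto> z"
proof -
  have "(x \<odot> y) \<odot> (y \<leadsto> x \<leadsto> z) \<preceq> x \<odot> (y \<odot> (y \<leadsto> x \<leadsto> z))" by (rule assoc)
  also have "\<dots> \<preceq> x \<odot> (x \<leadsto> z)" using mp mul_mono refl by blast
  also have "\<dots> \<preceq> z" by (rule mp)
  finally show ?thesis using res by blast
qed

lemma absorb: "x \<odot> (x \<odot> y) \<preceq> x \<odot> y" and absorb': "x \<odot> y \<preceq> x \<odot> (x \<odot> y)"
  using assoc assoc' idem1 idem2 mul_mono refl trans by meson+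

lemma st_le: "x \<preceq> st y \<longleftrightarrow> y \<odot> x \<preceq> e" and st_le': "x \<preceq> st y \<longleftrightarrow> x \<odot> y \<preceq> e"
  unfolding st_def using res res' by blast+

lemma st_galois: "x \<preceq> st y \<longleftrightarrow> y \<preceq> st x"
  using st_le st_le' by blast

lemma st_anti: "x \<preceq> y \<Longrightarrow> st y \<preceq> st x"
  unfolding st_def using imp_mono refl by blast

lemma st_st: "x \<preceq> st (st x)"
  using st_galois refl by blast

lemma st3: "st (st (st x)) \<preceq> st x"
  using st_anti st_st by blast

lemma st_mono2: "x \<preceq> y \<Longrightarrow> st (st x) \<preceq> st (st y)"
  using st_anti by blast

lemma e_st: "e \<preceq> st x \<longleftrightarrow> x \<preceq> e"
  unfolding st_def by (rule one_le_imp)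

lemma gsm': "e \<preceq> x \<Longrightarrow> st (st x) \<preceq> x"
proof -
  assume a: "e \<preceq> x"
  have "st (st x) \<preceq> st (st (jn x e))" using jn1 st_mono2 by blast
  also have "\<dots> \<preceq> jn x e" using gsm unfolding st_def .
  also have "\<dots> \<preceq> x" using a jn_iff refl by blast
  finally show ?thesis .
qed

lemma x_st: "x \<odot> st x \<preceq> e" and x_st': "st x \<odot> x \<preceq> e"
  using mp mp' unfolding st_def by blast+

lemma mt_mono: "x \<preceq> x' \<Longrightarrow> y \<preceq> y' \<Longrightarrow> mt x y \<preceq> mt x' y'"
  using mt_iff mt1 mt2 trans by meson

lemma mul_mt: "mt x e \<odot> mt y e \<preceq> mt x y"
proof -
  have "mt x e \<odot> mt y e \<preceq> x \<odot> e" using mt1 mt2 mul_mono by blast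
  moreover have "mt x e \<odot> mt y e \<preceq> e \<odot> y" using mt1 mt2 mul_mono by blast
  ultimately show ?thesis using unit1 unit3 trans mt_iff by blast
qed

lemma mul_le1: "x \<preceq> e \<Longrightarrow> x \<odot> y \<preceq> y" and mul_le2: "y \<preceq> e \<Longrightarrow> x \<odot> y \<preceq> x"
  using mul_mono refl unit1 unit3 trans by blast+

lemma mul_ge1: "e \<preceq> x \<Longrightarrow> y \<preceq> x \<odot> y" and mul_ge2: "e \<preceq> y \<Longrightarrow> x \<preceq> x \<odot> y"
  using mul_mono refl unit2 unit4 trans by blast+

text \<open>Multiplying \<open>x \<odot> y \<approx> e\<close> by \<open>x\<close> and using idempotence gives \<open>x \<approx> e\<close>.\<close>

lemma unit_factor:
  assumes "x \<odot> y \<preceq> e" "e \<preceq> x \<odot> y"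
  shows "x \<preceq> e" "e \<preceq> x" "y \<preceq> e" "e \<preceq> y"
proof -
  have *: "a \<preceq> e \<and> e \<preceq> a" if "a \<odot> b \<preceq> e" "e \<preceq> a \<odot> b" for a b
  proof
    have "a \<preceq> a \<odot> (a \<odot> b)" using that(2) by (rule mul_ge2)
    thus "a \<preceq> e" using absorb that(1) trans by blast
    have "a \<odot> (a \<odot> b) \<preceq> a" using that(1) by (rule mul_le2)
    thus "e \<preceq> a" using absorb' that(2) trans by blast
  qed
  show "x \<preceq> e" "e \<preceq> x" using * assms by auto
  have "y \<odot> x \<preceq> e" "e \<preceq> y \<odot> x" using assms comm trans by blast+
  thus "y \<preceq> e" "e \<preceq> y" using * by auto
qed

lemma decomp1: "mt x e \<odot> jn x e \<preceq> x"
proof -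
  have "x \<preceq> mt x e \<leadsto> x" using mul_le1[OF mt2] res by blast
  moreover have "e \<preceq> mt x e \<leadsto> x" using mt1 one_le_imp by blast
  ultimately show ?thesis using res jn_iff by blast
qed

lemma decomp2: "x \<preceq> mt x e \<odot> jn x e"
proof -
  have "x \<odot> mt x e \<preceq> mt x e \<odot> jn x e" using comm mul_mono[OF refl jn1] trans by blast
  moreover have "x \<odot> mt (st x) e \<preceq> mt x e"
    using mul_le2[OF mt2] mul_mono[OF refl mt1] x_st trans mt_iff by meson
  hence "x \<odot> mt (st x) e \<preceq> mt x e \<odot> jn x e"
    using mul_ge2[OF jn2] trans by blast
  ultimately have "jn (mt x e) (mt (st x) e) \<preceq> x \<leadsto> mt x e \<odot> jn x e"
    using res jn_iff by blast
  hence "e \<preceq> x \<leadsto> mt x e \<odot> jn x e" using semic trans unfolding st_def by blast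
  thus ?thesis using one_le_imp by blast
qed

lemma st_jn1: "st (jn x e) \<preceq> mt (st x) e"
proof -
  have "st (jn x e) \<preceq> st e" using st_anti jn2 by blast
  also have "st e \<preceq> e" using mp unit2 trans unfolding st_def by blast
  finally show ?thesis using mt_iff st_anti jn1 by blast
qed

lemma st_jn2: "mt (st x) e \<preceq> st (jn x e)"
proof -
  have "x \<preceq> st (mt (st x) e)" using mt1 st_galois by blast
  moreover have "e \<preceq> st (mt (st x) e)" using mt2 e_st by blast
  ultimately show ?thesis using jn_iff st_galois by blast
qed

section \<open>Deductive filters and the preorders of their quotients\<close>

definition filt :: "'a set \<Rightarrow> bool" where
  "filt F \<longleftrightarrow> e \<in> F \<and> (\<forall>x y. x \<in> F \<longrightarrow> x \<preceq> y \<longrightarrow> y \<in> F) \<and> (\<forall>x\<in>F. \<forall>y\<in>F. x \<odot> y \<in> F) \<and>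
     (\<forall>x\<in>F. mt x e \<in> F)"

lemma filtD: assumes "filt F"
  shows "e \<in> F" "x \<in> F \<Longrightarrow> x \<preceq> y \<Longrightarrow> y \<in> F" "x \<in> F \<Longrightarrow> y \<in> F \<Longrightarrow> x \<odot> y \<in> F"
    "x \<in> F \<Longrightarrow> mt x e \<in> F"
  using assms unfolding filt_def by blast+

lemma filt_mt: "filt F \<Longrightarrow> mt x y \<in> F \<longleftrightarrow> x \<in> F \<and> y \<in> F"
  using filtD mul_mt mt1 mt2 by meson

lemma filt_e: "filt F \<Longrightarrow> e \<preceq> x \<Longrightarrow> x \<in> F"
  using filtD by blast

definition lef :: "'a set \<Rightarrow> 'a \<Rightarrow> 'a \<Rightarrow> bool" where "lef F x y \<longleftrightarrow> x \<leadsto> y \<in> F"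

lemma le_lef: "filt F \<Longrightarrow> x \<preceq> y \<Longrightarrow> lef F x y"
  unfolding lef_def using filt_e one_le_imp by blast

lemma mem_lef: assumes "filt F" shows "x \<in> F \<longleftrightarrow> lef F e x"
proof -
  have "e \<leadsto> x \<preceq> x" "x \<preceq> e \<leadsto> x" using mp unit2 trans res unit1 by blast+
  thus ?thesis unfolding lef_def using filtD(2)[OF assms] by blast
qed

text \<open>Laws that are plain inequalities pass to the coarser preorder by \<open>le_lef\<close>.
  The others are implications between inequalities; each has an internal form, such as
  \<open>imp_trans\<close> or currying, and closure of \<open>F\<close> under products and meets
  turns that form into the law.\<close>

lemma preordered_rl_lef:
  assumes F: "filt F"
  shows "preordered_rl (lef F) (\<odot>) (\<leadsto>) mt jn e"
proof
  note L = le_lef[OF F]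
  fix x y z
  show "lef F x x" "lef F (x \<odot> y) (y \<odot> x)" "lef F ((x \<odot> y) \<odot> z) (x \<odot> (y \<odot> z))"
    "lef F (e \<odot> x) x" "lef F x (e \<odot> x)" "lef F x (x \<odot> x)" "lef F (x \<odot> x) x"
    "lef F e (jn (mt x e) (mt (x \<leadsto> e) e))" "lef F (((jn x e) \<leadsto> e) \<leadsto> e) (jn x e)"
    by (rule L, simp_all add: comm assoc unit1 unit2 idem1 idem2 semic gsm)+
  show "lef F x y \<Longrightarrow> lef F y z \<Longrightarrow> lef F x z"
    unfolding lef_def using imp_trans filtD[OF F] by blast
  show "lef F (x \<odot> y) z = lef F y (x \<leadsto> z)"
    unfolding lef_def using curry1 curry2 filtD(2)[OF F] by blast
  have "mt (z \<leadsto> x) (z \<leadsto> y) \<preceq> z \<leadsto> mt x y"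
    using mt1 mt2 res trans mt_iff by meson
  moreover have "z \<leadsto> mt x y \<preceq> mt (z \<leadsto> x) (z \<leadsto> y)"
    using mt1 mt2 refl imp_mono mt_iff by meson
  ultimately show "lef F z (mt x y) = (lef F z x \<and> lef F z y)"
    unfolding lef_def using filt_mt[OF F] filtD(2)[OF F] by blast
  have "jn x y \<preceq> mt (x \<leadsto> z) (y \<leadsto> z) \<leadsto> z"
    using mt1 mt2 res res' trans jn_iff by meson
  hence "mt (x \<leadsto> z) (y \<leadsto> z) \<preceq> jn x y \<leadsto> z" using res res' by blast
  moreover have "jn x y \<leadsto> z \<preceq> mt (x \<leadsto> z) (y \<leadsto> z)"
    using jn1 jn2 refl imp_mono mt_iff by meson
  ultimately show "lef F (jn x y) z = (lef F x z \<and> lef F y z)"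
    unfolding lef_def using filt_mt[OF F] filtD(2)[OF F] by blast
qed

end

section \<open>Conic quotients: the positive chain and sign criteria\<close>

locale conic_preordered_rl = preordered_rl +
  assumes conic: "x \<preceq> e \<or> e \<preceq> x"
    and jirr: "x \<preceq> e \<Longrightarrow> y \<preceq> e \<Longrightarrow> e \<preceq> jn x y \<Longrightarrow> e \<preceq> x \<or> e \<preceq> y"
begin

lemma e_jn: "e \<preceq> jn x y \<longleftrightarrow> e \<preceq> x \<or> e \<preceq> y"
  using conic jirr jn1 jn2 trans by blast

text \<open>Conicity is applied to \<open>st x \<odot> y\<close>: below \<open>e\<close> it gives
  \<open>y\<close> below the double star of \<open>x\<close>, which is \<open>x\<close> by
  \<open>gsm'\<close>; above \<open>e\<close>, multiplying by \<open>x\<close> gives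
  \<open>x\<close> below \<open>y\<close>.\<close>

lemma pos_chain: assumes "e \<preceq> x" "e \<preceq> y" shows "x \<preceq> y \<or> y \<preceq> x"
proof (cases "st x \<odot> y \<preceq> e")
  case True
  hence "y \<preceq> st (st x)" using st_le by blast
  thus ?thesis using gsm' assms trans by blast
next
  case False
  hence "e \<preceq> st x \<odot> y" using conic by blast
  hence "x \<preceq> x \<odot> (st x \<odot> y)" by (rule mul_ge2)
  also have "\<dots> \<preceq> (x \<odot> st x) \<odot> y" by (rule assoc')
  also have "\<dots> \<preceq> y" using x_st by (rule mul_le1)
  finally show ?thesis ..
qed

lemma mt_le_e: "mt x y \<preceq> e \<longleftrightarrow> x \<preceq> e \<or> y \<preceq> e"
proof
  assume a: "mt x y \<preceq> e"
  show "x \<preceq> e \<or> y \<preceq> e"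
  proof (rule ccontr)
    assume n: "\<not> ?thesis"
    hence "x \<preceq> y \<or> y \<preceq> x" using pos_chain conic by blast
    hence "x \<preceq> mt x y \<or> y \<preceq> mt x y" using mt_iff refl by blast
    thus False using n a trans by blast
  qed
qed (use mt1 mt2 trans in blast)

lemma mt_e: "x \<preceq> e \<Longrightarrow> x \<preceq> mt x e" and mt_e': "e \<preceq> x \<Longrightarrow> e \<preceq> mt x e"
  using mt_iff refl by blast+

text \<open>The order can be tested on the negative parts of \<open>x\<close> and
  \<open>st y\<close> alone, and this is what inclusions between sets of primes can express;
  \<open>rp_le\<close> rests on it. For positive elements the stars are compared and
  \<open>gsm'\<close> undoes the star.\<close>

lemma le_char: "x \<preceq> y \<longleftrightarrow> mt x e \<preceq> y \<and> mt (st y) e \<preceq> st x"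
proof
  assume "x \<preceq> y"
  thus "mt x e \<preceq> y \<and> mt (st y) e \<preceq> st x" using mt1 st_anti trans by meson
next
  assume a: "mt x e \<preceq> y \<and> mt (st y) e \<preceq> st x"
  show "x \<preceq> y"
  proof (cases "x \<preceq> e")
    case True thus ?thesis using a mt_e trans by blast
  next
    case False
    hence x: "e \<preceq> x" using conic by blast
    hence y: "e \<preceq> y" using a mt_e' trans by blast
    have "st y \<preceq> st e" using y st_anti by blast
    hence "st y \<preceq> e" using mp unit2 trans unfolding st_def by meson
    hence "st y \<preceq> st x" using a mt_e trans by blast
    hence "st (st x) \<preceq> st (st y)" by (rule st_anti)
    thus ?thesis using st_st gsm'[OF y] trans by blast
  qed
qed

text \<open>The right-hand side becomes the case distinction in \<open>fmul\<close>. If both factors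
  are positive, it makes both stars positive too, so that both factors are also below
  \<open>e\<close>.\<close>

lemma mul_e: "x \<odot> y \<preceq> e \<longleftrightarrow> mt x e \<preceq> st y \<and> mt y e \<preceq> st x"
proof
  assume "x \<odot> y \<preceq> e"
  hence "x \<preceq> st y" "y \<preceq> st x" using st_le st_le' by blast+
  thus "mt x e \<preceq> st y \<and> mt y e \<preceq> st x" using mt1 trans by blast
next
  assume a: "mt x e \<preceq> st y \<and> mt y e \<preceq> st x"
  consider "x \<preceq> e" | "y \<preceq> e" | "e \<preceq> x" "e \<preceq> y" using conic by blast
  thus "x \<odot> y \<preceq> e"
  proof cases
    case 1 thus ?thesis using a mt_e trans st_le' by blast
  next
    case 2 thus ?thesis using a mt_e trans st_le by blast
  next
    case 3
    hence "e \<preceq> st y" "e \<preceq> st x" using a mt_e' trans by blast+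
    hence "x \<preceq> e" "y \<preceq> e" using e_st by blast+
    thus ?thesis using mul_le1 trans by blast
  qed
qed

text \<open>Where \<open>x \<preceq> y\<close>, the element \<open>x \<leadsto> y\<close> is positive, and its position relative to \<open>e\<close> is that of
  \<open>jn (st x) y\<close>.\<close>

lemma imp_le_e:
  assumes "x \<preceq> y"
  shows "x \<leadsto> y \<preceq> e \<longleftrightarrow> e \<preceq> st (st x) \<and> y \<preceq> e"
proof
  assume a: "x \<leadsto> y \<preceq> e"
  show "e \<preceq> st (st x) \<and> y \<preceq> e"
  proof (cases "x \<preceq> e")
    case True
    have "x \<odot> st x \<preceq> x \<odot> (x \<odot> st x)" by (rule absorb')
    also have "\<dots> \<preceq> x" using x_st by (rule mul_le2)
    finally have "x \<odot> st x \<preceq> y" using assms trans by blast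
    hence "st x \<preceq> e" using res a trans by blast
    moreover have "y \<preceq> e" using mul_le1[OF True] res a trans by blast
    ultimately show ?thesis using e_st by blast
  next
    case False
    hence x: "e \<preceq> x" using conic by blast
    have "x \<odot> y \<preceq> y \<odot> y" using assms mul_mono refl by blast
    hence "x \<odot> y \<preceq> y" using idem2 trans by blast
    hence "y \<preceq> e" using res a trans by blast
    thus ?thesis using False assms trans by blast
  qed
next
  assume a: "e \<preceq> st (st x) \<and> y \<preceq> e"
  have "x \<leadsto> y \<preceq> st x" using a imp_mono refl unfolding st_def by blast
  thus "x \<leadsto> y \<preceq> e" using a e_st trans by blast
qed

text \<open>If \<open>e \<preceq> x \<odot> (x \<leadsto> y)\<close>, then \<open>x \<preceq> x \<odot> x \<odot> (x \<leadsto> y) \<preceq> y\<close>.\<close>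

lemma imp_bound: assumes "\<not> x \<preceq> y" shows "x \<odot> (x \<leadsto> y) \<preceq> e"
proof (rule ccontr)
  assume "\<not> ?thesis"
  hence "e \<preceq> x \<odot> (x \<leadsto> y)" using conic by blast
  hence "x \<preceq> x \<odot> (x \<odot> (x \<leadsto> y))" by (rule mul_ge2)
  hence "x \<preceq> y" using absorb mp trans by blast
  thus False using assms by blast
qed

lemma st_st_meet: "mt (st (st x)) e \<preceq> st (st (mt x e))"
proof (cases "x \<preceq> e")
  case True thus ?thesis using mt1 mt_e st_mono2 trans by blast
next
  case False
  hence "e \<preceq> mt x e" using conic mt_e' by blast
  thus ?thesis using mt2 st_st trans by blast
qed

end

section \<open>Prime and nuclear filters\<close>

context preordered_rl
begin

text \<open>Primeness is tested on negative elements only. This already makes the quotient conic,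
  and \<open>prime_jn\<close> then recovers it for arbitrary joins.\<close>

definition prime :: "'a set \<Rightarrow> bool" where
  "prime P \<longleftrightarrow> filt P \<and> (\<forall>x y. x \<preceq> e \<longrightarrow> y \<preceq> e \<longrightarrow> jn x y \<in> P \<longrightarrow> x \<in> P \<or> y \<in> P)"

lemma prime_filt: "prime P \<Longrightarrow> filt P"
  unfolding prime_def by blast

text \<open>By \<open>semic\<close> the unit is below a join of two negative elements; a prime
  contains one of them, and this is conicity of the quotient. For \<open>jirr\<close>, elements that
  are negative only modulo \<open>P\<close> are first replaced by their meets with
  \<open>e\<close>.\<close>

lemma conic_preordered_rl_lef:
  assumes P: "prime P"
  shows "conic_preordered_rl (lef P) (\<odot>) (\<leadsto>) mt jn e"
proof -
  have F: "filt P" using P by (rule prime_filt)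
  interpret L: preordered_rl "lef P" "(\<odot>)" "(\<leadsto>)" mt jn e using F by (rule preordered_rl_lef)
  have pr: "x \<in> P \<or> y \<in> P" if "jn (mt x e) (mt y e) \<in> P" for x y
    using that P mt2 filt_mt[OF F] unfolding prime_def by blast
  show ?thesis
  proof
    fix x y
    have "jn (mt x e) (mt (x \<leadsto> e) e) \<in> P" using semic filt_e[OF F] by blast
    hence "x \<in> P \<or> x \<leadsto> e \<in> P" by (rule pr)
    thus "lef P x e \<or> lef P e x" using mem_lef[OF F] unfolding lef_def by blast
    assume "lef P x e" "lef P y e" "lef P e (jn x y)"
    moreover have "lef P (jn x y) (jn (mt x e) (mt y e))"
    proof -
      have "lef P x (mt x e)" "lef P y (mt y e)"
        using L.mt_iff L.refl \<open>lef P x e\<close> \<open>lef P y e\<close> by blast+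
      hence "lef P x (jn (mt x e) (mt y e))" "lef P y (jn (mt x e) (mt y e))"
        using L.jn1 L.jn2 L.trans by blast+
      thus ?thesis using L.jn_iff by blast
    qed
    ultimately have "jn (mt x e) (mt y e) \<in> P" using L.trans mem_lef[OF F] by blast
    hence "x \<in> P \<or> y \<in> P" by (rule pr)
    thus "lef P e x \<or> lef P e y" using mem_lef[OF F] by blast
  qed
qed

lemma prime_jn: assumes "prime P" shows "jn x y \<in> P \<longleftrightarrow> x \<in> P \<or> y \<in> P"
proof -
  interpret L: conic_preordered_rl "lef P" "(\<odot>)" "(\<leadsto>)" mt jn e using assms by (rule conic_preordered_rl_lef)
  show ?thesis using L.e_jn mem_lef[OF prime_filt[OF assms]] by blast
qed

section \<open>The prime filter theorem\<close>

definition adjoin :: "'a set \<Rightarrow> 'a \<Rightarrow> 'a set" where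
  "adjoin F x = {c. \<exists>p\<in>F. p \<odot> mt x e \<preceq> c}"

lemma mul4: "(a \<odot> b) \<odot> (c \<odot> d) \<preceq> (a \<odot> c) \<odot> (b \<odot> d)"
proof -
  have "(a \<odot> b) \<odot> (c \<odot> d) \<preceq> a \<odot> (b \<odot> (c \<odot> d))" by (rule assoc)
  also have "\<dots> \<preceq> a \<odot> ((b \<odot> c) \<odot> d)" using assoc' mul_mono refl by blast
  also have "\<dots> \<preceq> a \<odot> ((c \<odot> b) \<odot> d)" using comm mul_mono refl by blast
  also have "\<dots> \<preceq> a \<odot> (c \<odot> (b \<odot> d))" using assoc mul_mono refl by blast
  also have "\<dots> \<preceq> (a \<odot> c) \<odot> (b \<odot> d)" by (rule assoc')
  finally show ?thesis .
qed

lemma filt_closure: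
  assumes "G \<noteq> {}" "\<And>x y. x \<in> G \<Longrightarrow> y \<in> G \<Longrightarrow> \<exists>z\<in>G. z \<preceq> e \<and> z \<preceq> x \<odot> y"
  shows "filt {c. \<exists>g\<in>G. g \<preceq> c}"
  unfolding filt_def
proof (intro conjI ballI allI impI)
  have *: "\<exists>z\<in>G. z \<preceq> e \<and> z \<preceq> x" if "x \<in> G" for x
    using assms(2)[OF that that] idem2 trans by blast
  show "e \<in> {c. \<exists>g\<in>G. g \<preceq> c}" using * assms(1) by blast
  show "x \<in> {c. \<exists>g\<in>G. g \<preceq> c} \<Longrightarrow> x \<preceq> y \<Longrightarrow> y \<in> {c. \<exists>g\<in>G. g \<preceq> c}" for x y
    using trans by blast
  show "x \<odot> y \<in> {c. \<exists>g\<in>G. g \<preceq> c}" if xy: "x \<in> {c. \<exists>g\<in>G. g \<preceq> c}" "y \<in> {c. \<exists>g\<in>G. g \<preceq> c}" for x y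
  proof -
    obtain g h where g: "g \<in> G" "g \<preceq> x" "h \<in> G" "h \<preceq> y" using xy by auto
    then obtain z where "z \<in> G" "z \<preceq> g \<odot> h" using assms(2) by blast
    thus ?thesis using mul_mono[OF g(2,4)] trans by blast
  qed
  show "mt x e \<in> {c. \<exists>g\<in>G. g \<preceq> c}" if x: "x \<in> {c. \<exists>g\<in>G. g \<preceq> c}" for x
  proof -
    obtain g where g: "g \<in> G" "g \<preceq> x" using x by auto
    then obtain z where "z \<in> G" "z \<preceq> e" "z \<preceq> g" using * by blast
    thus ?thesis using g trans mt_iff by blast
  qed
qed

text \<open>\<open>adjoin F x\<close> is the filter generated by \<open>F\<close> and
  \<open>x\<close>: by idempotence a single factor \<open>mt x e\<close> stands for all its powers.
  Meeting the product of two members of \<open>F\<close> with \<open>e\<close> yields the negative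
  lower bound that \<open>filt_closure\<close> asks for.\<close>

lemma adjoin:
  assumes F: "filt F"
  shows "filt (adjoin F x)" "F \<subseteq> adjoin F x" "x \<in> adjoin F x"
proof -
  let ?G = "(\<lambda>p. p \<odot> mt x e) ` F"
  have eq: "adjoin F x = {c. \<exists>g\<in>?G. g \<preceq> c}" unfolding adjoin_def by blast
  show "filt (adjoin F x)" unfolding eq
  proof (rule filt_closure)
    show "?G \<noteq> {}" using filtD(1)[OF F] by blast
    fix g h assume "g \<in> ?G" "h \<in> ?G"
    then obtain p q where p: "p \<in> F" "q \<in> F" and g: "g = p \<odot> mt x e" "h = q \<odot> mt x e" by blast
    let ?r = "mt (p \<odot> q) e"
    have "?r \<in> F" using p filtD[OF F] by blast
    moreover have "?r \<odot> mt x e \<preceq> e" using mt2 mul_le2 trans by blast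
    moreover have "?r \<odot> mt x e \<preceq> (p \<odot> q) \<odot> (mt x e \<odot> mt x e)" using mt1 idem1 mul_mono by blast
    hence "?r \<odot> mt x e \<preceq> g \<odot> h" unfolding g using mul4 trans by blast
    ultimately show "\<exists>z\<in>?G. z \<preceq> e \<and> z \<preceq> g \<odot> h" by blast
  qed
  show "F \<subseteq> adjoin F x" unfolding adjoin_def using mul_le2[OF mt2] by blast
  show "x \<in> adjoin F x" unfolding adjoin_def using mul_le1 refl filtD(1)[OF F] mt1 trans by blast
qed

text \<open>A filter maximal among those avoiding \<open>J\<close> is prime: adjoining either of two
  negative non-members reaches \<open>J\<close>, and distributing the product over the join would
  put a common upper bound in \<open>J\<close> into the filter. \<open>J\<close> is only directed,
  not an ideal, so that it can be the image of the complement of a prime under an embedding.\<close>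

lemma prime_filter:
  assumes F: "filt F" and J: "F \<inter> J = {}" "\<And>x y. x \<in> J \<Longrightarrow> y \<in> J \<Longrightarrow> \<exists>z\<in>J. x \<preceq> z \<and> y \<preceq> z"
  shows "\<exists>P. prime P \<and> F \<subseteq> P \<and> P \<inter> J = {}"
proof -
  let ?A = "{G. filt G \<and> F \<subseteq> G \<and> G \<inter> J = {}}"
  have "\<exists>M\<in>?A. \<forall>X\<in>?A. M \<subseteq> X \<longrightarrow> X = M"
  proof (rule subset_Zorn_nonempty)
    show "?A \<noteq> {}" using F J by blast
    fix C assume C: "C \<noteq> {}" "subset.chain ?A C"
    hence ch: "\<And>X Y. X \<in> C \<Longrightarrow> Y \<in> C \<Longrightarrow> X \<subseteq> Y \<or> Y \<subseteq> X" and CA: "\<And>X. X \<in> C \<Longrightarrow> X \<in> ?A"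
      unfolding subset.chain_def by blast+
    have "filt (\<Union>C)" unfolding filt_def
    proof (intro conjI ballI allI impI)
      show "e \<in> \<Union>C" using C(1) CA filtD(1) by blast
      show "x \<in> \<Union>C \<Longrightarrow> x \<preceq> y \<Longrightarrow> y \<in> \<Union>C" for x y using CA filtD(2) by blast
      show "x \<in> \<Union>C \<Longrightarrow> mt x e \<in> \<Union>C" for x using CA filtD(4) by blast
      fix x y assume "x \<in> \<Union>C" "y \<in> \<Union>C"
      then obtain X Y where "X \<in> C" "Y \<in> C" "x \<in> X" "y \<in> Y" by blast
      moreover from this ch have "X \<subseteq> Y \<or> Y \<subseteq> X" by blast
      ultimately show "x \<odot> y \<in> \<Union>C" using CA filtD(3) by blast
    qed
    thus "\<Union>C \<in> ?A" using C CA by blast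
  qed
  then obtain P where "P \<in> ?A" and mx: "\<forall>X\<in>?A. P \<subseteq> X \<longrightarrow> X = P" ..
  hence P: "filt P" "F \<subseteq> P" "P \<inter> J = {}" by blast+
  have max: "X = P" if "filt X" "F \<subseteq> X" "X \<inter> J = {}" "P \<subseteq> X" for X
    using mx that by blast
  have meets: "\<exists>p\<in>P. \<exists>j\<in>J. p \<preceq> e \<and> p \<odot> x \<preceq> j" if "x \<notin> P" "x \<preceq> e" for x
  proof -
    have "adjoin P x \<inter> J \<noteq> {}" using max[of "adjoin P x"] adjoin[OF P(1), of x] P(2) that by blast
    then obtain p j where p: "p \<in> P" "j \<in> J" "p \<odot> mt x e \<preceq> j" unfolding adjoin_def by blast
    have "mt p e \<odot> x \<preceq> p \<odot> mt x e" using mt1 that mt_iff refl mul_mono by blast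
    thus ?thesis using p mt2 filtD(4)[OF P(1)] trans by blast
  qed
  have "x \<in> P \<or> y \<in> P" if xy: "x \<preceq> e" "y \<preceq> e" "jn x y \<in> P" for x y
  proof (rule ccontr)
    assume "\<not> ?thesis"
    then obtain p j q k where p: "p \<in> P" "j \<in> J" "p \<preceq> e" "p \<odot> x \<preceq> j"
      and q: "q \<in> P" "k \<in> J" "q \<preceq> e" "q \<odot> y \<preceq> k" using meets xy by meson
    obtain l where l: "l \<in> J" "j \<preceq> l" "k \<preceq> l" using J(2) p q by blast
    have "(p \<odot> q) \<odot> x \<preceq> l" using mul_mono[OF mul_le2[OF q(3)] refl] p l trans by blast
    moreover have "(p \<odot> q) \<odot> y \<preceq> l" using mul_mono[OF mul_le1[OF p(3)] refl] q l trans by blast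
    ultimately have "(p \<odot> q) \<odot> jn x y \<preceq> l" using res jn_iff by blast
    moreover have "(p \<odot> q) \<odot> jn x y \<in> P" using p(1) q(1) xy(3) filtD(3)[OF P(1)] by blast
    ultimately have "l \<in> P" using filtD(2)[OF P(1)] by blast
    thus False using l P by blast
  qed
  thus ?thesis using P unfolding prime_def by blast
qed

lemma prime_sep:
  assumes P: "filt P" and x: "mt x e \<leadsto> w \<notin> P"
  shows "\<exists>Q. prime Q \<and> P \<subseteq> Q \<and> x \<in> Q \<and> w \<notin> Q"
proof -
  have "adjoin P x \<inter> {w} = {}"
    unfolding adjoin_def using x res' filtD(2)[OF P] by blast
  then obtain Q where "prime Q" "adjoin P x \<subseteq> Q" "Q \<inter> {w} = {}"
    using prime_filter[OF adjoin(1)[OF P], of x "{w}"] by auto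
  thus ?thesis using adjoin[OF P, of x] by blast
qed

lemma filt_principal: "filt {z. e \<preceq> z}"
proof -
  have "filt {c. \<exists>g\<in>{e}. g \<preceq> c}" by (rule filt_closure) (use refl unit2 in auto)
  thus ?thesis by simp
qed

lemma prime_separate: assumes "\<not> x \<preceq> y" shows "\<exists>P. prime P \<and> \<not> lef P x y"
proof -
  have "{z. e \<preceq> z} \<inter> {x \<leadsto> y} = {}" using assms one_le_imp by blast
  then obtain P where "prime P" "P \<inter> {x \<leadsto> y} = {}"
    using prime_filter[OF filt_principal, of "{x \<leadsto> y}"] by auto
  thus ?thesis unfolding lef_def by blast
qed

section \<open>Nuclear primes\<close>

definition nuclear :: "'a set \<Rightarrow> bool" where
  "nuclear P \<longleftrightarrow> prime P \<and> (\<forall>b. st (st b) \<in> P \<longrightarrow> b \<in> P)"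

text \<open>Take \<open>p\<close> in \<open>P\<close> only and \<open>q\<close> in \<open>Q\<close>
  only, and compare \<open>p \<odot> st q\<close> with \<open>e\<close> modulo \<open>R\<close>.
  Below \<open>e\<close>, the double star of \<open>q\<close> lies above \<open>p\<close>, and
  nuclearity puts \<open>q\<close> into \<open>P\<close>. Above \<open>e\<close>, multiplying by
  \<open>q\<close> gives \<open>q\<close> below \<open>p\<close>, so \<open>p\<close> is in
  \<open>Q\<close>.\<close>

lemma nuc_comparable:
  assumes P: "nuclear P" and R: "prime R" "R \<subseteq> P" and Q: "prime Q" "R \<subseteq> Q"
  shows "P \<subseteq> Q \<or> Q \<subseteq> P"
proof (rule ccontr)
  assume "\<not> ?thesis"
  hence "\<not> P \<subseteq> Q" "\<not> Q \<subseteq> P" by simp_all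
  then obtain p q where p: "p \<in> P" "p \<notin> Q" and q: "q \<in> Q" "q \<notin> P" unfolding subset_iff by metis
  interpret R: conic_preordered_rl "lef R" "(\<odot>)" "(\<leadsto>)" mt jn e using R(1) by (rule conic_preordered_rl_lef)
  have FP: "filt P" and FQ: "filt Q" using P Q prime_filt unfolding nuclear_def by blast+
  from R.conic[of "p \<odot> st q"] show False
  proof
    assume "lef R (p \<odot> st q) e"
    hence "lef R p (st (st q))" using R.st_le' by blast
    hence "p \<leadsto> st (st q) \<in> P" using R(2) unfolding lef_def by blast
    hence "p \<odot> (p \<leadsto> st (st q)) \<in> P" using p(1) filtD(3)[OF FP] by blast
    hence "st (st q) \<in> P" using filtD(2)[OF FP] mp by blast
    thus False using q P unfolding nuclear_def by blast
  next
    assume "lef R e (p \<odot> st q)"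
    hence "lef R q (q \<odot> (p \<odot> st q))" by (rule R.mul_ge2)
    moreover have "lef R (q \<odot> (p \<odot> st q)) (p \<odot> (q \<odot> st q))"
      using R.assoc R.assoc' R.comm R.mul_mono R.refl R.trans by meson
    moreover have "lef R (p \<odot> (q \<odot> st q)) p" using R.x_st by (rule R.mul_le2)
    ultimately have "lef R q p" using R.trans by blast
    hence "q \<leadsto> p \<in> Q" using Q(2) unfolding lef_def by blast
    hence "q \<odot> (q \<leadsto> p) \<in> Q" using q(1) filtD(3)[OF FQ] by blast
    hence "p \<in> Q" using filtD(2)[OF FQ] mp by blast
    thus False using p by blast
  qed
qed

text \<open>Removes only what must be removed: if \<open>mt c e\<close> is below the double star of
  \<open>t\<close> modulo \<open>Q\<close>, a nuclear filter above \<open>Q\<close> that contains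
  \<open>c\<close> also contains \<open>t\<close>. So under the hypotheses of \<open>cut_nuc\<close>
  this is the greatest nuclear prime above \<open>Q\<close> that avoids \<open>T\<close>.\<close>

definition cut :: "'a set \<Rightarrow> 'a set \<Rightarrow> 'a set" where
  "cut Q T = {c. \<forall>t\<in>T. mt c e \<leadsto> st (st t) \<notin> Q}"

text \<open>Products are the delicate point and need conicity modulo \<open>Q\<close>. Primeness
  comes from directedness of \<open>T\<close>, and nuclearity holds because the bounds used in
  \<open>cut\<close> are themselves double stars.\<close>

lemma cut_nuc:
  assumes Q: "prime Q" and T: "\<And>t. t \<in> T \<Longrightarrow> st (st t) \<notin> Q"
    "\<And>x y. x \<in> T \<Longrightarrow> y \<in> T \<Longrightarrow> \<exists>z\<in>T. x \<preceq> z \<and> y \<preceq> z"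
  shows "nuclear (cut Q T)" "Q \<subseteq> cut Q T" "T \<inter> cut Q T = {}"
proof -
  interpret Q: conic_preordered_rl "lef Q" "(\<odot>)" "(\<leadsto>)" mt jn e using Q by (rule conic_preordered_rl_lef)
  note FQ = prime_filt[OF Q]
  have cut: "c \<in> cut Q T \<longleftrightarrow> (\<forall>t\<in>T. \<not> lef Q (mt c e) (st (st t)))" for c
    unfolding cut_def lef_def by blast
  have Tn: "\<not> lef Q e (st (st t))" if "t \<in> T" for t using T that mem_lef[OF FQ] by blast
  have *: "mt c e \<in> cut Q T \<longleftrightarrow> c \<in> cut Q T" for c
    unfolding cut using Q.mt1 Q.mt2 Q.mt_iff Q.refl Q.trans by meson
  have up: "d \<in> cut Q T" if "c \<in> cut Q T" "lef Q c d" for c d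
    using that Q.mt_mono Q.refl Q.trans unfolding cut by blast
  have e: "e \<in> cut Q T" unfolding cut using Tn Q.mt_iff Q.refl Q.trans by blast
  have mul: "c \<odot> d \<in> cut Q T" if c: "c \<in> cut Q T" "d \<in> cut Q T" for c d
  proof (rule ccontr)
    assume "c \<odot> d \<notin> cut Q T"
    hence "mt c e \<odot> mt d e \<notin> cut Q T"
      using up Q.mul_mono Q.mt1 by blast
    then obtain t where t: "t \<in> T" and "lef Q (mt (mt c e \<odot> mt d e) e) (st (st t))"
      unfolding cut by blast
    moreover have "lef Q (mt c e \<odot> mt d e) (mt (mt c e \<odot> mt d e) e)"
      using Q.mt2 Q.mul_le2 Q.mt_iff Q.refl Q.trans by blast
    ultimately have "lef Q ((mt c e \<odot> mt d e) \<odot> st t) e"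
      using Q.st_le' Q.trans by blast
    \<comment> \<open>Idempotence doubles \<open>st t\<close>, giving one copy to each factor. Both
      factors are then strictly above \<open>e\<close> modulo \<open>Q\<close> while their product
      is equivalent to \<open>e\<close>, against \<open>unit_factor\<close>.\<close>
    hence le: "lef Q ((mt c e \<odot> st t) \<odot> (mt d e \<odot> st t)) e"
      using Q.mul4 Q.idem2 Q.mul_mono Q.refl Q.trans by meson
    have "\<not> lef Q (mt c e \<odot> st t) e" "\<not> lef Q (mt d e \<odot> st t) e"
      using c t unfolding cut using Q.st_le' by blast+
    moreover from this have ge: "lef Q e (mt c e \<odot> st t)" "lef Q e (mt d e \<odot> st t)"
      using Q.conic by blast+
    hence "lef Q e ((mt c e \<odot> st t) \<odot> (mt d e \<odot> st t))" using Q.mul_ge1 Q.trans by blast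
    ultimately show False using le Q.unit_factor by blast
  qed
  have F: "filt (cut Q T)" unfolding filt_def
    using e up mul * le_lef[OF FQ] by blast
  have pr: "x \<in> cut Q T \<or> y \<in> cut Q T" if xy: "x \<preceq> e" "y \<preceq> e" "jn x y \<in> cut Q T" for x y
  proof (rule ccontr)
    assume "\<not> ?thesis"
    then obtain s t where s: "s \<in> T" "lef Q (mt x e) (st (st s))" "t \<in> T" "lef Q (mt y e) (st (st t))"
      unfolding cut by blast
    then obtain u where u: "u \<in> T" "s \<preceq> u" "t \<preceq> u" using T(2) by blast
    have "lef Q x (st (st u))" "lef Q y (st (st u))"
      using s u xy Q.mt_e le_lef[OF FQ] st_mono2 Q.trans by meson+
    hence "lef Q (mt (jn x y) e) (st (st u))" using Q.jn_iff Q.mt1 Q.trans by blast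
    thus False using u xy unfolding cut by blast
  qed
  have "b \<in> cut Q T" if b: "st (st b) \<in> cut Q T" for b
  proof (rule ccontr)
    assume "b \<notin> cut Q T"
    then obtain t where t: "t \<in> T" "lef Q (mt b e) (st (st t))" unfolding cut by blast
    hence "lef Q (st (st (mt b e))) (st (st t))" using Q.st_mono2 Q.st3 Q.trans by blast
    hence "lef Q (mt (st (st b)) e) (st (st t))" using Q.st_st_meet Q.trans by blast
    thus False using b t unfolding cut by blast
  qed
  thus "nuclear (cut Q T)" unfolding nuclear_def prime_def using F pr by blast
  show "Q \<subseteq> cut Q T" using up e mem_lef[OF FQ] by blast
  have "t \<notin> cut Q T" if "t \<in> T" for t
    using that Q.trans[OF Q.mt1 Q.st_st] unfolding cut by blast
  thus "T \<inter> cut Q T = {}" by blast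
qed

text \<open>So the double star of \<open>b\<close> lies in \<open>Q\<close> exactly when
  \<open>b\<close> lies in all nuclear primes above \<open>Q\<close>. This identifies the double
  star with the operator \<open>ga\<close> of a frame.\<close>

lemma nuc_avoid:
  assumes "prime Q" "st (st b) \<notin> Q"
  shows "\<exists>P. nuclear P \<and> Q \<subseteq> P \<and> b \<notin> P"
proof (intro exI conjI)
  show "nuclear (cut Q {b})"
    by (rule cut_nuc(1)[OF assms(1)]) (use assms(2) in auto)
  show "Q \<subseteq> cut Q {b}"
    by (rule cut_nuc(2)[OF assms(1)]) (use assms(2) in auto)
  have "{b} \<inter> cut Q {b} = {}"
    by (rule cut_nuc(3)[OF assms(1)]) (use assms(2) in auto)
  thus "b \<notin> cut Q {b}" by simp
qed

text \<open>By \<open>nuc_comparable\<close> the family is a chain, and an intersection of a chain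
  of primes is prime. It provides the least node over a given trace.\<close>

lemma nuc_Inter:
  assumes "\<Z> \<noteq> {}" and nuclear: "\<And>Z. Z \<in> \<Z> \<Longrightarrow> nuclear Z" and R: "prime R" "\<And>Z. Z \<in> \<Z> \<Longrightarrow> R \<subseteq> Z"
  shows "nuclear (\<Inter>\<Z>)"
proof -
  have pr: "prime Z" if "Z \<in> \<Z>" for Z using nuclear[OF that] unfolding nuclear_def by simp
  have fl: "filt Z" if "Z \<in> \<Z>" for Z using prime_filt[OF pr[OF that]] .
  have F: "filt (\<Inter>\<Z>)" 
    unfolding filt_def
  proof (intro conjI ballI allI impI)
    show "e \<in> \<Inter>\<Z>" using fl filtD(1) by auto
    show "x \<in> \<Inter>\<Z> \<Longrightarrow> x \<preceq> y \<Longrightarrow> y \<in> \<Inter>\<Z>" for x y using fl filtD(2) by blast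
    show "x \<in> \<Inter>\<Z> \<Longrightarrow> y \<in> \<Inter>\<Z> \<Longrightarrow> x \<odot> y \<in> \<Inter>\<Z>" for x y using fl filtD(3) by blast
    show "x \<in> \<Inter>\<Z> \<Longrightarrow> mt x e \<in> \<Inter>\<Z>" for x using fl filtD(4) by blast
  qed
  have "x \<in> \<Inter>\<Z> \<or> y \<in> \<Inter>\<Z>" if xy: "jn x y \<in> \<Inter>\<Z>" for x y
  proof (rule ccontr)
    assume "\<not> ?thesis"
    then obtain Z W where Z: "Z \<in> \<Z>" "x \<notin> Z" "W \<in> \<Z>" "y \<notin> W" by auto
    have "Z \<subseteq> W \<or> W \<subseteq> Z"
      using nuc_comparable[OF nuclear[OF Z(1)] R(1) R(2)[OF Z(1)] pr[OF Z(3)] R(2)[OF Z(3)]] .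
    moreover have "y \<in> Z" "x \<in> W" using xy Z prime_jn[OF pr] by blast+
    ultimately show False using Z by blast
  qed
  moreover have "b \<in> \<Inter>\<Z>" if "st (st b) \<in> \<Inter>\<Z>" for b
    using that nuclear unfolding nuclear_def by blast
  ultimately show ?thesis unfolding nuclear_def prime_def using F by blast
qed

end

section \<open>The conic algebra of a frame\<close>

locale frame =
  fixes X :: "'p set" and fle :: "'p \<Rightarrow> 'p \<Rightarrow> bool" (infix "\<sqsubseteq>" 50) and Y :: "'p set"
  assumes frefl: "x \<in> X \<Longrightarrow> x \<sqsubseteq> x"
    and ftrans: "x \<in> X \<Longrightarrow> y \<in> X \<Longrightarrow> z \<in> X \<Longrightarrow> x \<sqsubseteq> y \<Longrightarrow> y \<sqsubseteq> z \<Longrightarrow> x \<sqsubseteq> z"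
    and YX: "Y \<subseteq> X"
    and node: "y \<in> Y \<Longrightarrow> z \<in> X \<Longrightarrow> y \<sqsubseteq> z \<or> z \<sqsubseteq> y"
begin

definition up :: "'p set \<Rightarrow> bool" where
  "up U \<longleftrightarrow> U \<subseteq> X \<and> (\<forall>x\<in>U. \<forall>z\<in>X. x \<sqsubseteq> z \<longrightarrow> z \<in> U)"

text \<open>The nucleus on up-sets determined by the nodes; it represents the double star on the
  negative cone.\<close>

definition ga :: "'p set \<Rightarrow> 'p set" where
  "ga U = {x \<in> X. \<forall>y\<in>Y. x \<sqsubseteq> y \<longrightarrow> y \<in> U}"

definition cl :: "'p set \<Rightarrow> bool" where
  "cl V \<longleftrightarrow> up V \<and> ga V = V"

text \<open>The Heyting implication of the lattice of up-sets.\<close>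

definition hi :: "'p set \<Rightarrow> 'p set \<Rightarrow> 'p set" where
  "hi U W = {x \<in> X. \<forall>z\<in>X. x \<sqsubseteq> z \<longrightarrow> z \<in> U \<longrightarrow> z \<in> W}"

text \<open>A pair \<open>(U, X)\<close> stands for the negative element \<open>U\<close>, and \<open>(X, V)\<close> for the positive
  element \<open>x\<close> with \<open>x\<^sup>* = V\<close>. The formulas below treat both kinds at once.\<close>

definition fmul :: "'p set \<times> 'p set \<Rightarrow> 'p set \<times> 'p set \<Rightarrow> 'p set \<times> 'p set" where
  "fmul x y = (if fst x \<subseteq> snd y \<and> fst y \<subseteq> snd x then (fst x \<inter> fst y, X) else (X, snd x \<inter> snd y))"

definition fimp :: "'p set \<times> 'p set \<Rightarrow> 'p set \<times> 'p set \<Rightarrow> 'p set \<times> 'p set" where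
  "fimp x y = (if fst x \<subseteq> fst y \<and> snd y \<subseteq> snd x then (X, ga (fst x) \<inter> snd y)
     else (snd x \<inter> hi (fst x) (fst y), X))"

definition frame_alg :: "('p set \<times> 'p set) rlat" where
  "frame_alg = \<lparr>carrier = {(U, V). up U \<and> cl V \<and> (U = X \<or> V = X)}, mult = fmul, one = (X, X),
     lmeet = \<lambda>x y. (fst x \<inter> fst y, snd x \<union> snd y), ljoin = \<lambda>x y. (fst x \<union> fst y, snd x \<inter> snd y),
     ldiv = fimp, rdiv = \<lambda>z y. fimp y z\<rparr>"

lemma frame_alg_simps [simp]:
  "mult frame_alg = fmul" "one frame_alg = (X, X)" "ldiv frame_alg = fimp" "rdiv frame_alg z y = fimp y z"
  "lmeet frame_alg x y = (fst x \<inter> fst y, snd x \<union> snd y)"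
  "ljoin frame_alg x y = (fst x \<union> fst y, snd x \<inter> snd y)"
  by (simp_all add: frame_alg_def)

lemma frame_alg_carrier: "(U, V) \<in> carrier frame_alg \<longleftrightarrow> up U \<and> cl V \<and> (U = X \<or> V = X)"
  by (simp add: frame_alg_def)

lemma up_X [simp]: "up X" unfolding up_def by blast

lemma up_sub: "up U \<Longrightarrow> U \<subseteq> X" unfolding up_def by blast

lemma up_Int: "up U \<Longrightarrow> up W \<Longrightarrow> up (U \<inter> W)" and up_Un: "up U \<Longrightarrow> up W \<Longrightarrow> up (U \<union> W)"
  unfolding up_def by blast+

lemma up_ga: "up (ga U)"
  unfolding up_def ga_def using ftrans YX by blast

lemma up_hi: "up (hi U W)"
  unfolding up_def hi_def using ftrans by blast

lemma hi_iff: "up U \<Longrightarrow> up W \<Longrightarrow> W \<subseteq> hi U U' \<longleftrightarrow> U \<inter> W \<subseteq> U'"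
  unfolding up_def hi_def using frefl by blast

lemma ga_sub: "ga U \<subseteq> X"
  unfolding ga_def by blast

lemma ga_ext: "up U \<Longrightarrow> U \<subseteq> ga U"
  unfolding up_def ga_def using YX by blast

lemma ga_mono: "U \<subseteq> W \<Longrightarrow> ga U \<subseteq> ga W"
  unfolding ga_def by blast

lemma ga_ga: "ga (ga U) = ga U"
proof
  show "ga (ga U) \<subseteq> ga U" unfolding ga_def using frefl YX by blast
  show "ga U \<subseteq> ga (ga U)" using up_ga by (rule ga_ext)
qed

lemma cl_ga: "cl (ga U)" unfolding cl_def using up_ga ga_ga by blast

lemma clD: "cl V \<Longrightarrow> up V" "cl V \<Longrightarrow> ga V = V" unfolding cl_def by blast+

lemma ga_X [simp]: "ga X = X" unfolding ga_def using YX by blast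

lemma cl_X [simp]: "cl X" unfolding cl_def by simp

lemma ga_le: "cl V \<Longrightarrow> up U \<Longrightarrow> ga U \<subseteq> V \<longleftrightarrow> U \<subseteq> V"
  using ga_mono[of U V] ga_ext[of U] clD(2)[of V] by blast

lemma cl_outside: "cl V \<Longrightarrow> x \<in> X \<Longrightarrow> x \<notin> V \<Longrightarrow> \<exists>y\<in>Y. x \<sqsubseteq> y \<and> y \<notin> V"
  unfolding cl_def ga_def by blast

text \<open>A point outside a closed set lies below a node outside it, and that node is comparable
  with every point. Hence closed sets form a chain, as the positive cone requires.\<close>

lemma cl_comp: assumes "cl V" "up U" shows "U \<subseteq> V \<or> V \<subseteq> U"
proof (rule ccontr)
  assume "\<not> ?thesis"
  then obtain u v where u: "u \<in> U" "u \<notin> V" and v: "v \<in> V" "v \<notin> U" by auto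
  have X: "u \<in> X" "v \<in> X" using u v up_sub[OF assms(2)] up_sub[OF clD(1)[OF assms(1)]] by blast+
  then obtain y where y: "y \<in> Y" "u \<sqsubseteq> y" "y \<notin> V" using cl_outside[OF assms(1)] u by blast
  hence yX: "y \<in> X" using YX by blast
  from node[OF y(1) X(2)] show False
  proof
    assume "y \<sqsubseteq> v"
    hence "u \<sqsubseteq> v" using ftrans X yX y by blast
    thus False using u v X assms(2) unfolding up_def by blast
  next
    assume "v \<sqsubseteq> y"
    thus False using v y yX clD(1)[OF assms(1)] unfolding up_def by blast
  qed
qed

text \<open>If neither set is inside \<open>V\<close>, each contains a node outside
  \<open>V\<close>; nodes are comparable, so the upper one lies in both sets.\<close>

lemma cl_prime: assumes "cl V" "up U" "up W" "U \<inter> W \<subseteq> V" shows "U \<subseteq> V \<or> W \<subseteq> V"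
proof (rule ccontr)
  assume "\<not> ?thesis"
  then obtain u w where u: "u \<in> U" "u \<notin> V" and w: "w \<in> W" "w \<notin> V" by auto
  have X: "u \<in> X" "w \<in> X" using u w up_sub assms by blast+
  obtain y where y: "y \<in> Y" "u \<sqsubseteq> y" "y \<notin> V" using cl_outside[OF assms(1)] u X by blast
  obtain z where z: "z \<in> Y" "w \<sqsubseteq> z" "z \<notin> V" using cl_outside[OF assms(1)] w X by blast
  have YZ: "y \<in> X" "z \<in> X" using YX y z by blast+
  have "y \<in> U" "z \<in> W" using assms(2,3) u w y z YZ unfolding up_def by blast+
  moreover have "y \<sqsubseteq> z \<or> z \<sqsubseteq> y" using node y(1) YZ(2) by blast
  ultimately have "z \<in> U \<or> y \<in> W" using assms(2,3) YZ unfolding up_def by blast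
  thus False using \<open>y \<in> U\<close> \<open>z \<in> W\<close> y z assms(4) by blast
qed

lemma cl_Int: assumes "cl V" "cl W" shows "cl (V \<inter> W)"
proof -
  have "ga (V \<inter> W) = ga V \<inter> ga W" unfolding ga_def by blast
  thus ?thesis using assms up_Int unfolding cl_def by simp
qed

lemma cl_Un: assumes "cl V" "cl W" shows "cl (V \<union> W)"
  using cl_comp[OF assms(1) clD(1)[OF assms(2)]] assms by (metis sup.absorb1 sup.absorb2)

lemma rle_frame_alg: "rle frame_alg x y \<longleftrightarrow> fst x \<subseteq> fst y \<and> snd y \<subseteq> snd x"
  unfolding rle_def by (cases x) auto

lemma fcases:
  assumes "x \<in> carrier frame_alg"
  obtains U where "x = (U, X)" "up U" | V where "x = (X, V)" "cl V"
  using assms unfolding frame_alg_def by auto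

lemma fmul_NN: "up U \<Longrightarrow> up W \<Longrightarrow> fmul (U, X) (W, X) = (U \<inter> W, X)"
  and fmul_NP: "cl V \<Longrightarrow> fmul (U, X) (X, V) = (if U \<subseteq> V then (U \<inter> X, X) else (X, V \<inter> X))"
  and fmul_PN: "cl V \<Longrightarrow> fmul (X, V) (U, X) = (if U \<subseteq> V then (U \<inter> X, X) else (X, V \<inter> X))"
  and fmul_PP: "cl V \<Longrightarrow> cl W \<Longrightarrow> fmul (X, V) (X, W) = (X, V \<inter> W)"
  unfolding fmul_def using up_sub clD(1) by auto

lemma fmul_closed:
  assumes "x \<in> carrier frame_alg" "y \<in> carrier frame_alg" shows "fmul x y \<in> carrier frame_alg"
  using assms up_Int[of "fst x" "fst y"] cl_Int[of "snd x" "snd y"]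
  by (cases x; cases y) (auto simp: fmul_def frame_alg_carrier)

lemma fimp_closed:
  assumes "x \<in> carrier frame_alg" "y \<in> carrier frame_alg" shows "fimp x y \<in> carrier frame_alg"
  using assms cl_Int[OF cl_ga, of "snd y" "fst x"] up_Int[OF clD(1) up_hi, of "snd x" "fst x" "fst y"]
  by (cases x; cases y) (auto simp: fimp_def frame_alg_carrier)

lemma similar_frame_alg: "similar_algebra frame_alg"
  unfolding similar_algebra_def
proof (intro conjI ballI)
  show "\<one>\<^bsub>frame_alg\<^esub> \<in> carrier frame_alg" by (simp add: frame_alg_carrier)
  fix x y assume xy: "x \<in> carrier frame_alg" "y \<in> carrier frame_alg"
  show "x \<otimes>\<^bsub>frame_alg\<^esub> y \<in> carrier frame_alg" using xy fmul_closed by simp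
  show "ldiv frame_alg x y \<in> carrier frame_alg" "rdiv frame_alg x y \<in> carrier frame_alg" using xy fimp_closed by simp_all
  have *: "up (fst z) \<and> cl (snd z) \<and> (fst z = X \<or> snd z = X) \<and> fst z \<subseteq> X \<and> snd z \<subseteq> X"
    if "z \<in> carrier frame_alg" for z
    using that by (cases rule: fcases) (simp_all add: up_sub clD(1))
  have x: "up (fst x)" "cl (snd x)" "fst x = X \<or> snd x = X" "fst x \<subseteq> X" "snd x \<subseteq> X"
    and y: "up (fst y)" "cl (snd y)" "fst y = X \<or> snd y = X" "fst y \<subseteq> X" "snd y \<subseteq> X"
    using *[OF xy(1)] *[OF xy(2)] by blast+
  show "lmeet frame_alg x y \<in> carrier frame_alg"
    using up_Int[OF x(1) y(1)] cl_Un[OF x(2) y(2)] x(3-) y(3-) by (simp add: frame_alg_carrier) blast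
  show "ljoin frame_alg x y \<in> carrier frame_alg"
    using up_Un[OF x(1) y(1)] cl_Int[OF x(2) y(2)] x(3-) y(3-) by (simp add: frame_alg_carrier) blast
qed

lemma lattice_frame_alg: "is_lattice frame_alg"
  unfolding is_lattice_def by (auto simp: frame_alg_carrier)

lemma fmul_comm: "fmul x y = fmul y x"
  unfolding fmul_def by auto

lemma fmul_one: "x \<in> carrier frame_alg \<Longrightarrow> fmul (X, X) x = x"
  by (erule fcases) (auto simp: fmul_NN fmul_NP fmul_PN fmul_PP dest: up_sub clD(1))

lemma fmul_assoc:
  assumes "x \<in> carrier frame_alg" "y \<in> carrier frame_alg" "z \<in> carrier frame_alg"
  shows "fmul (fmul x y) z = fmul x (fmul y z)"
proof -
  \<comment> \<open>\<open>N\<close> and \<open>P\<close> record the signs of the three factors.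
    Commutativity reduces the remaining mixed patterns NPP and PNN to PPN and NNP.\<close>
  have NNP: "fmul (fmul (U, X) (W, X)) (X, V) = fmul (U, X) (fmul (W, X) (X, V))"
    if "up U" "up W" "cl V" for U W V
    using that cl_comp[of V U] cl_comp[of V W] cl_prime[of V U W] up_sub[of U] up_sub[of W]
      up_sub[OF clD(1), of V]
    by (auto simp: fmul_def)
  have NPN: "fmul (fmul (U, X) (X, V)) (W, X) = fmul (U, X) (fmul (X, V) (W, X))"
    if "up U" "up W" "cl V" for U W V
    using that cl_comp[of V U] cl_comp[of V W] cl_prime[of V U W] up_sub[of U] up_sub[of W]
      up_sub[OF clD(1), of V]
    by (auto simp: fmul_def)
  have PPN: "fmul (fmul (X, V) (X, W)) (U, X) = fmul (X, V) (fmul (X, W) (U, X))"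
    if "up U" "cl W" "cl V" for U W V
    using that cl_comp[of V U] cl_comp[of W U] cl_comp[of V W] up_sub[of U] clD(1)[of W]
      up_sub[OF clD(1), of W] up_sub[OF clD(1), of V]
    by (auto simp: fmul_def)
  have PNP: "fmul (fmul (X, V) (U, X)) (X, W) = fmul (X, V) (fmul (U, X) (X, W))"
    if "up U" "cl W" "cl V" for U W V
    using that cl_comp[of V U] cl_comp[of W U] cl_comp[of V W] up_sub[of U] clD(1)[of W]
      up_sub[OF clD(1), of W] up_sub[OF clD(1), of V]
    by (auto simp: fmul_def)
  show ?thesis
    using assms
  proof (elim fcases, goal_cases)
    case 1 thus ?case using up_sub by (auto simp: fmul_def)
  next
    case 2 thus ?case using NNP by simp
  next
    case 3 thus ?case using NPN by simp
  next
    case 4 thus ?case using PPN fmul_comm by metis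
  next
    case 5 thus ?case using NNP fmul_comm by metis
  next
    case 6 thus ?case using PNP by simp
  next
    case 7 thus ?case using PPN by simp
  next
    case 8 thus ?case using up_sub[OF clD(1)] by (simp add: fmul_PP cl_Int Int_assoc)
  qed
qed

lemma fmul_idem: "x \<in> carrier frame_alg \<Longrightarrow> fmul x x = x"
  by (erule fcases) (auto simp: fmul_NN fmul_PP)

lemma monoid_frame_alg: "comm_monoid frame_alg"
  by (rule comm_monoidI)
    (use fmul_assoc fmul_comm fmul_one fmul_closed in \<open>auto simp: frame_alg_carrier\<close>)

text \<open>The signs of the three elements give eight cases. They rest on the Heyting adjunction
  \<open>hi_iff\<close>, on the Galois property \<open>ga_le\<close> of the nucleus, and on the
  comparability \<open>cl_comp\<close>.\<close>

lemma frame_alg_res: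
  assumes "x \<in> carrier frame_alg" "y \<in> carrier frame_alg" "z \<in> carrier frame_alg"
  shows "rle frame_alg (fmul x z) y \<longleftrightarrow> rle frame_alg z (fimp x y)"
  using assms
proof (elim fcases, goal_cases)
  case (1 U U' W) thus ?case using hi_iff[of U W U'] up_sub by (auto simp: rle_frame_alg fmul_NN fimp_def)
next
  case (2 U U' Z) thus ?case using hi_iff[of U X U'] ga_le[of Z U] up_sub[of U] up_sub[of U'] clD(1)[of Z]
    up_sub[of Z] ga_sub[of U]
    by (simp add: rle_frame_alg fmul_NP fimp_def Int_absorb2) blast
next
  case (3 U V' W) thus ?case by (auto simp: rle_frame_alg fmul_NN fimp_def dest: up_sub clD(1))
next
  case (4 U V' Z) thus ?case using ga_le[of Z U] cl_comp[of Z U] cl_comp[OF cl_ga, of V' U] clD(1)[of V']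
    by (auto simp: rle_frame_alg fmul_NP fimp_def dest: up_sub clD(1))
next
  case (5 V U' W) thus ?case using hi_iff[of X W U']
    by (auto simp: rle_frame_alg fmul_PN fimp_def dest: up_sub clD(1))
next
  case (6 V U' Z) thus ?case using hi_iff[of X X U']
    by (auto simp: rle_frame_alg fmul_PP fimp_def dest: up_sub clD(1))
next
  case (7 V V' W) thus ?case using hi_iff[of X W X]
    by (auto simp: rle_frame_alg fmul_PN fimp_def dest: up_sub clD(1))
next
  case (8 V V' Z) thus ?case using cl_comp[of V Z] cl_comp[of V V'] cl_comp[of Z V']
      clD(1)[of Z] clD(1)[of V'] up_sub[of V'] up_sub[of Z] up_sub[of V] clD(1)[of V]
    by (simp add: rle_frame_alg fmul_PP fimp_def hi_def) blast
qed

lemma residuated_frame_alg: "residuated_lattice frame_alg"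
  unfolding residuated_lattice_def
  using similar_frame_alg lattice_frame_alg monoid_frame_alg[THEN comm_monoid.axioms(1)] frame_alg_res fmul_comm
  by simp metis

lemma conic_frame_alg: "conic frame_alg"
  unfolding conic_def
proof
  fix x assume "x \<in> carrier frame_alg"
  thus "rle frame_alg x \<one>\<^bsub>frame_alg\<^esub> \<or> rle frame_alg \<one>\<^bsub>frame_alg\<^esub> x"
    by (cases rule: fcases) (simp_all add: rle_frame_alg up_sub clD(1))
qed

lemma idem_frame_alg: "idempotent frame_alg"
  unfolding idempotent_def using fmul_idem by simp

lemma star_frame_alg: assumes "x \<in> carrier frame_alg" shows "star frame_alg x = (snd x, ga (fst x))"
  using assms
proof (cases rule: fcases)
  case (1 U) thus ?thesis using ga_sub[of U] up_sub[of U] by (auto simp: star_def fimp_def)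
next
  case (2 V)
  hence "V \<subseteq> X" "V \<subseteq> hi X X" using up_sub[OF clD(1)] unfolding hi_def by blast+
  thus ?thesis using 2 by (cases "X \<subseteq> V") (simp_all add: star_def fimp_def Int_absorb2 subset_antisym)
qed

lemma gsm_frame_alg:
  assumes "x \<in> carrier frame_alg"
  shows "star frame_alg (star frame_alg (ljoin frame_alg x \<one>\<^bsub>frame_alg\<^esub>)) = ljoin frame_alg x \<one>\<^bsub>frame_alg\<^esub>"
proof -
  have "up (fst x)" "cl (snd x)" using assms by (cases x; auto simp: frame_alg_carrier)+
  hence j: "fst x \<union> X = X" "snd x \<inter> X = snd x" "ga (snd x) = snd x"
    using up_sub clD by blast+
  have "(X, snd x) \<in> carrier frame_alg" "(snd x, X) \<in> carrier frame_alg"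
    using \<open>cl (snd x)\<close> clD(1) by (auto simp: frame_alg_carrier)
  thus ?thesis by (simp add: j star_frame_alg)
qed

text \<open>If the nodes form an up-set, \<open>ga U\<close> is either all of \<open>X\<close> or
  \<open>U\<close> itself: a point outside \<open>ga U\<close> has a node outside \<open>U\<close>
  above it, any point of \<open>ga U\<close> outside \<open>U\<close> would lie above that node,
  hence be a node itself, and then belong to \<open>U\<close>.\<close>

lemma central_frame_alg:
  assumes "up Y" "x \<in> carrier frame_alg"
  shows "rle frame_alg \<one>\<^bsub>frame_alg\<^esub>
    (ljoin frame_alg (star frame_alg (star frame_alg x)) (ldiv frame_alg (star frame_alg (star frame_alg x)) x))"
  using assms(2)
proof (cases rule: fcases)
  case (1 U)
  hence ss: "star frame_alg (star frame_alg x) = (ga U, X)"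
    using star_frame_alg[of x] star_frame_alg[of "(X, ga U)"] assms cl_ga[of U] by (auto simp: frame_alg_carrier)
  have "X \<subseteq> ga U \<or> ga U \<subseteq> U"
  proof (rule ccontr)
    assume "\<not> ?thesis"
    then obtain p q where p: "p \<in> X" "p \<notin> ga U" and q: "q \<in> ga U" "q \<notin> U" by auto
    then obtain y where y: "y \<in> Y" "y \<notin> U" unfolding ga_def by blast
    have yX: "y \<in> X" "q \<in> X" using y q YX unfolding ga_def by blast+
    have "\<not> q \<sqsubseteq> y" using y q unfolding ga_def by blast
    hence "y \<sqsubseteq> q" using node y yX by blast
    hence "q \<in> Y" using assms(1) y yX unfolding up_def by blast
    thus False using q frefl yX unfolding ga_def by blast
  qed
  thus ?thesis using 1 clD(1)[OF cl_ga, of U, THEN up_sub] unfolding ss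
    by (auto simp: fimp_def rle_frame_alg hi_def)
next
  case (2 V)
  hence "star frame_alg (star frame_alg x) = (X, V)"
    using star_frame_alg[of x] star_frame_alg[of "(V, X)"] assms clD[of V] by (auto simp: frame_alg_carrier)
  thus ?thesis using 2 by (auto simp: rle_frame_alg fimp_def dest: up_sub clD(1))
qed

end

section \<open>Gluing two spectra\<close>

text \<open>What the pairing of spectra uses about one algebra over \<open>A\<close>: the trace
  lifts inclusions (\<open>go\<close>), and each fibre over a nuclear trace has a greatest point,
  which is a node, and a least node.\<close>

locale side =
  fixes S :: "'a set set" and P0 :: "'a set" and Y :: "'a set set" and tr :: "'a set \<Rightarrow> 'r set"
    and SA :: "'r set set" and YA :: "'r set set"
  assumes P0: "P0 \<in> S" and P0_least: "P \<in> S \<Longrightarrow> P0 \<subseteq> P"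
    and YS: "Z \<in> Y \<Longrightarrow> Z \<in> S"
    and nodes: "Z \<in> Y \<Longrightarrow> P \<in> S \<Longrightarrow> Z \<subseteq> P \<or> P \<subseteq> Z"
    and tr_SA: "P \<in> S \<Longrightarrow> tr P \<in> SA"
    and tr_mono: "P \<subseteq> Q \<Longrightarrow> tr P \<subseteq> tr Q"
    and tr_YA: "Z \<in> Y \<Longrightarrow> tr Z \<in> YA"
    and go: "P \<in> S \<Longrightarrow> R \<in> SA \<Longrightarrow> tr P \<subseteq> R \<Longrightarrow> \<exists>Q\<in>S. P \<subseteq> Q \<and> tr Q = R"
    and greatest: "R \<in> YA \<Longrightarrow> tr P0 \<subseteq> R \<Longrightarrow> \<exists>M\<in>Y. tr M = R \<and> (\<forall>P\<in>S. tr P = R \<longrightarrow> P \<subseteq> M)"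
    and least: "R \<in> YA \<Longrightarrow> tr P0 \<subseteq> R \<Longrightarrow> \<exists>m\<in>Y. tr m = R \<and> (\<forall>Z\<in>Y. tr Z = R \<longrightarrow> m \<subseteq> Z)"
begin

text \<open>Over a trace in \<open>YA\<close>, these are the points of the fibre not strictly above
  its least node. Over any other trace every point is low, by \<open>low_if\<close>.\<close>

definition low :: "'a set \<Rightarrow> bool" where
  "low P \<longleftrightarrow> (\<forall>Z\<in>Y. tr Z = tr P \<longrightarrow> Z \<subseteq> P \<longrightarrow> Z = P)"

definition topmost :: "'a set \<Rightarrow> bool" where
  "topmost P \<longleftrightarrow> (\<forall>Z\<in>S. tr Z = tr P \<longrightarrow> P \<subseteq> Z \<longrightarrow> Z = P)"

lemma low_P0: "low P0"
  unfolding low_def using P0_least YS by blast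

lemma tr_above: "P \<in> S \<Longrightarrow> tr P0 \<subseteq> tr P"
  using P0_least tr_mono by blast

lemma low_if: "tr P \<notin> YA \<Longrightarrow> low P"
  unfolding low_def using tr_YA by metis

text \<open>The least node over \<open>R\<close> is comparable with \<open>P\<close>. If it is below
  \<open>P\<close>, the traces agree, and lowness makes the two equal.\<close>

lemma least_low:
  assumes "P \<in> S" "R \<in> YA" "tr P \<subseteq> R" and lw: "tr P = R \<Longrightarrow> low P"
  shows "\<exists>m\<in>Y. tr m = R \<and> low m \<and> P \<subseteq> m"
proof -
  have "tr P0 \<subseteq> R" using assms tr_above by blast
  then obtain m where m: "m \<in> Y" "tr m = R" "\<forall>Z\<in>Y. tr Z = R \<longrightarrow> m \<subseteq> Z" using least assms(2) by blast
  hence "low m" unfolding low_def by blast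
  moreover have "P \<subseteq> m"
  proof (rule ccontr)
    assume n: "\<not> P \<subseteq> m"
    hence s: "m \<subseteq> P" using nodes m assms by blast
    hence R: "tr P = R" using tr_mono m assms by blast
    hence "m = P" using lw s m unfolding low_def by blast
    thus False using n by blast
  qed
  ultimately show ?thesis using m by blast
qed

lemma greatest_top:
  assumes "P \<in> S" "R \<in> YA" "tr P \<subseteq> R"
  shows "\<exists>M\<in>Y. tr M = R \<and> topmost M \<and> P \<subseteq> M"
proof -
  have "tr P0 \<subseteq> R" using assms tr_above by blast
  then obtain M where M: "M \<in> Y" "tr M = R" "\<forall>P\<in>S. tr P = R \<longrightarrow> P \<subseteq> M"
    using greatest assms(2) by blast
  hence "topmost M" unfolding topmost_def by blast
  moreover have "P \<subseteq> M"
  proof (rule ccontr)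
    assume n: "\<not> P \<subseteq> M"
    hence "M \<subseteq> P" using nodes M assms by blast
    hence "tr P = R" using tr_mono M assms by blast
    thus False using M n assms by blast
  qed
  ultimately show ?thesis using M by blast
qed

lemma not_low_up:
  assumes "\<not> low P" "P \<subseteq> Q" "tr P = tr Q" shows "\<not> low Q"
proof -
  obtain Z where "Z \<in> Y" "tr Z = tr P" "Z \<subseteq> P" "Z \<noteq> P" using assms(1) unfolding low_def by blast
  thus ?thesis using assms(2,3) unfolding low_def by blast
qed

end

locale two_sides =
  B: side SB PB YB trB SA YA + C: side SC PC YC trC SA YA
  for SB :: "'b set set" and PB YB and trB :: "'b set \<Rightarrow> 'r set" and SA YA
    and SC :: "'c set set" and PC YC and trC :: "'c set \<Rightarrow> 'r set" +
  assumes tr_root: "trB PB = trC PC"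
begin

text \<open>Over a trace in \<open>YA\<close>, the pairs beyond the low ones run along an L-shaped path: the first
  coordinate climbs while the second is the least node of its fibre, then the second climbs while the
  first is the greatest point of its fibre. So any node is comparable with any pair.\<close>

definition pts :: "('b set \<times> 'c set) set" where
  "pts = {(P, Q). P \<in> SB \<and> Q \<in> SC \<and> trB P = trC Q \<and>
     (B.low P \<and> C.low Q \<or> Q \<in> YC \<and> C.low Q \<or> B.topmost P \<and> \<not> C.low Q)}"

definition nds :: "('b set \<times> 'c set) set" where
  "nds = {p \<in> pts. fst p \<in> YB \<and> snd p \<in> YC}"

definition ple :: "('b set \<times> 'c set) \<Rightarrow> ('b set \<times> 'c set) \<Rightarrow> bool" where
  "ple p q \<longleftrightarrow> fst p \<subseteq> fst q \<and> snd p \<subseteq> snd q"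

lemma ptsD: "p \<in> pts \<Longrightarrow> fst p \<in> SB" "p \<in> pts \<Longrightarrow> snd p \<in> SC"
  "p \<in> pts \<Longrightarrow> trB (fst p) = trC (snd p)"
  unfolding pts_def by auto

lemma root: "(PB, PC) \<in> pts"
  unfolding pts_def using B.P0 C.P0 tr_root B.low_P0 C.low_P0 by blast

text \<open>The coordinates of a node and a pair are comparable separately, so comparability could
  fail only by strict inclusions in opposite directions. These force equal traces, so both pairs lie
  over one trace in \<open>YA\<close>, where the L-shaped path admits neither combination.\<close>

lemma frame_pts: "frame pts ple nds"
proof
  fix y z assume y: "y \<in> nds" and z: "z \<in> pts"
  obtain P Q where yP: "y = (P, Q)" by fastforce
  obtain P' Q' where zP: "z = (P', Q')" by fastforce
  have Y: "P \<in> YB" "Q \<in> YC" "(P, Q) \<in> pts" using y unfolding yP nds_def by auto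
  have Z: "P' \<in> SB" "Q' \<in> SC" "trB P' = trC Q'" using z zP ptsD by force+
  have tY: "trB P = trC Q" using Y(3) ptsD(3) by force
  show "ple y z \<or> ple z y"
  proof (rule ccontr)
    assume n: "\<not> ?thesis"
    have c: "P \<subseteq> P' \<or> P' \<subseteq> P" "Q \<subseteq> Q' \<or> Q' \<subseteq> Q" using Y Z B.nodes C.nodes by blast+
    then consider "P \<subset> P'" "Q' \<subset> Q" | "P' \<subset> P" "Q \<subset> Q'"
      using n unfolding ple_def yP zP by auto
    thus False
    proof cases
      case 1
      hence "trB P \<subseteq> trB P'" "trC Q' \<subseteq> trC Q" using B.tr_mono C.tr_mono by blast+
      hence t: "trB P = trB P'" "trC Q = trC Q'" using tY Z by auto
      have l: "\<not> B.low P'" using Y 1 t unfolding B.low_def by blast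
      have tp: "\<not> B.topmost P" using Z(1) 1 t unfolding B.topmost_def by blast
      hence "C.low Q" using Y(3) unfolding pts_def by auto
      moreover have "\<not> C.low Q" if "\<not> C.low Q'"
        using C.not_low_up[OF that] 1 t by auto
      ultimately have "C.low Q'" by blast
      hence "Q' \<in> YC" using z l unfolding pts_def zP by auto
      thus False using \<open>C.low Q\<close> 1 t unfolding C.low_def by auto
    next
      case 2
      hence "trB P' \<subseteq> trB P" "trC Q \<subseteq> trC Q'" using B.tr_mono C.tr_mono by blast+
      hence t: "trB P = trB P'" "trC Q = trC Q'" using tY Z by auto
      have "\<not> C.low Q'" using Y 2 t unfolding C.low_def by blast
      hence "B.topmost P'" using z unfolding pts_def zP by auto
      thus False using 2 t B.YS[OF Y(1)] unfolding B.topmost_def by blast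
    qed
  qed
qed (auto simp: ple_def nds_def)

text \<open>Over a nuclear trace the new second coordinate is the least node of its fibre. The
  exception is that \<open>Q\<close> is already non-low over the same trace: then \<open>P1\<close>
  is topmost, so \<open>P\<close> equals it, and the greatest point of the fibre is taken. Both
  choices are nodes, as needed when \<open>P\<close> is one.\<close>

lemma backB:
  assumes p: "p \<in> pts" and P: "P \<in> SB" "fst p \<subseteq> P"
  shows "\<exists>q\<in>pts. ple p q \<and> fst q = P \<and> (P \<in> YB \<longrightarrow> snd q \<in> YC)"
proof -
  obtain P1 Q where pP: "p = (P1, Q)" by fastforce
  have Q: "Q \<in> SC" "P1 \<in> SB" "trB P1 = trC Q" using ptsD[OF p] unfolding pP by auto
  have tQ: "trC Q \<subseteq> trB P" using B.tr_mono[OF P(2)] Q unfolding pP by simp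
  have "\<exists>Q'. Q \<subseteq> Q' \<and> (P, Q') \<in> pts \<and> (P \<in> YB \<longrightarrow> Q' \<in> YC)"
  proof (cases "trB P \<in> YA")
    case False
    then obtain Q' where "Q' \<in> SC" "Q \<subseteq> Q'" "trC Q' = trB P" using C.go Q tQ B.tr_SA[OF P(1)] by blast
    moreover from this have "B.low P" "C.low Q'" using False B.low_if C.low_if by simp_all
    ultimately show ?thesis using P False B.tr_YA unfolding pts_def by auto
  next
    case True
    show ?thesis
    proof (cases "trC Q = trB P \<longrightarrow> C.low Q")
      case True
      then obtain m where "m \<in> YC" "trC m = trB P" "C.low m" "Q \<subseteq> m"
        using C.least_low[OF Q(1) \<open>trB P \<in> YA\<close> tQ] by blast
      thus ?thesis using P C.YS unfolding pts_def by auto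
    next
      case False
      hence "B.topmost P1" using p unfolding pts_def pP by auto
      hence PP: "P = P1" using False P Q unfolding B.topmost_def pP by auto
      obtain M where M: "M \<in> YC" "trC M = trB P" "Q \<subseteq> M"
        using C.greatest_top[OF Q(1) True tQ] by blast
      have "\<not> C.low M" using C.not_low_up False M by metis
      thus ?thesis using M \<open>B.topmost P1\<close> PP P C.YS unfolding pts_def by auto
    qed
  qed
  then obtain Q' where "Q \<subseteq> Q'" "(P, Q') \<in> pts" "P \<in> YB \<longrightarrow> Q' \<in> YC" by blast
  thus ?thesis using P unfolding pP ple_def by (intro bexI[of _ "(P, Q')"]) auto
qed

text \<open>Over a nuclear trace the greatest point of the fibre serves as first coordinate if
  \<open>Q\<close> is a node or non-low. If \<open>Q\<close> is low and not a node, the least node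
  is taken instead.\<close>

lemma backC:
  assumes p: "p \<in> pts" and Q: "Q \<in> SC" "snd p \<subseteq> Q"
  shows "\<exists>q\<in>pts. ple p q \<and> snd q = Q \<and> (Q \<in> YC \<longrightarrow> fst q \<in> YB)"
proof -
  obtain P Q1 where pP: "p = (P, Q1)" by fastforce
  have P: "Q1 \<in> SC" "P \<in> SB" "trB P = trC Q1" using ptsD[OF p] unfolding pP by auto
  have tP: "trB P \<subseteq> trC Q" using C.tr_mono[OF Q(2)] P unfolding pP by simp
  have "\<exists>P'. P \<subseteq> P' \<and> (P', Q) \<in> pts \<and> (Q \<in> YC \<longrightarrow> P' \<in> YB)"
  proof (cases "trC Q \<in> YA")
    case False
    then obtain P' where "P' \<in> SB" "P \<subseteq> P'" "trB P' = trC Q" using B.go P tP C.tr_SA[OF Q(1)] by blast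
    moreover from this have "B.low P'" "C.low Q" using False B.low_if C.low_if by simp_all
    ultimately show ?thesis using Q False C.tr_YA unfolding pts_def by auto
  next
    case True
    show ?thesis
    proof (cases "C.low Q \<and> Q \<notin> YC")
      case False
      obtain M where "M \<in> YB" "trB M = trC Q" "B.topmost M" "P \<subseteq> M"
        using B.greatest_top[OF P(2) True tP] by blast
      thus ?thesis using False Q B.YS unfolding pts_def by auto
    next
      case low: True
      show ?thesis
      proof (cases "trB P = trC Q \<longrightarrow> B.low P")
        case True
        then obtain m where "m \<in> YB" "trB m = trC Q" "B.low m" "P \<subseteq> m"
          using B.least_low[OF P(2) \<open>trC Q \<in> YA\<close> tP] by blast
        thus ?thesis using low Q B.YS unfolding pts_def by auto
      next
        \<comment> \<open>This case is void: with \<open>P\<close> non-low and \<open>Q1\<close>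
          low, the pair forces \<open>Q1\<close> to be a node of the fibre of \<open>Q\<close>;
          lowness of \<open>Q\<close> then gives \<open>Q1 = Q\<close>, although \<open>Q\<close> is
          not a node.\<close>
        case False
        have "C.low Q1" using C.not_low_up[of Q1 Q] False low P Q unfolding pP by auto
        hence "Q1 \<in> YC" using p False unfolding pts_def pP by auto
        hence "Q1 = Q" using low False P Q unfolding C.low_def pP by auto
        thus ?thesis using \<open>Q1 \<in> YC\<close> low by blast
      qed
    qed
  qed
  then obtain P' where "P \<subseteq> P'" "(P', Q) \<in> pts" "Q \<in> YC \<longrightarrow> P' \<in> YB" by blast
  thus ?thesis using Q unfolding pP ple_def by (intro bexI[of _ "(P', Q)"]) auto
qed

lemma nds_up:
  assumes "\<And>Z P. Z \<in> YB \<Longrightarrow> P \<in> SB \<Longrightarrow> Z \<subseteq> P \<Longrightarrow> P \<in> YB"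
    "\<And>Z Q. Z \<in> YC \<Longrightarrow> Q \<in> SC \<Longrightarrow> Z \<subseteq> Q \<Longrightarrow> Q \<in> YC"
  shows "frame.up pts ple nds"
  unfolding frame.up_def[OF frame_pts]
  using assms ptsD unfolding nds_def ple_def by blast

end

section \<open>Representation over a spectrum\<close>

text \<open>A bounded morphism from the frame to the primes above \<open>P0\<close> that also lifts
  inclusions into nuclear primes at nodes. The lifting makes Heyting implication and nucleus
  computed on the frame agree with those on the primes; the point \<open>r\<close> tests membership
  in \<open>P0\<close>.\<close>

locale spectral_rep = preordered_rl le mul imp mt jn one + frame X fle Y
  for le :: "'a \<Rightarrow> 'a \<Rightarrow> bool" (infix "\<preceq>" 50)
    and mul :: "'a \<Rightarrow> 'a \<Rightarrow> 'a" (infixl "\<odot>" 70)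
    and imp :: "'a \<Rightarrow> 'a \<Rightarrow> 'a" (infixr "\<leadsto>" 65)
    and mt :: "'a \<Rightarrow> 'a \<Rightarrow> 'a"
    and jn :: "'a \<Rightarrow> 'a \<Rightarrow> 'a"
    and one :: 'a ("e")
    and X :: "'p set" and fle :: "'p \<Rightarrow> 'p \<Rightarrow> bool" (infix "\<sqsubseteq>" 50) and Y :: "'p set" +
  fixes \<pi> :: "'p \<Rightarrow> 'a set" and P0 :: "'a set" and r :: 'p
  assumes pi_prime: "p \<in> X \<Longrightarrow> prime (\<pi> p)"
    and pi_P0: "p \<in> X \<Longrightarrow> P0 \<subseteq> \<pi> p"
    and root: "r \<in> X" "\<pi> r = P0"
    and pi_mono: "p \<in> X \<Longrightarrow> q \<in> X \<Longrightarrow> p \<sqsubseteq> q \<Longrightarrow> \<pi> p \<subseteq> \<pi> q"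
    and lift: "p \<in> X \<Longrightarrow> prime P \<Longrightarrow> \<pi> p \<subseteq> P \<Longrightarrow> \<exists>q\<in>X. p \<sqsubseteq> q \<and> \<pi> q = P"
    and Y_nuc: "p \<in> Y \<Longrightarrow> nuclear (\<pi> p)"
    and lift_nuc: "p \<in> X \<Longrightarrow> nuclear P \<Longrightarrow> \<pi> p \<subseteq> P \<Longrightarrow> \<exists>q\<in>Y. p \<sqsubseteq> q \<and> \<pi> q = P"
begin

lemma prime_P0: "prime P0" using pi_prime root by blast

sublocale R: conic_preordered_rl "lef P0" "(\<odot>)" "(\<leadsto>)" mt jn e
  using prime_P0 by (rule conic_preordered_rl_lef)

definition pos :: "'a \<Rightarrow> 'p set" where "pos x = {p \<in> X. x \<in> \<pi> p}"

definition rp :: "'a \<Rightarrow> 'p set \<times> 'p set" where "rp x = (pos x, pos (st x))"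

lemma filt_pi: "p \<in> X \<Longrightarrow> filt (\<pi> p)"
  using pi_prime prime_filt by blast

lemma up_pos: "up (pos x)"
  unfolding up_def pos_def using pi_mono by blast

text \<open>A failure of the inequality modulo \<open>P0\<close> is witnessed by a prime above
  \<open>P0\<close> through \<open>prime_sep\<close>, and \<open>lift\<close> at the root
  \<open>r\<close> turns that prime into a point of the frame.\<close>

lemma pos_sub: "pos x \<subseteq> pos y \<longleftrightarrow> lef P0 (mt x e) y"
proof
  assume s: "pos x \<subseteq> pos y"
  show "lef P0 (mt x e) y"
  proof (rule ccontr)
    assume "\<not> lef P0 (mt x e) y"
    then obtain Q where Q: "prime Q" "P0 \<subseteq> Q" "x \<in> Q" "y \<notin> Q"
      using prime_sep[OF prime_filt[OF prime_P0]] unfolding lef_def by blast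
    then obtain q where "q \<in> X" "\<pi> q = Q" using lift[OF root(1)] root(2) by blast
    thus False using s Q unfolding pos_def by blast
  qed
next
  assume l: "lef P0 (mt x e) y"
  show "pos x \<subseteq> pos y"
  proof
    fix p assume "p \<in> pos x"
    hence p: "p \<in> X" "x \<in> \<pi> p" unfolding pos_def by auto
    note F = filtD[OF filt_pi[OF p(1)]]
    have "mt x e \<leadsto> y \<in> \<pi> p" using l pi_P0[OF p(1)] unfolding lef_def by blast
    hence "mt x e \<odot> (mt x e \<leadsto> y) \<in> \<pi> p" using F p by blast
    thus "p \<in> pos y" using F(2) mp p(1) unfolding pos_def by blast
  qed
qed

lemma lef_pi: "lef P0 x y \<Longrightarrow> p \<in> X \<Longrightarrow> lef (\<pi> p) x y"
  unfolding lef_def using pi_P0 by blast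

lemma conic_pi: "p \<in> X \<Longrightarrow> conic_preordered_rl (lef (\<pi> p)) (\<odot>) (\<leadsto>) mt jn e"
  using pi_prime conic_preordered_rl_lef by blast

lemma mem_pi: "p \<in> X \<Longrightarrow> x \<in> \<pi> p \<longleftrightarrow> lef (\<pi> p) e x"
  using mem_lef filt_pi by blast

lemma st_pi: "p \<in> X \<Longrightarrow> st x \<in> \<pi> p \<longleftrightarrow> lef (\<pi> p) x e"
  unfolding lef_def st_def by blast

text \<open>One inclusion is \<open>nuc_avoid\<close> carried to the frame by
  \<open>lift_nuc\<close>; the other is nuclearity of the primes at nodes.\<close>

lemma ga_pos: "ga (pos x) = pos (st (st x))"
proof (rule subset_antisym; rule subsetI)
  fix p assume a: "p \<in> ga (pos x)"
  hence p: "p \<in> X" unfolding ga_def by blast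
  show "p \<in> pos (st (st x))"
  proof (rule ccontr)
    assume "p \<notin> pos (st (st x))"
    then obtain P where P: "nuclear P" "\<pi> p \<subseteq> P" "x \<notin> P"
      using nuc_avoid[OF pi_prime[OF p]] p unfolding pos_def by blast
    then obtain q where "q \<in> Y" "p \<sqsubseteq> q" "\<pi> q = P" using lift_nuc p by blast
    thus False using a P unfolding ga_def pos_def by blast
  qed
next
  fix p assume "p \<in> pos (st (st x))"
  hence p: "p \<in> X" "st (st x) \<in> \<pi> p" unfolding pos_def by auto
  have "y \<in> pos x" if y: "y \<in> Y" "p \<sqsubseteq> y" for y
  proof -
    have "y \<in> X" using y YX by blast
    moreover from this have "st (st x) \<in> \<pi> y" using pi_mono[OF p(1) _ y(2)] p by blast
    ultimately show ?thesis using Y_nuc[OF y(1)] unfolding nuclear_def pos_def by blast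
  qed
  thus "p \<in> ga (pos x)" using p unfolding ga_def by blast
qed

lemma pos_mono: "x \<preceq> y \<Longrightarrow> pos x \<subseteq> pos y"
  using pos_sub R.mt1 R.trans le_lef[OF prime_filt[OF prime_P0]] by blast

lemma cl_pos: "cl (pos (st x))"
  unfolding cl_def using up_pos ga_pos[of "st x"] pos_mono[OF st3, of x] pos_mono[OF st_st, of "st x"]
  by blast

lemma pos_X: "pos x = X \<longleftrightarrow> lef P0 e x"
proof
  assume "pos x = X"
  hence "x \<in> P0" using root unfolding pos_def by blast
  thus "lef P0 e x" using mem_lef[OF prime_filt[OF prime_P0]] by blast
next
  assume "lef P0 e x"
  hence "x \<in> P0" using mem_lef[OF prime_filt[OF prime_P0]] by blast
  thus "pos x = X" using pi_P0 unfolding pos_def by blast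
qed

lemma pos_st_X: "pos (st x) = X \<longleftrightarrow> lef P0 x e"
  using pos_X R.e_st by simp

lemma rp_carrier: "rp x \<in> carrier frame_alg"
  unfolding rp_def frame_alg_carrier pos_X using up_pos cl_pos R.conic[of x] R.e_st[of x] by auto

lemma rp_le: "fst (rp x) \<subseteq> fst (rp y) \<and> snd (rp y) \<subseteq> snd (rp x) \<longleftrightarrow> lef P0 x y"
  using R.le_char[of x y] unfolding rp_def by (simp add: pos_sub)

lemma rp_one: "rp e = (X, X)"
  unfolding rp_def using pos_X[of e] pos_st_X[of e] R.refl by simp

lemma rp_meet: "rp (mt x y) = (fst (rp x) \<inter> fst (rp y), snd (rp x) \<union> snd (rp y))"
proof -
  have "mt x y \<in> \<pi> p \<longleftrightarrow> x \<in> \<pi> p \<and> y \<in> \<pi> p" if "p \<in> X" for p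
    using filt_mt[OF filt_pi[OF that]] .
  moreover have "st (mt x y) \<in> \<pi> p \<longleftrightarrow> st x \<in> \<pi> p \<or> st y \<in> \<pi> p" if "p \<in> X" for p
    using conic_preordered_rl.mt_le_e[OF conic_pi[OF that], of x y] st_pi[OF that] by simp
  ultimately show ?thesis unfolding rp_def pos_def by auto
qed

lemma rp_join: "rp (jn x y) = (fst (rp x) \<union> fst (rp y), snd (rp x) \<inter> snd (rp y))"
proof -
  have "jn x y \<in> \<pi> p \<longleftrightarrow> x \<in> \<pi> p \<or> y \<in> \<pi> p" if "p \<in> X" for p
    using prime_jn[OF pi_prime[OF that]] .
  moreover have "st (jn x y) \<in> \<pi> p \<longleftrightarrow> st x \<in> \<pi> p \<and> st y \<in> \<pi> p" if "p \<in> X" for p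
    using preordered_rl.jn_iff[OF preordered_rl_lef[OF filt_pi[OF that]], of x y e] st_pi[OF that] by simp
  ultimately show ?thesis unfolding rp_def pos_def by auto
qed

text \<open>\<open>R.mul_e\<close> matches the case of \<open>fmul\<close> with the side of
  \<open>e\<close> on which the product lies. A product below \<open>e\<close> belongs to
  \<open>\<pi> p\<close> only if it is equivalent to \<open>e\<close> there, so
  \<open>unit_factor\<close> puts both factors into \<open>\<pi> p\<close>; products above
  \<open>e\<close> are treated dually through the star.\<close>

lemma rp_mul: "rp (x \<odot> y) = fmul (rp x) (rp y)"
proof -
  have cond: "pos x \<subseteq> pos (st y) \<and> pos y \<subseteq> pos (st x) \<longleftrightarrow> lef P0 (x \<odot> y) e"
    unfolding pos_sub by (rule R.mul_e[symmetric])
  have *: "p \<in> pos (x \<odot> y) \<longleftrightarrow> p \<in> pos x \<inter> pos y" if l: "lef P0 (x \<odot> y) e" for p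
  proof (cases "p \<in> X")
    case True
    interpret L: conic_preordered_rl "lef (\<pi> p)" "(\<odot>)" "(\<leadsto>)" mt jn e using True by (rule conic_pi)
    have "x \<in> \<pi> p \<and> y \<in> \<pi> p" if "x \<odot> y \<in> \<pi> p"
      using L.unit_factor[of x y] lef_pi[OF l True] that unfolding mem_pi[OF True] by simp
    thus ?thesis using True filtD(3)[OF filt_pi[OF True]] unfolding pos_def by blast
  qed (simp add: pos_def)
  have **: "p \<in> pos (st (x \<odot> y)) \<longleftrightarrow> p \<in> pos (st x) \<inter> pos (st y)" if l: "lef P0 e (x \<odot> y)" for p
  proof (cases "p \<in> X")
    case True
    interpret L: conic_preordered_rl "lef (\<pi> p)" "(\<odot>)" "(\<leadsto>)" mt jn e using True by (rule conic_pi)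
    have "lef (\<pi> p) (x \<odot> y) e \<longleftrightarrow> lef (\<pi> p) x e \<and> lef (\<pi> p) y e"
      using L.unit_factor(1,3)[of x y] lef_pi[OF l True] L.trans[OF L.mul_le1] by blast
    thus ?thesis using True st_pi[OF True] unfolding pos_def by blast
  qed (simp add: pos_def)
  show ?thesis
  proof (cases "lef P0 (x \<odot> y) e")
    case True
    thus ?thesis using cond * pos_st_X[of "x \<odot> y"] unfolding rp_def fmul_def by auto
  next
    case False
    hence "lef P0 e (x \<odot> y)" using R.conic by blast
    thus ?thesis using False cond ** pos_X[of "x \<odot> y"] unfolding rp_def fmul_def by auto
  qed
qed

text \<open>If \<open>x\<close> is below \<open>y\<close> modulo \<open>P0\<close>, the implication
  is positive and \<open>imp_le_e\<close> computes its star. Otherwise it is negative and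
  \<open>imp_bound\<close> applies.\<close>

lemma rp_imp: "rp (x \<leadsto> y) = fimp (rp x) (rp y)"
proof -
  have cond: "pos x \<subseteq> pos y \<and> pos (st y) \<subseteq> pos (st x) \<longleftrightarrow> lef P0 x y"
    using rp_le[of x y] unfolding rp_def by simp
  show ?thesis
  proof (cases "lef P0 x y")
    case True
    have "pos (x \<leadsto> y) = X" using True pos_X R.one_le_imp by blast
    moreover have "p \<in> pos (st (x \<leadsto> y)) \<longleftrightarrow> p \<in> ga (pos x) \<inter> pos (st y)" for p
    proof (cases "p \<in> X")
      case pX: True
      interpret L: conic_preordered_rl "lef (\<pi> p)" "(\<odot>)" "(\<leadsto>)" mt jn e using pX by (rule conic_pi)
      have "lef (\<pi> p) (x \<leadsto> y) e \<longleftrightarrow> lef (\<pi> p) e (st (st x)) \<and> lef (\<pi> p) y e"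
        by (rule L.imp_le_e[OF lef_pi[OF True pX]])
      thus ?thesis using pX st_pi[OF pX] mem_pi[OF pX] unfolding ga_pos unfolding pos_def by blast
    qed (simp add: pos_def ga_def)
    ultimately show ?thesis using True cond unfolding rp_def fimp_def by auto
  next
    case False
    have "lef P0 (x \<leadsto> y) e"
      using False R.one_le_imp[of x y] R.conic[of "x \<leadsto> y"] by simp
    hence "pos (st (x \<leadsto> y)) = X" using pos_st_X by blast
    moreover have "p \<in> pos (x \<leadsto> y) \<longleftrightarrow> p \<in> pos (st x) \<inter> hi (pos x) (pos y)" for p
    proof (cases "p \<in> X")
      case pX: True
      interpret L: conic_preordered_rl "lef (\<pi> p)" "(\<odot>)" "(\<leadsto>)" mt jn e using pX by (rule conic_pi)
      show ?thesis
      proof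
        assume "p \<in> pos (x \<leadsto> y)"
        hence m: "x \<leadsto> y \<in> \<pi> p" unfolding pos_def by blast
        hence e: "lef (\<pi> p) e (x \<leadsto> y)" using mem_pi[OF pX] by blast
        have "lef (\<pi> p) x (x \<odot> (x \<leadsto> y))" using e by (rule L.mul_ge2)
        moreover have "lef (\<pi> p) (x \<odot> (x \<leadsto> y)) e"
          using lef_pi[OF R.imp_bound[OF False] pX] .
        ultimately have "p \<in> pos (st x)" using L.trans st_pi pX unfolding pos_def by blast
        moreover have "p \<in> hi (pos x) (pos y)" unfolding hi_def
        proof (intro CollectI conjI ballI impI pX)
          fix q assume q: "q \<in> X" "p \<sqsubseteq> q" "q \<in> pos x"
          hence "x \<odot> (x \<leadsto> y) \<in> \<pi> q"
            using m pi_mono[OF pX q(1,2)] filtD(3)[OF filt_pi[OF q(1)]] unfolding pos_def by blast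
          thus "q \<in> pos y" using filtD(2)[OF filt_pi[OF q(1)]] mp q(1) unfolding pos_def by blast
        qed
        ultimately show "p \<in> pos (st x) \<inter> hi (pos x) (pos y)" by blast
      next
        \<comment> \<open>At \<open>p\<close> the element \<open>x\<close> is negative, hence
          equivalent to \<open>mt x e\<close>. So \<open>prime_sep\<close> can test the implication
          on the primes above \<open>\<pi> p\<close>, which \<open>lift\<close> realises in the
          frame.\<close>
        assume a: "p \<in> pos (st x) \<inter> hi (pos x) (pos y)"
        hence "lef (\<pi> p) x e" using st_pi pX unfolding pos_def by blast
        hence xe: "lef (\<pi> p) x (mt x e)" using L.mt_e by blast
        have "mt x e \<leadsto> y \<in> \<pi> p"
        proof (rule ccontr)
          assume "mt x e \<leadsto> y \<notin> \<pi> p"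
          then obtain Q where Q: "prime Q" "\<pi> p \<subseteq> Q" "x \<in> Q" "y \<notin> Q"
            using prime_sep filt_pi[OF pX] by blast
          then obtain q where "q \<in> X" "p \<sqsubseteq> q" "\<pi> q = Q" using lift pX by blast
          thus False using a Q unfolding hi_def pos_def by blast
        qed
        hence "lef (\<pi> p) x y" using xe L.trans unfolding lef_def[of _ "mt x e"] by (metis lef_def)
        thus "p \<in> pos (x \<leadsto> y)" using pX unfolding pos_def lef_def by blast
      qed
    qed (simp add: pos_def)
    ultimately show ?thesis using False cond unfolding rp_def fimp_def by auto
  qed
qed

end

section \<open>Residuated lattices with carriers\<close>

locale rl_lattice =
  fixes A :: "'u rlat"
  assumes similar: "similar_algebra A" and lattice: "is_lattice A"
begin

lemma closed [simp]:
  "\<one>\<^bsub>A\<^esub> \<in> carrier A"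
  "x \<in> carrier A \<Longrightarrow> y \<in> carrier A \<Longrightarrow> lmeet A x y \<in> carrier A"
  "x \<in> carrier A \<Longrightarrow> y \<in> carrier A \<Longrightarrow> ljoin A x y \<in> carrier A"
  "x \<in> carrier A \<Longrightarrow> y \<in> carrier A \<Longrightarrow> x \<otimes>\<^bsub>A\<^esub> y \<in> carrier A"
  "x \<in> carrier A \<Longrightarrow> y \<in> carrier A \<Longrightarrow> ldiv A x y \<in> carrier A"
  "x \<in> carrier A \<Longrightarrow> y \<in> carrier A \<Longrightarrow> rdiv A x y \<in> carrier A"
  using similar unfolding similar_algebra_def by blast+

lemma latt:
  assumes "x \<in> carrier A" "y \<in> carrier A"
  shows "lmeet A x y = lmeet A y x" "ljoin A x y = ljoin A y x"
    "lmeet A x (ljoin A x y) = x" "ljoin A x (lmeet A x y) = x"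
  using lattice assms unfolding is_lattice_def by blast+

lemma latt_assoc:
  assumes "x \<in> carrier A" "y \<in> carrier A" "z \<in> carrier A"
  shows "lmeet A (lmeet A x y) z = lmeet A x (lmeet A y z)"
    "ljoin A (ljoin A x y) z = ljoin A x (ljoin A y z)"
  using lattice assms unfolding is_lattice_def by blast+

lemma rle_join: "x \<in> carrier A \<Longrightarrow> y \<in> carrier A \<Longrightarrow> rle A x y \<longleftrightarrow> ljoin A x y = y"
  unfolding rle_def using latt by metis

lemma rle_refl: "x \<in> carrier A \<Longrightarrow> rle A x x"
  unfolding rle_def using latt closed by metis

lemma rle_antisym: "x \<in> carrier A \<Longrightarrow> y \<in> carrier A \<Longrightarrow> rle A x y \<Longrightarrow> rle A y x \<Longrightarrow> x = y"
  unfolding rle_def using latt by metis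

lemma rle_trans:
  "x \<in> carrier A \<Longrightarrow> y \<in> carrier A \<Longrightarrow> z \<in> carrier A \<Longrightarrow> rle A x y \<Longrightarrow> rle A y z \<Longrightarrow> rle A x z"
  unfolding rle_def using latt_assoc by metis

lemma rle_meet:
  assumes x: "x \<in> carrier A" and y: "y \<in> carrier A" and z: "z \<in> carrier A"
  shows "rle A z (lmeet A x y) \<longleftrightarrow> rle A z x \<and> rle A z y"
proof -
  have "rle A (lmeet A x y) x" "rle A (lmeet A x y) y"
    unfolding rle_def using x y latt latt_assoc rle_refl rle_def closed by metis+
  moreover have "rle A z (lmeet A x y)" if "rle A z x" "rle A z y"
    using that latt_assoc(1)[OF z x y] unfolding rle_def by simp
  ultimately show ?thesis
    using rle_trans[OF z closed(2)[OF x y] x] rle_trans[OF z closed(2)[OF x y] y] by blast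
qed

lemma rle_join_iff:
  assumes x: "x \<in> carrier A" and y: "y \<in> carrier A" and z: "z \<in> carrier A"
  shows "rle A (ljoin A x y) z \<longleftrightarrow> rle A x z \<and> rle A y z"
proof -
  have "rle A x (ljoin A x y)" "rle A y (ljoin A x y)"
    unfolding rle_def using latt x y by metis+
  moreover have "rle A (ljoin A x y) z" if "rle A x z" "rle A y z"
    using that latt_assoc(2)[OF x y z] rle_join x y z closed by simp
  ultimately show ?thesis
    using rle_trans[OF x closed(3)[OF x y] z] rle_trans[OF y closed(3)[OF x y] z] by blast
qed

end

lemma residuated_rl_lattice: "residuated_lattice A \<Longrightarrow> rl_lattice A"
  unfolding residuated_lattice_def rl_lattice_def by blast

text \<open>The identity by which semiconicity enters the arithmetic: in a conic algebra one of the
  two meets is the unit, and identities pass to the generated variety.\<close>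

definition semiconic_eq :: "rl_term \<times> rl_term" where
  "semiconic_eq = (Join (Meet (Var 0) One) (Meet (LDiv (Var 0) One) One), One)"

lemma conic_semiconic_eq:
  fixes B :: "'u rlat"
  assumes "residuated_lattice B" "conic B" shows "satisfies B semiconic_eq"
  unfolding satisfies_def
proof (intro allI impI)
  fix v :: "nat \<Rightarrow> 'u" assume v: "\<forall>n. v n \<in> carrier B"
  interpret rl_lattice B using assms(1) by (rule residuated_rl_lattice)
  interpret monoid B using assms(1) unfolding residuated_lattice_def by blast
  let ?x = "v 0" and ?e = "\<one>\<^bsub>B\<^esub>"
  have x: "?x \<in> carrier B" using v by blast
  have "rle B ?e (ldiv B ?x ?e) \<longleftrightarrow> rle B (?x \<otimes>\<^bsub>B\<^esub> ?e) ?e"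
    using assms(1) x unfolding residuated_lattice_def by simp
  hence "rle B ?e ?x \<or> rle B ?e (ldiv B ?x ?e)"
    using assms(2) x unfolding conic_def by auto
  hence *: "rle B ?e (lmeet B ?x ?e) \<or> rle B ?e (lmeet B (ldiv B ?x ?e) ?e)"
    using rle_meet rle_refl x by simp
  have le: "rle B (lmeet B ?x ?e) ?e" "rle B (lmeet B (ldiv B ?x ?e) ?e) ?e"
    using rle_meet[of _ ?e] rle_refl x by (metis closed)+
  have "lmeet B ?x ?e = ?e \<or> lmeet B (ldiv B ?x ?e) ?e = ?e"
    using * le rle_antisym x by (meson closed)
  thus "eval_term B v (fst semiconic_eq) = eval_term B v (snd semiconic_eq)"
    using le rle_join latt(2) x unfolding semiconic_eq_def by (simp, metis closed)
qed

lemma semiconic_satisfies: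
  assumes "semiconic A" "\<And>B :: 'u rlat. residuated_lattice B \<Longrightarrow> conic B \<Longrightarrow> satisfies B t"
  shows "satisfies (A :: 'u rlat) t"
proof -
  let ?V = "{A :: 'u rlat. similar_algebra A \<and> (\<forall>u\<in>{t}. satisfies A u)}"
  have "variety ?V" unfolding variety_def by blast
  moreover have "{B. residuated_lattice B \<and> conic B} \<subseteq> ?V"
    using assms(2) unfolding residuated_lattice_def by blast
  ultimately have "A \<in> ?V" using assms(1) unfolding semiconic_def variety_generated_def by blast
  thus ?thesis by blast
qed

text \<open>The operations of \<open>A\<close>, extended to the whole type by reading elements outside the carrier
  as the unit. The preorder then satisfies the laws without carrier conditions.\<close>

definition tz :: "'u rlat \<Rightarrow> 'u \<Rightarrow> 'u" where "tz A x = (if x \<in> carrier A then x else \<one>\<^bsub>A\<^esub>)"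
definition leT :: "'u rlat \<Rightarrow> 'u \<Rightarrow> 'u \<Rightarrow> bool" where "leT A x y \<longleftrightarrow> rle A (tz A x) (tz A y)"
definition mulT :: "'u rlat \<Rightarrow> 'u \<Rightarrow> 'u \<Rightarrow> 'u" where "mulT A x y = tz A x \<otimes>\<^bsub>A\<^esub> tz A y"
definition impT :: "'u rlat \<Rightarrow> 'u \<Rightarrow> 'u \<Rightarrow> 'u" where "impT A x y = ldiv A (tz A x) (tz A y)"
definition mtT :: "'u rlat \<Rightarrow> 'u \<Rightarrow> 'u \<Rightarrow> 'u" where "mtT A x y = lmeet A (tz A x) (tz A y)"
definition jnT :: "'u rlat \<Rightarrow> 'u \<Rightarrow> 'u \<Rightarrow> 'u" where "jnT A x y = ljoin A (tz A x) (tz A y)"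

lemma tz_id [simp]: "x \<in> carrier A \<Longrightarrow> tz A x = x" by (simp add: tz_def)

locale gsm_algebra =
  fixes A :: "'u rlat"
  assumes gsm_A: "A \<in> semiconic_GSM"
begin

lemma ax: "residuated_lattice A" "comm_monoid A" "semiconic A" "idempotent A"
  "x \<in> carrier A \<Longrightarrow> star A (star A (ljoin A x \<one>\<^bsub>A\<^esub>)) = ljoin A x \<one>\<^bsub>A\<^esub>"
  using gsm_A unfolding semiconic_GSM_def by blast+

sublocale rl_lattice A using ax(1) by (rule residuated_rl_lattice)

sublocale M: comm_monoid A by (rule ax(2))

lemma tz_closed [simp]: "tz A x \<in> carrier A" by (simp add: tz_def)

lemma opT_closed [simp]: "mulT A x y \<in> carrier A" "impT A x y \<in> carrier A"
  "mtT A x y \<in> carrier A" "jnT A x y \<in> carrier A"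
  by (simp_all add: mulT_def impT_def mtT_def jnT_def)

sublocale preordered_rl "leT A" "mulT A" "impT A" "mtT A" "jnT A" "\<one>\<^bsub>A\<^esub>"
proof
  fix x y z
  let ?x = "tz A x" and ?y = "tz A y" and ?z = "tz A z"
  have car: "?x \<in> carrier A" "?y \<in> carrier A" "?z \<in> carrier A" by simp_all
  show "leT A x x" by (simp add: leT_def rle_refl)
  show "leT A x y \<Longrightarrow> leT A y z \<Longrightarrow> leT A x z" unfolding leT_def using rle_trans[OF car] .
  show "leT A (mulT A x y) z = leT A y (impT A x z)"
    using ax(1) unfolding residuated_lattice_def by (simp add: leT_def mulT_def impT_def)
  show "leT A (mulT A x y) (mulT A y x)"
    using M.m_comm[of ?x ?y] by (simp add: leT_def mulT_def rle_refl)
  show "leT A (mulT A (mulT A x y) z) (mulT A x (mulT A y z))"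
    by (simp add: leT_def mulT_def M.m_assoc rle_refl)
  show "leT A (mulT A \<one>\<^bsub>A\<^esub> x) x" "leT A x (mulT A \<one>\<^bsub>A\<^esub> x)"
    by (simp_all add: leT_def mulT_def rle_refl)
  show "leT A x (mulT A x x)" "leT A (mulT A x x) x"
    using ax(4) unfolding idempotent_def by (simp_all add: leT_def mulT_def rle_refl)
  show "leT A z (mtT A x y) = (leT A z x \<and> leT A z y)"
    by (simp add: leT_def mtT_def rle_meet)
  show "leT A (jnT A x y) z = (leT A x z \<and> leT A y z)"
    by (simp add: leT_def jnT_def rle_join_iff)
  have "satisfies A semiconic_eq" using semiconic_satisfies[OF ax(3)] conic_semiconic_eq by blast
  hence "eval_term A (\<lambda>_. ?x) (fst semiconic_eq) = eval_term A (\<lambda>_. ?x) (snd semiconic_eq)"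
    unfolding satisfies_def by simp
  thus "leT A \<one>\<^bsub>A\<^esub> (jnT A (mtT A x \<one>\<^bsub>A\<^esub>) (mtT A (impT A x \<one>\<^bsub>A\<^esub>) \<one>\<^bsub>A\<^esub>))"
    by (simp add: leT_def jnT_def mtT_def impT_def semiconic_eq_def rle_refl)
  show "leT A (impT A (impT A (jnT A x \<one>\<^bsub>A\<^esub>) \<one>\<^bsub>A\<^esub>) \<one>\<^bsub>A\<^esub>) (jnT A x \<one>\<^bsub>A\<^esub>)"
    using ax(5)[OF car(1)] by (simp add: leT_def jnT_def impT_def star_def rle_refl)
qed

lemma eq_iff: "x \<in> carrier A \<Longrightarrow> y \<in> carrier A \<Longrightarrow> leT A x y \<Longrightarrow> leT A y x \<Longrightarrow> x = y"
  unfolding leT_def using rle_antisym by simp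

text \<open>The central law puts the double star of \<open>b\<close>, or the implication from it to
  \<open>b\<close>, into the prime \<open>Z\<close>. In either case \<open>b\<close> reaches
  \<open>P\<close>. This makes the nodes an up-set in the central case.\<close>

lemma nuc_up_if_central:
  assumes "A \<in> central_semiconic_GSM" and Z: "nuclear Z" and P: "prime P" "Z \<subseteq> P"
  shows "nuclear P"
proof -
  have ZF: "filt Z" and PF: "filt P" using Z P prime_filt unfolding nuclear_def by blast+
  have "b \<in> P" if b: "st (st b) \<in> P" for b
  proof -
    let ?b = "tz A b"
    have "rle A \<one>\<^bsub>A\<^esub> (ljoin A (star A (star A ?b)) (ldiv A (star A (star A ?b)) ?b))"
      using assms(1) unfolding central_semiconic_GSM_def by simp
    hence "leT A \<one>\<^bsub>A\<^esub> (jnT A (st (st b)) (impT A (st (st b)) b))"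
      unfolding leT_def jnT_def st_def star_def impT_def by simp
    hence "st (st b) \<in> Z \<or> impT A (st (st b)) b \<in> Z"
      using filt_e[OF ZF] prime_jn Z unfolding nuclear_def by blast
    thus ?thesis
    proof
      assume "st (st b) \<in> Z" thus ?thesis using Z P unfolding nuclear_def by blast
    next
      assume "impT A (st (st b)) b \<in> Z"
      hence "mulT A (st (st b)) (impT A (st (st b)) b) \<in> P" using b P filtD(3)[OF PF] by blast
      thus ?thesis using filtD(2)[OF PF] mp by blast
    qed
  qed
  thus ?thesis using P unfolding nuclear_def by blast
qed

end

section \<open>Traces along embeddings\<close>

locale gsm_embedding = A: gsm_algebra A + C: gsm_algebra C for A C :: "'u rlat" +
  fixes h :: "'u \<Rightarrow> 'u"
  assumes emb: "h \<in> embedding A C"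
begin

text \<open>Precomposing with \<open>tz\<close> makes the homomorphism equations hold on the whole
  type, so that traces are plain preimages.\<close>

definition f :: "'u \<Rightarrow> 'u" where "f x = h (tz A x)"

lemma h_closed: "x \<in> carrier A \<Longrightarrow> h x \<in> carrier C"
  and h_one: "h \<one>\<^bsub>A\<^esub> = \<one>\<^bsub>C\<^esub>"
  and h_ops: "x \<in> carrier A \<Longrightarrow> y \<in> carrier A \<Longrightarrow> h (lmeet A x y) = lmeet C (h x) (h y)"
    "x \<in> carrier A \<Longrightarrow> y \<in> carrier A \<Longrightarrow> h (ljoin A x y) = ljoin C (h x) (h y)"
    "x \<in> carrier A \<Longrightarrow> y \<in> carrier A \<Longrightarrow> h (ldiv A x y) = ldiv C (h x) (h y)"
    "x \<in> carrier A \<Longrightarrow> y \<in> carrier A \<Longrightarrow> h (x \<otimes>\<^bsub>A\<^esub> y) = h x \<otimes>\<^bsub>C\<^esub> h y"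
  using emb unfolding embedding_def rl_hom_def hom_def by auto

lemma h_inj: "inj_on h (carrier A)" using emb unfolding embedding_def by blast

lemma f_closed [simp]: "f x \<in> carrier C" by (simp add: f_def h_closed)

lemma f_ops [simp]: "f \<one>\<^bsub>A\<^esub> = \<one>\<^bsub>C\<^esub>" "f (mulT A x y) = mulT C (f x) (f y)" "f (impT A x y) = impT C (f x) (f y)"
  "f (mtT A x y) = mtT C (f x) (f y)" "f (jnT A x y) = jnT C (f x) (f y)"
  unfolding f_def by (simp_all add: h_one)
    (simp_all add: mulT_def impT_def mtT_def jnT_def h_ops h_closed)

lemma f_st [simp]: "f (A.st x) = C.st (f x)"
  unfolding A.st_def C.st_def by simp

lemma f_le: "leT C (f x) (f y) \<longleftrightarrow> leT A x y"
  unfolding leT_def rle_def f_def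
  using h_ops(1)[of "tz A x" "tz A y"] inj_on_eq_iff[OF h_inj, of "lmeet A (tz A x) (tz A y)" "tz A x"]
  by (simp add: h_closed)

lemma trace_filt: assumes "C.filt F" shows "A.filt (f -` F)"
  unfolding A.filt_def using C.filtD[OF assms] f_le by auto

lemma trace_prime: assumes "C.prime P" shows "A.prime (f -` P)"
  unfolding A.prime_def using trace_filt[OF C.prime_filt[OF assms]] C.prime_jn[OF assms] by auto

lemma trace_nuc: assumes "C.nuclear P" shows "A.nuclear (f -` P)"
  unfolding A.nuclear_def using trace_prime assms unfolding C.nuclear_def by auto

lemma compl_directed:
  assumes "A.prime R" "x \<in> f ` (- R)" "y \<in> f ` (- R)"
  shows "\<exists>z\<in>f ` (- R). leT C x z \<and> leT C y z"
proof -
  obtain a b where "a \<notin> R" "b \<notin> R" "x = f a" "y = f b" using assms by auto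
  moreover from this have "jnT A a b \<notin> R" using A.prime_jn[OF assms(1)] by blast
  hence "f (jnT A a b) \<in> f ` (- R)" by blast
  ultimately show ?thesis using C.jn1[of "f a" "f b"] C.jn2[of "f b" "f a"] by auto
qed

lemma going_up:
  assumes F: "C.filt F" and R: "A.prime R" "f -` F \<subseteq> R"
  shows "\<exists>P. C.prime P \<and> F \<subseteq> P \<and> f -` P = R"
proof -
  note RF = A.prime_filt[OF R(1)]
  let ?e = "\<one>\<^bsub>A\<^esub>"
  let ?G = "{mulT C q (f (mtT A r ?e)) |q r. q \<in> F \<and> r \<in> R}"
  let ?H = "{c. \<exists>g\<in>?G. leT C g c}"
  have le1: "leT C (f (mtT A r ?e)) \<one>\<^bsub>C\<^esub>" for r using C.mt2 by simp
  have "C.filt ?H"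
  proof (rule C.filt_closure)
    show "?G \<noteq> {}" using C.filtD(1)[OF F] A.filtD(1)[OF RF] by blast
    fix x y assume "x \<in> ?G" "y \<in> ?G"
    then obtain q r q' r' where m: "q \<in> F" "r \<in> R" "q' \<in> F" "r' \<in> R"
      and x: "x = mulT C q (f (mtT A r ?e))" and y: "y = mulT C q' (f (mtT A r' ?e))" by blast
    let ?q = "mtT C (mulT C q q') \<one>\<^bsub>C\<^esub>" and ?r = "mtT A r r'"
    have "?q \<in> F" using m C.filtD[OF F] by blast
    moreover have "?r \<in> R" using m A.filt_mt[OF RF] by blast
    moreover have "leT C (mulT C ?q (f (mtT A ?r ?e))) \<one>\<^bsub>C\<^esub>"
      using C.trans[OF C.mul_le2[OF le1] C.mt2] .
    moreover have "leT A (mtT A ?r ?e) (mulT A (mtT A r ?e) (mtT A r' ?e))"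
    proof -
      have "leT A (mtT A ?r ?e) (mtT A r ?e)" "leT A (mtT A ?r ?e) (mtT A r' ?e)"
        using A.mt_mono[OF A.mt1 A.refl] A.mt_mono[OF A.mt2 A.refl] by blast+
      thus ?thesis using A.trans[OF A.idem1 A.mul_mono] by blast
    qed
    hence "leT C (f (mtT A ?r ?e)) (mulT C (f (mtT A r ?e)) (f (mtT A r' ?e)))"
      using f_le by (metis f_ops(2))
    hence "leT C (mulT C ?q (f (mtT A ?r ?e))) (mulT C x y)"
      unfolding x y using C.trans[OF C.mul_mono[OF C.mt1] C.mul4] by blast
    ultimately show "\<exists>z\<in>?G. leT C z \<one>\<^bsub>C\<^esub> \<and> leT C z (mulT C x y)" by blast
  qed
  moreover have "?H \<inter> f ` (- R) = {}"
  proof -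
    have "a \<in> R" if "q \<in> F" "r \<in> R" "leT C (mulT C q (f (mtT A r ?e))) (f a)" for q r a
    proof -
      have "leT C q (f (impT A (mtT A r ?e) a))" using that C.res' by simp
      hence "impT A (mtT A r ?e) a \<in> R" using that(1) C.filtD(2)[OF F] R(2) by blast
      hence "mulT A (mtT A r ?e) (impT A (mtT A r ?e) a) \<in> R"
        using that(2) A.filtD(3,4)[OF RF] by blast
      thus ?thesis using A.filtD(2)[OF RF] A.mp by blast
    qed
    thus ?thesis by blast
  qed
  ultimately obtain P where P: "C.prime P" "?H \<subseteq> P" "P \<inter> f ` (- R) = {}"
    using C.prime_filter[of ?H "f ` (- R)"] compl_directed[OF R(1)] by auto
  have "q \<in> ?H" if "q \<in> F" for q
    using that A.filtD(1)[OF RF] C.mul_le2[OF le1, of q] by blast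
  moreover have "f r \<in> ?H" if "r \<in> R" for r
  proof -
    have "leT C (mulT C \<one>\<^bsub>C\<^esub> (f (mtT A r ?e))) (f r)"
      using C.trans[OF C.unit1] f_le A.mt1 by blast
    thus ?thesis using that C.filtD(1)[OF F] by blast
  qed
  ultimately have "F \<subseteq> P" "R \<subseteq> f -` P" using P(2) by blast+
  thus ?thesis using P by blast
qed

text \<open>The witness is the cut of \<open>Q\<close> by the image of the complement of
  \<open>R\<close>. Its hypothesis holds because \<open>R\<close> is nuclear and contains the trace
  of \<open>Q\<close>; modus ponens shows that it contains every prime above \<open>Q\<close> with
  trace \<open>R\<close>.\<close>

lemma greatest_nuc:
  assumes Q: "C.prime Q" and R: "A.nuclear R" "f -` Q \<subseteq> R"
  shows "\<exists>M. C.nuclear M \<and> Q \<subseteq> M \<and> f -` M = R \<and> (\<forall>P. C.prime P \<and> Q \<subseteq> P \<and> f -` P = R \<longrightarrow> P \<subseteq> M)"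
proof -
  have Rp: "A.prime R" using R unfolding A.nuclear_def by blast
  note RF = A.prime_filt[OF Rp] and QF = C.prime_filt[OF Q]
  let ?T = "f ` (- R)"
  let ?M = "C.cut Q ?T"
  have st: "a \<in> R" if "C.st (C.st (f a)) \<in> Q" for a
  proof -
    have "A.st (A.st a) \<in> f -` Q" using that by simp
    thus ?thesis using R unfolding A.nuclear_def by blast
  qed
  have T: "\<And>t. t \<in> ?T \<Longrightarrow> C.st (C.st t) \<notin> Q" using st by blast
  have M: "C.nuclear ?M"
    by (rule C.cut_nuc(1)[OF Q]) (use T compl_directed[OF Rp] in blast)+
  have QM: "Q \<subseteq> ?M"
    by (rule C.cut_nuc(2)[OF Q]) (use T compl_directed[OF Rp] in blast)+
  have MT: "?T \<inter> ?M = {}"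
    by (rule C.cut_nuc(3)[OF Q]) (use T compl_directed[OF Rp] in blast)+
  have "f r \<in> ?M" if r: "r \<in> R" for r
    unfolding C.cut_def
  proof (intro CollectI ballI notI)
    fix t assume "t \<in> ?T" and a: "impT C (mtT C (f r) \<one>\<^bsub>C\<^esub>) (C.st (C.st t)) \<in> Q"
    then obtain b where b: "b \<notin> R" "t = f b" by blast
    have "f (impT A (mtT A r \<one>\<^bsub>A\<^esub>) (A.st (A.st b))) \<in> Q" using a b by simp
    hence "impT A (mtT A r \<one>\<^bsub>A\<^esub>) (A.st (A.st b)) \<in> R" using R by blast
    hence "mulT A (mtT A r \<one>\<^bsub>A\<^esub>) (impT A (mtT A r \<one>\<^bsub>A\<^esub>) (A.st (A.st b))) \<in> R"
      using r A.filtD(3,4)[OF RF] by blast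
    hence "A.st (A.st b) \<in> R" using A.filtD(2)[OF RF] A.mp by blast
    thus False using R b unfolding A.nuclear_def by blast
  qed
  hence "f -` ?M = R" using MT by blast
  moreover have "P \<subseteq> ?M" if P: "C.prime P" "Q \<subseteq> P" "f -` P = R" for P
  proof
    fix p assume p: "p \<in> P"
    note PF = C.prime_filt[OF P(1)]
    show "p \<in> ?M"
      unfolding C.cut_def
    proof (intro CollectI ballI notI)
      fix t assume "t \<in> ?T" and a: "impT C (mtT C p \<one>\<^bsub>C\<^esub>) (C.st (C.st t)) \<in> Q"
      then obtain b where b: "b \<notin> R" "t = f b" by blast
      have "mulT C (mtT C p \<one>\<^bsub>C\<^esub>) (impT C (mtT C p \<one>\<^bsub>C\<^esub>) (C.st (C.st t))) \<in> P"
        using p a P(2) C.filtD(3,4)[OF PF] by blast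
      hence "C.st (C.st t) \<in> P" using C.filtD(2)[OF PF] C.mp by blast
      hence "A.st (A.st b) \<in> f -` P" using b by simp
      thus False using R b P(3) unfolding A.nuclear_def by blast
    qed
  qed
  ultimately show ?thesis using M QM by blast
qed

lemma spectrum_side:
  assumes Q: "C.prime Q"
  shows "side {P. C.prime P \<and> Q \<subseteq> P} Q {P. C.nuclear P \<and> Q \<subseteq> P} (vimage f) {R. A.prime R} {R. A.nuclear R}"
proof
  show "Q \<in> {P. C.prime P \<and> Q \<subseteq> P}" using Q by blast
  show "Q \<subseteq> P" if "P \<in> {P. C.prime P \<and> Q \<subseteq> P}" for P using that by blast
  show "Z \<in> {P. C.prime P \<and> Q \<subseteq> P}" if "Z \<in> {P. C.nuclear P \<and> Q \<subseteq> P}" for Z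
    using that unfolding C.nuclear_def by blast
  show "Z \<subseteq> P \<or> P \<subseteq> Z" if "Z \<in> {P. C.nuclear P \<and> Q \<subseteq> P}" "P \<in> {P. C.prime P \<and> Q \<subseteq> P}" for Z P
    using that C.nuc_comparable[of Z Q P] Q by blast
  show "f -` P \<in> {R. A.prime R}" if "P \<in> {P. C.prime P \<and> Q \<subseteq> P}" for P
    using that trace_prime by blast
  show "P \<subseteq> P' \<Longrightarrow> f -` P \<subseteq> f -` P'" for P P' by blast
  show "f -` Z \<in> {R. A.nuclear R}" if "Z \<in> {P. C.nuclear P \<and> Q \<subseteq> P}" for Z
    using that trace_nuc by blast
  show "\<exists>P'\<in>{P. C.prime P \<and> Q \<subseteq> P}. P \<subseteq> P' \<and> f -` P' = R"
    if P: "P \<in> {P. C.prime P \<and> Q \<subseteq> P}" "R \<in> {R. A.prime R}" "f -` P \<subseteq> R" for P R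
  proof -
    obtain P' where "C.prime P'" "P \<subseteq> P'" "f -` P' = R"
      using going_up[of P R] P C.prime_filt by auto
    thus ?thesis using P by blast
  qed
  fix R assume R: "R \<in> {R. A.nuclear R}" "f -` Q \<subseteq> R"
  obtain M where M: "C.nuclear M" "Q \<subseteq> M" "f -` M = R"
    "\<forall>P. C.prime P \<and> Q \<subseteq> P \<and> f -` P = R \<longrightarrow> P \<subseteq> M"
    using greatest_nuc[OF Q _ R(2)] R(1) by auto
  thus "\<exists>M\<in>{P. C.nuclear P \<and> Q \<subseteq> P}. f -` M = R \<and>
      (\<forall>P\<in>{P. C.prime P \<and> Q \<subseteq> P}. f -` P = R \<longrightarrow> P \<subseteq> M)"
    by (intro bexI[of _ M] conjI ballI) simp_all
  \<comment> \<open>The least node is the intersection of all nodes over \<open>R\<close>; the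
    family is nonempty because it contains \<open>M\<close>.\<close>
  let ?Z = "{Z. C.nuclear Z \<and> Q \<subseteq> Z \<and> f -` Z = R}"
  have "M \<in> ?Z" using M by blast
  hence "C.nuclear (\<Inter>?Z)" by (intro C.nuc_Inter[OF _ _ Q]) auto
  moreover have "Q \<subseteq> \<Inter>?Z" by blast
  moreover have "f -` \<Inter>?Z = R" using \<open>M \<in> ?Z\<close> by blast
  ultimately show "\<exists>m\<in>{P. C.nuclear P \<and> Q \<subseteq> P}. f -` m = R \<and>
      (\<forall>Z\<in>{P. C.nuclear P \<and> Q \<subseteq> P}. f -` Z = R \<longrightarrow> m \<subseteq> Z)"
    by (intro bexI[of _ "\<Inter>?Z"]) auto
qed

end

section \<open>Amalgamation over pairs of primes\<close>

text \<open>Semiconicity is left out and restored by \<open>semiconic_separated\<close>. The flag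
  \<open>z\<close> adds the central law, so that one argument serves both varieties.\<close>

definition gsm_alg :: "bool \<Rightarrow> 'd rlat \<Rightarrow> bool" where
  "gsm_alg z D \<longleftrightarrow> residuated_lattice D \<and> comm_monoid D \<and> idempotent D \<and>
     (\<forall>x\<in>carrier D. star D (star D (ljoin D x \<one>\<^bsub>D\<^esub>)) = ljoin D x \<one>\<^bsub>D\<^esub>) \<and>
     (z \<longrightarrow> (\<forall>x\<in>carrier D. rle D \<one>\<^bsub>D\<^esub> (ljoin D (star D (star D x)) (ldiv D (star D (star D x)) x))))"

text \<open>Unlike \<open>rl_hom\<close>, source and target may live over different types; frame
  algebras consist of pairs of sets of points.\<close>

definition hhom :: "'a rlat \<Rightarrow> 'd rlat \<Rightarrow> ('a \<Rightarrow> 'd) \<Rightarrow> bool" where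
  "hhom A D g \<longleftrightarrow> (\<forall>x\<in>carrier A. g x \<in> carrier D) \<and> g \<one>\<^bsub>A\<^esub> = \<one>\<^bsub>D\<^esub> \<and>
     (\<forall>x\<in>carrier A. \<forall>y\<in>carrier A. g (x \<otimes>\<^bsub>A\<^esub> y) = g x \<otimes>\<^bsub>D\<^esub> g y \<and>
        g (lmeet A x y) = lmeet D (g x) (g y) \<and> g (ljoin A x y) = ljoin D (g x) (g y) \<and>
        g (ldiv A x y) = ldiv D (g x) (g y) \<and> g (rdiv A x y) = rdiv D (g x) (g y))"

context gsm_algebra
begin

lemma rdiv_eq:
  assumes x: "x \<in> carrier A" and y: "y \<in> carrier A" shows "rdiv A x y = ldiv A y x"
proof -
  have *: "rle A w (rdiv A x y) \<longleftrightarrow> rle A w (ldiv A y x)" if w: "w \<in> carrier A" for w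
  proof -
    have "rle A w (rdiv A x y) \<longleftrightarrow> rle A (w \<otimes>\<^bsub>A\<^esub> y) x" "rle A w (ldiv A y x) \<longleftrightarrow> rle A (y \<otimes>\<^bsub>A\<^esub> w) x"
      using ax(1) x y w unfolding residuated_lattice_def by blast+
    thus ?thesis using M.m_comm[OF w y] by simp
  qed
  have "rdiv A x y \<in> carrier A" "ldiv A y x \<in> carrier A" using x y by simp_all
  thus ?thesis using * rle_refl rle_antisym by blast
qed

lemma rep_hhom:
  assumes "spectral_rep (leT A) (mulT A) (impT A) (mtT A) (jnT A) \<one>\<^bsub>A\<^esub> X fle Y \<pi> P0 r"
  shows "hhom A (frame.frame_alg X fle Y) (spectral_rep.rp (impT A) \<one>\<^bsub>A\<^esub> X \<pi>)"
proof -
  interpret R: spectral_rep "leT A" "mulT A" "impT A" "mtT A" "jnT A" "\<one>\<^bsub>A\<^esub>" X fle Y \<pi> P0 r by fact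
  show ?thesis
    unfolding hhom_def
  proof (intro conjI ballI)
    show "R.rp x \<in> carrier R.frame_alg" for x by (rule R.rp_carrier)
    show "R.rp \<one>\<^bsub>A\<^esub> = \<one>\<^bsub>R.frame_alg\<^esub>" by (simp add: R.rp_one)
    fix x y assume xy: "x \<in> carrier A" "y \<in> carrier A"
    show "R.rp (x \<otimes>\<^bsub>A\<^esub> y) = R.rp x \<otimes>\<^bsub>R.frame_alg\<^esub> R.rp y"
      using R.rp_mul[of x y] xy by (simp add: mulT_def)
    show "R.rp (lmeet A x y) = lmeet R.frame_alg (R.rp x) (R.rp y)"
      using R.rp_meet[of x y] xy by (simp add: mtT_def)
    show "R.rp (ljoin A x y) = ljoin R.frame_alg (R.rp x) (R.rp y)"
      using R.rp_join[of x y] xy by (simp add: jnT_def)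
    show "R.rp (ldiv A x y) = ldiv R.frame_alg (R.rp x) (R.rp y)"
      using R.rp_imp[of x y] xy by (simp add: impT_def)
    show "R.rp (rdiv A x y) = rdiv R.frame_alg (R.rp x) (R.rp y)"
      using R.rp_imp[of y x] xy by (simp add: impT_def rdiv_eq)
  qed
qed

end

locale gsm_span = F: gsm_embedding A B hB + G: gsm_embedding A C hC for A B C :: "'u rlat" and hB hC
begin

abbreviation "fB \<equiv> F.f"
abbreviation "fC \<equiv> G.f"

definition roots :: "('u set \<times> 'u set) set" where
  "roots = {(P, Q). F.C.prime P \<and> G.C.prime Q \<and> fB -` P = fC -` Q}"

text \<open>A local amalgam at one pair of primes. Its maps need not be injective: equal images give
  the order only modulo the root primes, and all pairs together restore injectivity. The last clause
  is what makes the final amalgam strong.\<close>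

definition root_amalgam ::
  "bool \<Rightarrow> 'u set \<times> 'u set \<Rightarrow> 'd rlat \<times> ('u \<Rightarrow> 'd) \<times> ('u \<Rightarrow> 'd) \<Rightarrow> bool" where
  "root_amalgam z r t \<longleftrightarrow> (case r of (PB, PC) \<Rightarrow> case t of (D, gB, gC) \<Rightarrow>
    gsm_alg z D \<and> conic D \<and> hhom B D gB \<and> hhom C D gC \<and>
    (\<forall>a. gB (fB a) = gC (fC a)) \<and>
    (\<forall>x y. gB x = gB y \<longrightarrow> F.C.lef PB x y) \<and> (\<forall>x y. gC x = gC y \<longrightarrow> G.C.lef PC x y) \<and>
    (\<forall>b c. gB b = gC c \<longrightarrow> (b \<in> PB \<longleftrightarrow> c \<in> PC) \<and> (F.C.st b \<in> PB \<longleftrightarrow> G.C.st c \<in> PC)))"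

text \<open>Both coordinate projections of the glued frame are spectral representations, by
  \<open>backB\<close> and \<open>backC\<close>, so \<open>B\<close> and \<open>C\<close> map into
  one frame algebra. Equality of traces makes the two maps agree on \<open>A\<close>.\<close>

lemma root_rep:
  assumes i: "(PB, PC) \<in> roots"
    and z: "z \<Longrightarrow> B \<in> central_semiconic_GSM" "z \<Longrightarrow> C \<in> central_semiconic_GSM"
  shows "\<exists>t :: (('u set \<times> 'u set) set \<times> ('u set \<times> 'u set) set) rlat \<times> _ \<times> _.
    root_amalgam z (PB, PC) t"
proof -
  have PB: "F.C.prime PB" and PC: "G.C.prime PC" and tr: "fB -` PB = fC -` PC"
    using i unfolding roots_def by auto
  let ?SB = "{P. F.C.prime P \<and> PB \<subseteq> P}" and ?YB = "{P. F.C.nuclear P \<and> PB \<subseteq> P}"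
  let ?SC = "{P. G.C.prime P \<and> PC \<subseteq> P}" and ?YC = "{P. G.C.nuclear P \<and> PC \<subseteq> P}"
  interpret T: two_sides ?SB PB ?YB "vimage fB" "{R. F.A.prime R}" "{R. F.A.nuclear R}" ?SC PC ?YC "vimage fC"
    by (intro two_sides.intro F.spectrum_side G.spectrum_side PB PC two_sides_axioms.intro tr)
  interpret frame T.pts T.ple T.nds by (rule T.frame_pts)
  have pt: "fst p \<in> ?SB" "snd p \<in> ?SC" "fB -` fst p = fC -` snd p" if "p \<in> T.pts" for p
    using T.ptsD that by blast+
  interpret RB: spectral_rep "leT B" "mulT B" "impT B" "mtT B" "jnT B" "\<one>\<^bsub>B\<^esub>" T.pts T.ple T.nds fst PB "(PB, PC)"
  proof
    fix p assume p: "p \<in> T.pts"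
    show "F.C.prime (fst p)" "PB \<subseteq> fst p" using pt[OF p] by blast+
    show "\<exists>q\<in>T.pts. T.ple p q \<and> fst q = P" if P: "F.C.prime P" "fst p \<subseteq> P" for P
      using T.backB[OF p, of P] P pt(1)[OF p] by blast
    show "\<exists>q\<in>T.nds. T.ple p q \<and> fst q = P" if P: "F.C.nuclear P" "fst p \<subseteq> P" for P
    proof -
      have P': "P \<in> ?SB" "P \<in> ?YB" using P pt(1)[OF p] unfolding F.C.nuclear_def by blast+
      obtain q where "q \<in> T.pts" "T.ple p q" "fst q = P" "snd q \<in> ?YC"
        using T.backB[OF p P'(1) P(2)] P'(2) by blast
      thus ?thesis using P'(2) unfolding T.nds_def by blast
    qed
  next
    show "(PB, PC) \<in> T.pts" by (rule T.root)
    show "fst (PB, PC) = PB" by simp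
    show "fst p \<subseteq> fst q" if "T.ple p q" for p q using that unfolding T.ple_def by blast
    show "F.C.nuclear (fst p)" if "p \<in> T.nds" for p using that unfolding T.nds_def by blast
  qed
  interpret RC: spectral_rep "leT C" "mulT C" "impT C" "mtT C" "jnT C" "\<one>\<^bsub>C\<^esub>" T.pts T.ple T.nds snd PC "(PB, PC)"
  proof
    fix p assume p: "p \<in> T.pts"
    show "G.C.prime (snd p)" "PC \<subseteq> snd p" using pt[OF p] by blast+
    show "\<exists>q\<in>T.pts. T.ple p q \<and> snd q = P" if P: "G.C.prime P" "snd p \<subseteq> P" for P
      using T.backC[OF p, of P] P pt(2)[OF p] by blast
    show "\<exists>q\<in>T.nds. T.ple p q \<and> snd q = P" if P: "G.C.nuclear P" "snd p \<subseteq> P" for P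
    proof -
      have P': "P \<in> ?SC" "P \<in> ?YC" using P pt(2)[OF p] unfolding G.C.nuclear_def by blast+
      obtain q where "q \<in> T.pts" "T.ple p q" "snd q = P" "fst q \<in> ?YB"
        using T.backC[OF p P'(1) P(2)] P'(2) by blast
      thus ?thesis using P'(2) unfolding T.nds_def by blast
    qed
  next
    show "(PB, PC) \<in> T.pts" by (rule T.root)
    show "snd (PB, PC) = PC" by simp
    show "snd p \<subseteq> snd q" if "T.ple p q" for p q using that unfolding T.ple_def by blast
    show "G.C.nuclear (snd p)" if "p \<in> T.nds" for p using that unfolding T.nds_def by blast
  qed
  have upY: "up T.nds" if z
  proof (rule T.nds_up)
    show "P \<in> ?YB" if "Z \<in> ?YB" "P \<in> ?SB" "Z \<subseteq> P" for Z P
      using that F.C.nuc_up_if_central[OF z(1)[OF \<open>z\<close>], of Z P] by blast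
    show "P \<in> ?YC" if "Z \<in> ?YC" "P \<in> ?SC" "Z \<subseteq> P" for Z P
      using that G.C.nuc_up_if_central[OF z(2)[OF \<open>z\<close>], of Z P] by blast
  qed
  have "root_amalgam z (PB, PC) (frame_alg, RB.rp, RC.rp)"
    unfolding root_amalgam_def prod.case
  proof (intro conjI allI impI)
    show "gsm_alg z frame_alg" unfolding gsm_alg_def
      using residuated_frame_alg monoid_frame_alg idem_frame_alg gsm_frame_alg central_frame_alg[OF upY] by blast
    show "conic frame_alg" by (rule conic_frame_alg)
    show "hhom B frame_alg RB.rp" by (rule F.C.rep_hhom) (rule RB.spectral_rep_axioms)
    show "hhom C frame_alg RC.rp" by (rule G.C.rep_hhom) (rule RC.spectral_rep_axioms)
    show "RB.rp (fB a) = RC.rp (fC a)" for a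
    proof -
      have *: "fB a \<in> fst p \<longleftrightarrow> fC a \<in> snd p" if "p \<in> T.pts" for p a using pt(3)[OF that] by blast
      have "RB.pos (fB a) = RC.pos (fC a)" "RB.pos (fB (F.A.st a)) = RC.pos (fC (F.A.st a))"
        unfolding RB.pos_def RC.pos_def using * by blast+
      thus ?thesis unfolding RB.rp_def RC.rp_def by simp
    qed
    show "F.C.lef PB x y" if "RB.rp x = RB.rp y" for x y
      using RB.rp_le[of x y] that by simp
    show "G.C.lef PC x y" if "RC.rp x = RC.rp y" for x y
      using RC.rp_le[of x y] that by simp
    fix b c assume "RB.rp b = RC.rp c"
    hence "RB.pos b = RC.pos c" "RB.pos (F.C.st b) = RC.pos (G.C.st c)"
      unfolding RB.rp_def RC.rp_def by simp_all
    hence "(PB, PC) \<in> RB.pos b \<longleftrightarrow> (PB, PC) \<in> RC.pos c"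
      "(PB, PC) \<in> RB.pos (F.C.st b) \<longleftrightarrow> (PB, PC) \<in> RC.pos (G.C.st c)" by simp_all
    thus "b \<in> PB \<longleftrightarrow> c \<in> PC" "F.C.st b \<in> PB \<longleftrightarrow> G.C.st c \<in> PC"
      using T.root unfolding RB.pos_def RC.pos_def by simp_all
  qed
  thus ?thesis ..
qed

lemma extend_root: "F.C.prime P \<Longrightarrow> \<exists>Q. (P, Q) \<in> roots"
proof -
  assume P: "F.C.prime P"
  have "fC -` {z. leT C \<one>\<^bsub>C\<^esub> z} \<subseteq> fB -` P"
  proof
    fix a assume "a \<in> fC -` {z. leT C \<one>\<^bsub>C\<^esub> z}"
    hence "leT C (fC \<one>\<^bsub>A\<^esub>) (fC a)" by simp
    hence "leT B (fB \<one>\<^bsub>A\<^esub>) (fB a)" unfolding F.f_le G.f_le .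
    thus "a \<in> fB -` P" using F.C.filt_e[OF F.C.prime_filt[OF P]] by simp
  qed
  then obtain Q where "G.C.prime Q" "fC -` Q = fB -` P"
    using G.going_up[OF G.C.filt_principal F.trace_prime[OF P]] by blast
  thus ?thesis using P unfolding roots_def by (intro exI[of _ Q]) simp
qed

text \<open>Without an interpolant, some prime \<open>Q\<close> omits \<open>z\<close> and contains
  all \<open>fC a\<close> with \<open>x\<close> below \<open>fB a\<close>. Lifting the trace of
  \<open>Q\<close> over the filter generated by \<open>x\<close> then gives a pair of primes against
  the assumption.\<close>

lemma interpolate:
  assumes x: "leT B x \<one>\<^bsub>B\<^esub>" and imp: "\<And>P Q. (P, Q) \<in> roots \<Longrightarrow> x \<in> P \<Longrightarrow> z \<in> Q"
  shows "\<exists>a. leT B x (fB a) \<and> leT C (fC a) z"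
proof (rule ccontr)
  assume n: "\<not> ?thesis"
  let ?G = "{fC a |a. leT B x (fB a)}"
  let ?H = "{c. \<exists>g\<in>?G. leT C g c}"
  have "G.C.filt ?H"
  proof (rule G.C.filt_closure)
    have "leT B x (fB \<one>\<^bsub>A\<^esub>)" using x by simp
    hence "fC \<one>\<^bsub>A\<^esub> \<in> ?G" by blast
    thus "?G \<noteq> {}" by blast
    fix c d assume "c \<in> ?G" "d \<in> ?G"
    then obtain a b where a: "c = fC a" "leT B x (fB a)" and b: "d = fC b" "leT B x (fB b)" by blast
    let ?m = "mtT A (mulT A a b) \<one>\<^bsub>A\<^esub>"
    have "leT B x (mulT B (fB a) (fB b))"
      using F.C.trans[OF F.C.idem1 F.C.mul_mono[OF a(2) b(2)]] .
    hence "leT B x (fB ?m)" using x by (simp add: F.C.mt_iff)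
    moreover have "leT C (fC ?m) \<one>\<^bsub>C\<^esub>" "leT C (fC ?m) (mulT C c d)"
      using G.C.mt1 G.C.mt2 a b by simp_all
    ultimately show "\<exists>z\<in>?G. leT C z \<one>\<^bsub>C\<^esub> \<and> leT C z (mulT C c d)" by blast
  qed
  moreover have "?H \<inter> {z} = {}" using n by blast
  ultimately obtain Q where Q: "G.C.prime Q" "?H \<subseteq> Q" "z \<notin> Q"
    using G.C.prime_filter[of ?H "{z}"] by auto
  \<comment> \<open>Since \<open>x\<close> is negative, the trace of this filter consists of those
    \<open>a\<close> with \<open>x\<close> below \<open>fB a\<close>, and \<open>Q\<close> was
    chosen to contain their images.\<close>
  let ?F = "F.C.adjoin {z. leT B \<one>\<^bsub>B\<^esub> z} x"
  have "fB -` ?F \<subseteq> fC -` Q"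
  proof
    fix a assume "a \<in> fB -` ?F"
    then obtain p where p: "leT B \<one>\<^bsub>B\<^esub> p" "leT B (mulT B p (mtT B x \<one>\<^bsub>B\<^esub>)) (fB a)"
      unfolding F.C.adjoin_def by auto
    have "leT B x (mtT B x \<one>\<^bsub>B\<^esub>)" using x by (simp add: F.C.mt_iff)
    hence "leT B x (fB a)" using F.C.trans[OF _ F.C.trans[OF F.C.mul_ge1[OF p(1)] p(2)]] by blast
    hence "fC a \<in> ?H" using G.C.refl by blast
    thus "a \<in> fC -` Q" using Q(2) by blast
  qed
  then obtain P where P: "F.C.prime P" "?F \<subseteq> P" "fB -` P = fC -` Q"
    using F.going_up[OF F.C.adjoin(1)[OF F.C.filt_principal] G.trace_prime[OF Q(1)]] by blast
  have "x \<in> P" using P(2) F.C.adjoin(3)[OF F.C.filt_principal] by blast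
  thus False using imp[of P Q] P Q unfolding roots_def by blast
qed

end

lemma gsm_span_swap: "gsm_span A B C hB hC \<Longrightarrow> gsm_span A C B hC hB"
  unfolding gsm_span_def by blast

context gsm_span
begin

lemma roots_swap: "(P, Q) \<in> gsm_span.roots A C B hC hB \<longleftrightarrow> (Q, P) \<in> roots"
  unfolding roots_def gsm_span.roots_def[OF gsm_span_swap[OF gsm_span_axioms]] by auto

text \<open>Interpolating in both directions gives \<open>x\<close> below \<open>fB a\<close>,
  \<open>fC a\<close> below \<open>y\<close> below \<open>fC b\<close>, and \<open>fB b\<close>
  below \<open>x\<close>. The embedding into \<open>C\<close> reflects \<open>a\<close> below
  \<open>b\<close>, which closes the circle.\<close>

lemma shared_negative:
  assumes x: "leT B x \<one>\<^bsub>B\<^esub>" and y: "leT C y \<one>\<^bsub>C\<^esub>"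
    and eq: "\<And>P Q. (P, Q) \<in> roots \<Longrightarrow> x \<in> P \<longleftrightarrow> y \<in> Q"
  shows "\<exists>a. leT B x (fB a) \<and> leT B (fB a) x"
proof -
  obtain a where a: "leT B x (fB a)" "leT C (fC a) y" using interpolate[OF x] eq by blast
  obtain b where b: "leT C y (fC b)" "leT B (fB b) x"
    using gsm_span.interpolate[OF gsm_span_swap[OF gsm_span_axioms] y, of x] eq unfolding roots_swap by blast
  have "leT C (fC a) (fC b)" using G.C.trans a b by blast
  hence "leT B (fB a) (fB b)" unfolding F.f_le G.f_le .
  thus ?thesis using a b F.C.trans by blast
qed

text \<open>An element is the product of its meet and its join with the unit. The join equals its
  own double star, and its star is the negative part of \<open>st b\<close>; so the two negative
  elements supplied by \<open>shared_negative\<close> determine \<open>b\<close>.\<close>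

lemma shared:
  assumes b: "b \<in> carrier B"
    and eq: "\<And>P Q. (P, Q) \<in> roots \<Longrightarrow> (b \<in> P \<longleftrightarrow> c \<in> Q) \<and> (F.C.st b \<in> P \<longleftrightarrow> G.C.st c \<in> Q)"
  shows "\<exists>a\<in>carrier A. hB a = b"
proof -
  let ?e = "\<one>\<^bsub>B\<^esub>"
  have *: "mtT B x ?e \<in> P \<longleftrightarrow> x \<in> P" "mtT C y \<one>\<^bsub>C\<^esub> \<in> Q \<longleftrightarrow> y \<in> Q" if "(P, Q) \<in> roots" for P Q x y
    using that F.C.filt_mt[OF F.C.prime_filt] G.C.filt_mt[OF G.C.prime_filt]
      F.C.filtD(1)[OF F.C.prime_filt] G.C.filtD(1)[OF G.C.prime_filt] unfolding roots_def by blast+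
  obtain a where a: "leT B (mtT B b ?e) (fB a)" "leT B (fB a) (mtT B b ?e)"
    using shared_negative[OF F.C.mt2 G.C.mt2, of b c] * eq by blast
  obtain s where s: "leT B (mtT B (F.C.st b) ?e) (fB s)" "leT B (fB s) (mtT B (F.C.st b) ?e)"
    using shared_negative[OF F.C.mt2 G.C.mt2, of "F.C.st b" "G.C.st c"] * eq by blast
  let ?j = "jnT B b ?e" and ?s = "F.C.st (fB s)"
  have "leT B (F.C.st ?j) (fB s)" "leT B (fB s) (F.C.st ?j)"
    using s F.C.st_jn1 F.C.st_jn2 F.C.trans by blast+
  hence "leT B ?s (F.C.st (F.C.st ?j))" "leT B (F.C.st (F.C.st ?j)) ?s"
    using F.C.st_anti by blast+
  moreover have "leT B (F.C.st (F.C.st ?j)) ?j" "leT B ?j (F.C.st (F.C.st ?j))"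
    using F.C.gsm'[OF F.C.jn2] F.C.st_st by blast+
  ultimately have j: "leT B ?j ?s" "leT B ?s ?j" using F.C.trans by blast+
  let ?r = "mulT B (fB a) ?s"
  have "leT B b ?r" using F.C.trans[OF F.C.decomp2 F.C.mul_mono[OF a(1) j(1)]] .
  moreover have "leT B ?r b" using F.C.trans[OF F.C.mul_mono[OF a(2) j(2)] F.C.decomp1] .
  ultimately have "b = ?r" using F.C.eq_iff b by simp
  also have "\<dots> = fB (mulT A a (F.A.st s))" by simp
  finally show ?thesis unfolding F.f_def by auto
qed

end

section \<open>Products, subalgebras and the varieties\<close>

lemma hhom_ops:
  assumes "hhom A D g"
  shows "x \<in> carrier A \<Longrightarrow> g x \<in> carrier D" "g \<one>\<^bsub>A\<^esub> = \<one>\<^bsub>D\<^esub>"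
    "x \<in> carrier A \<Longrightarrow> y \<in> carrier A \<Longrightarrow> g (x \<otimes>\<^bsub>A\<^esub> y) = g x \<otimes>\<^bsub>D\<^esub> g y"
    "x \<in> carrier A \<Longrightarrow> y \<in> carrier A \<Longrightarrow> g (lmeet A x y) = lmeet D (g x) (g y)"
    "x \<in> carrier A \<Longrightarrow> y \<in> carrier A \<Longrightarrow> g (ljoin A x y) = ljoin D (g x) (g y)"
    "x \<in> carrier A \<Longrightarrow> y \<in> carrier A \<Longrightarrow> g (ldiv A x y) = ldiv D (g x) (g y)"
    "x \<in> carrier A \<Longrightarrow> y \<in> carrier A \<Longrightarrow> g (rdiv A x y) = rdiv D (g x) (g y)"
  using assms unfolding hhom_def by blast+

lemma similar_ops:
  assumes "similar_algebra A"
  shows "\<one>\<^bsub>A\<^esub> \<in> carrier A"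
    "x \<in> carrier A \<Longrightarrow> y \<in> carrier A \<Longrightarrow> x \<otimes>\<^bsub>A\<^esub> y \<in> carrier A"
    "x \<in> carrier A \<Longrightarrow> y \<in> carrier A \<Longrightarrow> lmeet A x y \<in> carrier A"
    "x \<in> carrier A \<Longrightarrow> y \<in> carrier A \<Longrightarrow> ljoin A x y \<in> carrier A"
    "x \<in> carrier A \<Longrightarrow> y \<in> carrier A \<Longrightarrow> ldiv A x y \<in> carrier A"
    "x \<in> carrier A \<Longrightarrow> y \<in> carrier A \<Longrightarrow> rdiv A x y \<in> carrier A"
  using assms unfolding similar_algebra_def by blast+

lemma hhom_star:
  assumes "similar_algebra A" "hhom A D g" "x \<in> carrier A"
  shows "g (star A x) = star D (g x)" "star A x \<in> carrier A"
  unfolding star_def using assms(3) hhom_ops[OF assms(2)] similar_ops[OF assms(1)] by simp_all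

lemma hhom_compose: "hhom A D g \<Longrightarrow> hhom D E h \<Longrightarrow> hhom A E (h \<circ> g)"
  unfolding hhom_def by simp

lemma hhom_eval:
  assumes "similar_algebra A" "hhom A D g" "\<And>n. v n \<in> carrier A"
  shows "eval_term A v t \<in> carrier A \<and> g (eval_term A v t) = eval_term D (g \<circ> v) t"
  by (induction t) (simp_all add: assms similar_ops[OF assms(1)] hhom_ops[OF assms(2)])

text \<open>The class is a quasivariety, since all its axioms are universal Horn sentences.\<close>

lemma gsm_alg_separated:
  assumes N: "similar_algebra N" and D: "\<And>i. i \<in> I \<Longrightarrow> gsm_alg z (D i)"
    and p: "\<And>i. i \<in> I \<Longrightarrow> hhom N (D i) (p i)"
    and sep: "\<And>x y. x \<in> carrier N \<Longrightarrow> y \<in> carrier N \<Longrightarrow> (\<And>i. i \<in> I \<Longrightarrow> p i x = p i y) \<Longrightarrow> x = y"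
  shows "gsm_alg z N"
proof -
  note cl = similar_ops[OF N]
  note ho = hhom_ops[OF p]
  have R: "residuated_lattice (D i)" if "i \<in> I" for i using D[OF that] unfolding gsm_alg_def by blast
  note L = rl_lattice.latt[OF residuated_rl_lattice[OF R]] rl_lattice.latt_assoc[OF residuated_rl_lattice[OF R]]
  have le: "rle N x y \<longleftrightarrow> (\<forall>i\<in>I. rle (D i) (p i x) (p i y))"
    if xy: "x \<in> carrier N" "y \<in> carrier N" for x y
  proof
    show "rle N x y \<Longrightarrow> \<forall>i\<in>I. rle (D i) (p i x) (p i y)"
      unfolding rle_def using ho(4)[OF _ xy] by simp
    assume "\<forall>i\<in>I. rle (D i) (p i x) (p i y)"
    hence "p i (lmeet N x y) = p i x" if "i \<in> I" for i
      unfolding rle_def using ho(4)[OF that xy] that by simp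
    thus "rle N x y" unfolding rle_def by (intro sep) (simp_all add: cl xy)
  qed
  have st: "p i (star N x) = star (D i) (p i x)" "star N x \<in> carrier N" if "i \<in> I" "x \<in> carrier N" for i x
    using hhom_star[OF N p] that by blast+
  have stc: "star N x \<in> carrier N" if "x \<in> carrier N" for x unfolding star_def using that cl by simp
  have lat: "is_lattice N"
    unfolding is_lattice_def
  proof (intro conjI ballI)
    fix x y assume xy: "x \<in> carrier N" "y \<in> carrier N"
    show "lmeet N x y = lmeet N y x"
      by (rule sep) (use xy in \<open>simp_all add: cl ho L(1)[of _ "p _ x" "p _ y"]\<close>)
    show "ljoin N x y = ljoin N y x"
      by (rule sep) (use xy in \<open>simp_all add: cl ho L(2)[of _ "p _ x" "p _ y"]\<close>)
    show "lmeet N x (ljoin N x y) = x" "ljoin N x (lmeet N x y) = x"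
      by (rule sep; use xy in \<open>simp add: cl ho L(3,4)\<close>)+
    fix z assume z: "z \<in> carrier N"
    show "lmeet N (lmeet N x y) z = lmeet N x (lmeet N y z)"
      "ljoin N (ljoin N x y) z = ljoin N x (ljoin N y z)"
      by (rule sep; use xy z in \<open>simp add: cl ho L(5,6)\<close>)+
  qed
  have m: "comm_monoid N"
  proof (rule comm_monoidI)
    have D': "comm_monoid (D i)" if "i \<in> I" for i using D[OF that] unfolding gsm_alg_def by blast
    note Dm = comm_monoid.axioms(1)[OF D']
    show "\<one>\<^bsub>N\<^esub> \<in> carrier N" by (rule cl)
    fix x y assume xy: "x \<in> carrier N" "y \<in> carrier N"
    show "x \<otimes>\<^bsub>N\<^esub> y \<in> carrier N" using xy by (rule cl)
    show "\<one>\<^bsub>N\<^esub> \<otimes>\<^bsub>N\<^esub> x = x"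
      by (rule sep) (use xy in \<open>simp_all add: cl ho monoid.l_one[OF Dm]\<close>)
    show "x \<otimes>\<^bsub>N\<^esub> y = y \<otimes>\<^bsub>N\<^esub> x"
      by (rule sep) (use xy in \<open>simp_all add: cl ho comm_monoid.m_comm[OF D']\<close>)
    fix z assume "z \<in> carrier N"
    thus "x \<otimes>\<^bsub>N\<^esub> y \<otimes>\<^bsub>N\<^esub> z = x \<otimes>\<^bsub>N\<^esub> (y \<otimes>\<^bsub>N\<^esub> z)"
      by (intro sep) (use xy in \<open>simp_all add: cl ho monoid.m_assoc[OF Dm]\<close>)
  qed
  have res: "residuated_lattice N"
    unfolding residuated_lattice_def
  proof (intro conjI ballI N lat comm_monoid.axioms(1)[OF m])
    fix x y z assume xyz: "x \<in> carrier N" "y \<in> carrier N" "z \<in> carrier N"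
    have "rle (D i) (p i y) (ldiv (D i) (p i x) (p i z)) \<longleftrightarrow> rle (D i) (p i x \<otimes>\<^bsub>D i\<^esub> p i y) (p i z)"
      "rle (D i) (p i x \<otimes>\<^bsub>D i\<^esub> p i y) (p i z) \<longleftrightarrow> rle (D i) (p i x) (rdiv (D i) (p i z) (p i y))"
      if "i \<in> I" for i
      using R[OF that] ho(1)[OF that] xyz unfolding residuated_lattice_def by simp_all
    thus "rle N y (ldiv N x z) = rle N (x \<otimes>\<^bsub>N\<^esub> y) z" "rle N (x \<otimes>\<^bsub>N\<^esub> y) z = rle N x (rdiv N z y)"
      using xyz by (simp_all add: le cl ho)
  qed
  have id: "idempotent N"
    unfolding idempotent_def
  proof
    fix x assume x: "x \<in> carrier N"
    have "p i x \<otimes>\<^bsub>D i\<^esub> p i x = p i x" if "i \<in> I" for i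
      using D[OF that] ho(1)[OF that x] unfolding gsm_alg_def idempotent_def by blast
    thus "x \<otimes>\<^bsub>N\<^esub> x = x" by (intro sep) (use x in \<open>simp_all add: cl ho\<close>)
  qed
  have g: "star N (star N (ljoin N x \<one>\<^bsub>N\<^esub>)) = ljoin N x \<one>\<^bsub>N\<^esub>" if x: "x \<in> carrier N" for x
  proof -
    have "star (D i) (star (D i) (ljoin (D i) (p i x) \<one>\<^bsub>D i\<^esub>)) = ljoin (D i) (p i x) \<one>\<^bsub>D i\<^esub>" if "i \<in> I" for i
      using D[OF that] ho(1)[OF that x] unfolding gsm_alg_def by blast
    thus ?thesis by (intro sep) (use x in \<open>simp_all add: cl ho st stc\<close>)
  qed
  have c: "rle N \<one>\<^bsub>N\<^esub> (ljoin N (star N (star N x)) (ldiv N (star N (star N x)) x))"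
    if x: "x \<in> carrier N" and z for x
  proof -
    have "rle (D i) \<one>\<^bsub>D i\<^esub> (ljoin (D i) (star (D i) (star (D i) (p i x))) (ldiv (D i) (star (D i) (star (D i) (p i x))) (p i x)))"
      if "i \<in> I" for i
      using D[OF that] ho(1)[OF that x] \<open>z\<close> unfolding gsm_alg_def by blast
    thus ?thesis using x by (simp add: le cl ho st stc)
  qed
  show ?thesis unfolding gsm_alg_def using res m id g c by blast
qed

text \<open>Transports the operations of \<open>D\<close> on a subset \<open>S\<close> to another
  type, with encoder \<open>e\<close> and decoder \<open>d\<close>.\<close>

definition copy :: "'d set \<Rightarrow> ('d \<Rightarrow> 'u) \<Rightarrow> ('u \<Rightarrow> 'd) \<Rightarrow> 'd rlat \<Rightarrow> 'u rlat" where
  "copy S e d D = \<lparr>carrier = e ` S, mult = \<lambda>x y. e (d x \<otimes>\<^bsub>D\<^esub> d y), one = e \<one>\<^bsub>D\<^esub>,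
     lmeet = \<lambda>x y. e (lmeet D (d x) (d y)), ljoin = \<lambda>x y. e (ljoin D (d x) (d y)),
     ldiv = \<lambda>x y. e (ldiv D (d x) (d y)), rdiv = \<lambda>x y. e (rdiv D (d x) (d y))\<rparr>"

definition subclosed :: "'d rlat \<Rightarrow> 'd set \<Rightarrow> bool" where
  "subclosed D S \<longleftrightarrow> S \<subseteq> carrier D \<and> \<one>\<^bsub>D\<^esub> \<in> S \<and> (\<forall>x\<in>S. \<forall>y\<in>S. x \<otimes>\<^bsub>D\<^esub> y \<in> S \<and> lmeet D x y \<in> S \<and>
     ljoin D x y \<in> S \<and> ldiv D x y \<in> S \<and> rdiv D x y \<in> S)"

lemma copy:
  assumes "subclosed D S" and d: "\<forall>s\<in>S. d (e s) = s"
  shows "similar_algebra (copy S e d D)" "hhom (copy S e d D) D d"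
    "hhom B D t \<Longrightarrow> t ` carrier B \<subseteq> S \<Longrightarrow> hhom B (copy S e d D) (e \<circ> t)"
  using assms unfolding subclosed_def similar_algebra_def hhom_def copy_def
  by (auto simp: image_subset_iff)

lemma copy_inj: "\<forall>s\<in>S. d (e s) = s \<Longrightarrow> x \<in> carrier (copy S e d D) \<Longrightarrow> y \<in> carrier (copy S e d D) \<Longrightarrow>
    d x = d y \<Longrightarrow> x = y"
  unfolding copy_def by auto

lemma image_subclosed:
  assumes N: "similar_algebra N" and q: "hhom N D q" shows "subclosed D (q ` carrier N)"
  unfolding subclosed_def
proof (intro conjI ballI)
  note h = hhom_ops[OF q] and cl = similar_ops[OF N]
  show "q ` carrier N \<subseteq> carrier D" using h(1) by blast
  show "\<one>\<^bsub>D\<^esub> \<in> q ` carrier N" using h(2) cl(1) by (metis imageI)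
  fix x y assume "x \<in> q ` carrier N" "y \<in> q ` carrier N"
  then obtain a b where ab: "a \<in> carrier N" "b \<in> carrier N" and [simp]: "x = q a" "y = q b" by blast
  show "x \<otimes>\<^bsub>D\<^esub> y \<in> q ` carrier N" using cl(2)[OF ab] by (simp flip: h(3)[OF ab])
  show "lmeet D x y \<in> q ` carrier N" using cl(3)[OF ab] by (simp flip: h(4)[OF ab])
  show "ljoin D x y \<in> q ` carrier N" using cl(4)[OF ab] by (simp flip: h(5)[OF ab])
  show "ldiv D x y \<in> q ` carrier N" using cl(5)[OF ab] by (simp flip: h(6)[OF ab])
  show "rdiv D x y \<in> q ` carrier N" using cl(6)[OF ab] by (simp flip: h(7)[OF ab])
qed

lemma semiconicI:
  assumes "similar_algebra (N :: 'u rlat)"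
    "\<And>t. (\<And>B :: 'u rlat. residuated_lattice B \<Longrightarrow> conic B \<Longrightarrow> satisfies B t) \<Longrightarrow> satisfies N t"
  shows "semiconic N"
  unfolding semiconic_def variety_generated_def
proof (rule InterI)
  fix V assume "V \<in> {V. variety V \<and> {B :: 'u rlat. residuated_lattice B \<and> conic B} \<subseteq> V}"
  then obtain E where V: "V = {A. similar_algebra A \<and> (\<forall>e\<in>E. satisfies A e)}"
    and sub: "{B. residuated_lattice B \<and> conic B} \<subseteq> V" unfolding variety_def by auto
  have "satisfies N t" if "t \<in> E" for t
    by (rule assms(2)) (use sub that in \<open>auto simp: V\<close>)
  thus "N \<in> V" using assms(1) V by blast
qed

text \<open>Identities are known only for conic algebras over \<open>'u\<close>, whereas the factors
  live over \<open>'d\<close>. So the image of \<open>N\<close> in each factor is copied back into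
  \<open>N\<close>; it is conic because its order is inherited from the factor.\<close>

lemma semiconic_separated:
  fixes N :: "'u rlat" and D :: "'i \<Rightarrow> 'd rlat"
  assumes N: "similar_algebra N" and D: "\<And>i. i \<in> I \<Longrightarrow> gsm_alg z (D i)" "\<And>i. i \<in> I \<Longrightarrow> conic (D i)"
    and p: "\<And>i. i \<in> I \<Longrightarrow> hhom N (D i) (p i)"
    and sep: "\<And>x y. x \<in> carrier N \<Longrightarrow> y \<in> carrier N \<Longrightarrow> (\<And>i. i \<in> I \<Longrightarrow> p i x = p i y) \<Longrightarrow> x = y"
  shows "semiconic N"
proof (rule semiconicI[OF N])
  fix t assume t: "\<And>B :: 'u rlat. residuated_lattice B \<Longrightarrow> conic B \<Longrightarrow> satisfies B t"
  show "satisfies N t"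
    unfolding satisfies_def
  proof (intro allI impI)
    fix v :: "nat \<Rightarrow> 'u" assume v: "\<forall>n. v n \<in> carrier N"
    show "eval_term N v (fst t) = eval_term N v (snd t)"
    proof (rule sep)
      show "eval_term N v (fst t) \<in> carrier N" "eval_term N v (snd t) \<in> carrier N"
        using hhom_eval[OF N, of N id v] v unfolding hhom_def by auto
      fix i assume i: "i \<in> I"
      let ?S = "p i ` carrier N"
      \<comment> \<open>Encodes an element of the image by one of its preimages in \<open>N\<close>,
        with \<open>p i\<close> as decoder.\<close>
      let ?e = "inv_into (carrier N) (p i)"
      let ?M = "copy ?S ?e (p i) (D i)"
      have S: "subclosed (D i) ?S" using N p[OF i] by (rule image_subclosed)
      have d: "\<forall>s\<in>?S. p i (?e s) = s" by (simp add: f_inv_into_f)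
      note M = copy[where e = ?e, OF S d]
      have "gsm_alg z ?M"
        by (rule gsm_alg_separated[where I = "{i}" and D = D and p = p])
          (use M D i copy_inj[where e = ?e and S = ?S, OF d] in auto)
      hence R: "residuated_lattice ?M" unfolding gsm_alg_def by blast
      have "rle ?M x y \<longleftrightarrow> rle (D i) (p i x) (p i y)" if "x \<in> carrier ?M" "y \<in> carrier ?M" for x y
        unfolding rle_def
        using hhom_ops(4)[OF M(2) that] copy_inj[where e = ?e and S = ?S, OF d, of "lmeet ?M x y" "D i" x]
          similar_ops(3)[OF M(1) that] that by auto
      hence "conic ?M"
        using D(2)[OF i] hhom_ops(1,2)[OF M(2)] similar_ops(1)[OF M(1)] unfolding conic_def by metis
      hence sat: "satisfies ?M t" using t R by blast
      have h: "hhom N ?M (?e \<circ> p i)" by (rule M(3)[OF p[OF i]]) simp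
      have "\<forall>n. (?e \<circ> p i \<circ> v) n \<in> carrier ?M" using hhom_ops(1)[OF h] v by simp
      hence "eval_term ?M (?e \<circ> p i \<circ> v) (fst t) = eval_term ?M (?e \<circ> p i \<circ> v) (snd t)"
        using sat unfolding satisfies_def by blast
      hence "(?e \<circ> p i) (eval_term N v (fst t)) = (?e \<circ> p i) (eval_term N v (snd t))"
        using hhom_eval[OF N h, of v] v by simp
      moreover have "p i (?e (p i (eval_term N v s))) = p i (eval_term N v s)" for s
        using d hhom_eval[OF N h, of v s] v by blast
      ultimately show "p i (eval_term N v (fst t)) = p i (eval_term N v (snd t))"
        by (metis comp_apply)
    qed
  qed
qed

section \<open>Cardinality bounds and subalgebras of products\<close>

lemma finite_small:
  includes cardinal_syntax
  assumes "infinite (UNIV :: 'u set)" "finite A" shows "|A| \<le>o |UNIV :: 'u set|"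
proof -
  obtain k :: "_ \<Rightarrow> nat" where "inj_on k A"
    using finite_imp_inj_to_nat_seg[OF assms(2)] by blast
  hence "|A| \<le>o |UNIV :: nat set|" by (rule card_of_ordLeqI) simp
  thus ?thesis using assms(1) infinite_iff_card_of_nat ordLeq_transitive by blast
qed

text \<open>The closure is a countable union of levels, each obtained from the previous one by
  finitely many binary operations; none of this exceeds an infinite cardinal.\<close>

lemma small_closure:
  includes cardinal_syntax
  fixes S :: "'x set" and Op :: "('x \<Rightarrow> 'x \<Rightarrow> 'x) set"
  assumes inf: "infinite (UNIV :: 'u set)" and Op: "finite Op" and S: "|S| \<le>o |UNIV :: 'u set|"
    and T: "S \<subseteq> T" "\<And>f x y. f \<in> Op \<Longrightarrow> x \<in> T \<Longrightarrow> y \<in> T \<Longrightarrow> f x y \<in> T"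
  shows "\<exists>G. S \<subseteq> G \<and> G \<subseteq> T \<and> (\<forall>f\<in>Op. \<forall>x\<in>G. \<forall>y\<in>G. f x y \<in> G) \<and> |G| \<le>o |UNIV :: 'u set|"
proof -
  \<comment> \<open>The added projection keeps every element of a level in the next, so the levels
    increase.\<close>
  define Op' where "Op' = insert (\<lambda>x y. x) Op"
  define step where "step W = (\<Union>f\<in>Op'. case_prod f ` (W \<times> W))" for W :: "'x set"
  define lev where "lev n = (step ^^ n) S" for n
  have lev_Suc: "lev (Suc n) = step (lev n)" for n unfolding lev_def by simp
  have nat: "|UNIV :: nat set| \<le>o |UNIV :: 'u set|" using inf infinite_iff_card_of_nat by blast
  have OpU: "|Op'| \<le>o |UNIV :: 'u set|"
    by (rule finite_small[OF inf]) (simp add: Op'_def Op)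
  have small: "|step W| \<le>o |UNIV :: 'u set|" if W: "|W| \<le>o |UNIV :: 'u set|" for W
  proof -
    have "|W \<times> W| \<le>o |UNIV :: 'u set|"
      using card_of_Sigma_ordLeq_infinite[OF inf W, of "\<lambda>_. W"] W by blast
    hence "\<forall>f\<in>Op'. |case_prod f ` (W \<times> W)| \<le>o |UNIV :: 'u set|"
      using card_of_image ordLeq_transitive by blast
    thus ?thesis unfolding step_def by (rule card_of_UNION_ordLeq_infinite[OF inf OpU])
  qed
  have lev: "|lev n| \<le>o |UNIV :: 'u set|" for n
    by (induction n) (simp add: lev_def S, simp add: lev_Suc small)
  have mono: "m \<le> n \<Longrightarrow> lev m \<subseteq> lev n" for m n
    by (rule lift_Suc_mono_le[of lev]) (force simp: lev_Suc step_def Op'_def)+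
  have stepT: "step W \<subseteq> T" if "W \<subseteq> T" for W
  proof
    fix t assume "t \<in> step W"
    then obtain f x y where "f = (\<lambda>x y. x) \<or> f \<in> Op" "x \<in> W" "y \<in> W" "t = f x y"
      unfolding step_def Op'_def by auto
    thus "t \<in> T" using T(2) that by auto
  qed
  have levT: "lev n \<subseteq> T" for n
    by (induction n) (simp add: lev_def T(1), simp add: lev_Suc stepT)
  let ?G = "\<Union>n. lev n"
  have "f x y \<in> ?G" if f: "f \<in> Op" and xy: "x \<in> ?G" "y \<in> ?G" for f x y
  proof -
    obtain m n where "x \<in> lev m" "y \<in> lev n" using xy by blast
    hence "x \<in> lev (max m n)" "y \<in> lev (max m n)"
      using mono[of m "max m n"] mono[of n "max m n"] by auto
    hence "f x y \<in> lev (Suc (max m n))" using f unfolding lev_Suc step_def Op'_def by force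
    thus ?thesis by blast
  qed
  moreover have "|?G| \<le>o |UNIV :: 'u set|"
    using card_of_UNION_ordLeq_infinite[OF inf nat] lev by blast
  moreover have "S \<subseteq> ?G" unfolding lev_def by (metis UN_upper UNIV_I funpow_0)
  moreover have "?G \<subseteq> T" using levT by blast
  ultimately show ?thesis by (intro exI[of _ ?G] conjI ballI)
qed

definition prod_alg :: "'i set \<Rightarrow> ('i \<Rightarrow> 'd rlat) \<Rightarrow> ('i \<Rightarrow> 'd) rlat" where
  "prod_alg I D = \<lparr>carrier = (\<Pi>\<^sub>E i\<in>I. carrier (D i)), mult = \<lambda>x y. \<lambda>i\<in>I. x i \<otimes>\<^bsub>D i\<^esub> y i,
     one = \<lambda>i\<in>I. \<one>\<^bsub>D i\<^esub>, lmeet = \<lambda>x y. \<lambda>i\<in>I. lmeet (D i) (x i) (y i),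
     ljoin = \<lambda>x y. \<lambda>i\<in>I. ljoin (D i) (x i) (y i), ldiv = \<lambda>x y. \<lambda>i\<in>I. ldiv (D i) (x i) (y i),
     rdiv = \<lambda>x y. \<lambda>i\<in>I. rdiv (D i) (x i) (y i)\<rparr>"

lemma prod_alg_similar:
  assumes "\<And>i. i \<in> I \<Longrightarrow> similar_algebra (D i)" shows "similar_algebra (prod_alg I D)"
  unfolding similar_algebra_def prod_alg_def
  by (simp add: PiE_iff similar_ops[OF assms])

lemma prod_alg_proj: "i \<in> I \<Longrightarrow> hhom (prod_alg I D) (D i) (\<lambda>f. f i)"
  unfolding hhom_def prod_alg_def by auto

lemma prod_alg_tuple:
  assumes "\<And>i. i \<in> I \<Longrightarrow> hhom B (D i) (g i)" shows "hhom B (prod_alg I D) (\<lambda>b. \<lambda>i\<in>I. g i b)"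
  unfolding hhom_def prod_alg_def
  by (auto simp: hhom_ops[OF assms] restrict_def intro!: ext)

lemma prod_alg_ext: "x \<in> carrier (prod_alg I D) \<Longrightarrow> y \<in> carrier (prod_alg I D) \<Longrightarrow>
    (\<And>i. i \<in> I \<Longrightarrow> x i = y i) \<Longrightarrow> x = y"
  unfolding prod_alg_def by (auto intro: PiE_ext)

lemma rl_hom_iff: "h \<in> rl_hom A B \<longleftrightarrow> hhom A B h"
  unfolding rl_hom_def hom_def hhom_def by auto

text \<open>The full product may be too large for \<open>'u\<close>, but the part generated by the
  images of \<open>B\<close> and \<open>C\<close> injects into \<open>'u\<close> and is copied
  there.\<close>

lemma subproduct:
  fixes B C :: "'u rlat" and D :: "'i \<Rightarrow> 'd rlat"
  assumes inf: "infinite (UNIV :: 'u set)" and sB: "similar_algebra B"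
    and D: "\<And>i. i \<in> I \<Longrightarrow> gsm_alg z (D i)" "\<And>i. i \<in> I \<Longrightarrow> conic (D i)"
    and g: "\<And>i. i \<in> I \<Longrightarrow> hhom B (D i) (g i)" and h: "\<And>i. i \<in> I \<Longrightarrow> hhom C (D i) (h i)"
  obtains N :: "'u rlat" and g' h' where "gsm_alg z N" "semiconic N" "hhom B N g'" "hhom C N h'"
    "\<And>x y. x \<in> carrier B \<Longrightarrow> y \<in> carrier B \<Longrightarrow> g' x = g' y \<longleftrightarrow> (\<forall>i\<in>I. g i x = g i y)"
    "\<And>x y. x \<in> carrier C \<Longrightarrow> y \<in> carrier C \<Longrightarrow> h' x = h' y \<longleftrightarrow> (\<forall>i\<in>I. h i x = h i y)"
    "\<And>x y. x \<in> carrier B \<Longrightarrow> y \<in> carrier C \<Longrightarrow> g' x = h' y \<longleftrightarrow> (\<forall>i\<in>I. g i x = h i y)"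
proof -
  include cardinal_syntax
  let ?P = "prod_alg I D"
  let ?g = "\<lambda>b. \<lambda>i\<in>I. g i b" and ?h = "\<lambda>c. \<lambda>i\<in>I. h i c"
  define F where "F k = (if k then ?g ` carrier B else ?h ` carrier C)" for k
  let ?S = "\<Union>k\<in>UNIV. F k"
  let ?Op = "{mult ?P, lmeet ?P, ljoin ?P, ldiv ?P, rdiv ?P}"
  have P: "similar_algebra ?P"
    by (rule prod_alg_similar) (use D(1) in \<open>auto simp: gsm_alg_def residuated_lattice_def\<close>)
  have gP: "hhom B ?P ?g" and hP: "hhom C ?P ?h" using g h prod_alg_tuple by blast+
  have "\<forall>k\<in>UNIV. |F k| \<le>o |UNIV :: 'u set|"
    by (auto simp: F_def intro!: ordLeq_transitive[OF card_of_image card_of_mono1[OF subset_UNIV]])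
  hence "|?S| \<le>o |UNIV :: 'u set|"
    by (rule card_of_UNION_ordLeq_infinite[OF inf finite_small[OF inf finite_UNIV]])
  moreover have "F k \<subseteq> carrier ?P" for k
    using hhom_ops(1)[OF gP] hhom_ops(1)[OF hP] unfolding F_def by auto
  hence "?S \<subseteq> carrier ?P" by blast
  moreover have "f x y \<in> carrier ?P" if "f \<in> ?Op" "x \<in> carrier ?P" "y \<in> carrier ?P" for f x y
    using that similar_ops[OF P] by auto
  ultimately obtain G where G: "?S \<subseteq> G" "G \<subseteq> carrier ?P" "\<forall>f\<in>?Op. \<forall>x\<in>G. \<forall>y\<in>G. f x y \<in> G"
    and small: "|G| \<le>o |UNIV :: 'u set|"
    using small_closure[OF inf, of ?Op ?S "carrier ?P"] by auto
  obtain e :: "('i \<Rightarrow> 'd) \<Rightarrow> 'u" where e: "inj_on e G" using small unfolding card_of_ordLeq[symmetric] by blast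
  let ?d = "inv_into G e"
  have d: "\<forall>s\<in>G. ?d (e s) = s" using e by simp
  have "F True \<subseteq> G" "F False \<subseteq> G" using G(1) by blast+
  hence gG: "?g ` carrier B \<subseteq> G" and hG: "?h ` carrier C \<subseteq> G" unfolding F_def by simp_all
  \<comment> \<open>\<open>G\<close> is closed under the binary operations only by construction; the
    constant comes from the image of \<open>B\<close>.\<close>
  have "?g \<one>\<^bsub>B\<^esub> \<in> G" using gG similar_ops(1)[OF sB] by blast
  hence sub: "subclosed ?P G"
    unfolding subclosed_def using G(2,3) hhom_ops(2)[OF gP] by simp
  let ?N = "copy G e ?d ?P"
  note N = copy[OF sub d]
  let ?p = "\<lambda>i. (\<lambda>f. f i) \<circ> ?d"
  have p: "hhom ?N (D i) (?p i)" if "i \<in> I" for i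
    using hhom_compose[OF N(2) prod_alg_proj[OF that]] .
  have sep: "x = y" if "x \<in> carrier ?N" "y \<in> carrier ?N" "\<And>i. i \<in> I \<Longrightarrow> ?p i x = ?p i y" for x y
    using copy_inj[OF d that(1,2)] prod_alg_ext[OF hhom_ops(1)[OF N(2) that(1)] hhom_ops(1)[OF N(2) that(2)]]
      that(3) by simp
  have eq: "e s = e t \<longleftrightarrow> (\<forall>i\<in>I. s i = t i)" if "s \<in> G" "t \<in> G" for s t
    using inj_on_eq_iff[OF e that] prod_alg_ext[of s I D t] that G(2) by blast
  have "gsm_alg z ?N" by (rule gsm_alg_separated[OF N(1) D(1) p sep])
  moreover have "semiconic ?N" by (rule semiconic_separated[OF N(1) D p sep])
  moreover note N(3)[OF gP gG] N(3)[OF hP hG]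
  moreover have "(e \<circ> ?g) x = (e \<circ> ?g) y \<longleftrightarrow> (\<forall>i\<in>I. g i x = g i y)" if "x \<in> carrier B" "y \<in> carrier B" for x y
    using eq[of "?g x" "?g y"] that gG by (simp add: image_subset_iff)
  moreover have "(e \<circ> ?h) x = (e \<circ> ?h) y \<longleftrightarrow> (\<forall>i\<in>I. h i x = h i y)" if "x \<in> carrier C" "y \<in> carrier C" for x y
    using eq[of "?h x" "?h y"] that hG by (simp add: image_subset_iff)
  moreover have "(e \<circ> ?g) x = (e \<circ> ?h) y \<longleftrightarrow> (\<forall>i\<in>I. g i x = h i y)" if "x \<in> carrier B" "y \<in> carrier C" for x y
    using eq[of "?g x" "?h y"] that gG hG by (simp add: image_subset_iff)
  ultimately show ?thesis by (rule that)
qed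

section \<open>The amalgam and epimorphisms\<close>

definition gsm_class :: "bool \<Rightarrow> 'u rlat set" where
  "gsm_class z = {A. gsm_alg z A \<and> semiconic A}"

lemma gsm_class_eq: "semiconic_GSM = gsm_class False" "central_semiconic_GSM = gsm_class True"
  unfolding gsm_class_def semiconic_GSM_def central_semiconic_GSM_def gsm_alg_def by auto

lemma gsm_class_GSM: "A \<in> gsm_class z \<Longrightarrow> A \<in> semiconic_GSM"
  "A \<in> gsm_class z \<Longrightarrow> z \<Longrightarrow> A \<in> central_semiconic_GSM"
  unfolding gsm_class_def semiconic_GSM_def central_semiconic_GSM_def gsm_alg_def by auto

lemma gsm_class_similar: "A \<in> gsm_class z \<Longrightarrow> similar_algebra A"
  unfolding gsm_class_def gsm_alg_def residuated_lattice_def by blast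

text \<open>The local amalgams at all pairs of primes are combined in a subproduct. Injectivity
  holds since every failing inequality fails modulo some prime, and every prime of one side extends
  to a pair.\<close>

lemma (in gsm_span) amalgam:
  assumes inf: "infinite (UNIV :: 'u set)"
    and K: "B \<in> gsm_class z" "C \<in> gsm_class z"
  shows "\<exists>D\<in>gsm_class z. \<exists>gB\<in>embedding B D. \<exists>gC\<in>embedding C D.
    (\<forall>a\<in>carrier A. gB (hB a) = gC (hC a)) \<and>
    (\<forall>b\<in>carrier B. \<forall>c\<in>carrier C. gB b = gC c \<longrightarrow> (\<exists>a\<in>carrier A. hB a = b))"
proof -
  have "\<exists>t :: (('u set \<times> 'u set) set \<times> ('u set \<times> 'u set) set) rlat \<times> _ \<times> _. root_amalgam z i t"
    if "i \<in> roots" for i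
    using root_rep[of "fst i" "snd i" z] that gsm_class_GSM(2)[OF K(1)] gsm_class_GSM(2)[OF K(2)] by simp
  hence "\<exists>t. \<forall>i\<in>roots. root_amalgam z i
    (t i :: (('u set \<times> 'u set) set \<times> ('u set \<times> 'u set) set) rlat \<times> _ \<times> _)"
    by (intro bchoice) blast
  then obtain t where t: "\<forall>i\<in>roots. root_amalgam z i
    (t i :: (('u set \<times> 'u set) set \<times> ('u set \<times> 'u set) set) rlat \<times> _ \<times> _)" ..
  define D where "D i = fst (t i)" for i
  define gB where "gB i = fst (snd (t i))" for i
  define gC where "gC i = snd (snd (t i))" for i
  note t' = t[rule_format, unfolded root_amalgam_def case_prod_beta, folded D_def gB_def gC_def]
  have D: "gsm_alg z (D i)" "conic (D i)" and g: "hhom B (D i) (gB i)" and h: "hhom C (D i) (gC i)"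
    and ag: "gB i (fB a) = gC i (fC a)"
    and gl: "gB i x = gB i y \<Longrightarrow> F.C.lef (fst i) x y" and hl: "gC i x = gC i y \<Longrightarrow> G.C.lef (snd i) x y"
    and sh: "gB i b = gC i c \<Longrightarrow>
      (b \<in> fst i \<longleftrightarrow> c \<in> snd i) \<and> (F.C.st b \<in> fst i \<longleftrightarrow> G.C.st c \<in> snd i)"
    if "i \<in> roots" for i a x y b c
    using t'[OF that] by simp_all
  obtain N :: "'u rlat" and g' h' where N: "gsm_alg z N" "semiconic N" "hhom B N g'" "hhom C N h'"
    and ig: "\<And>x y. x \<in> carrier B \<Longrightarrow> y \<in> carrier B \<Longrightarrow> g' x = g' y \<longleftrightarrow> (\<forall>i\<in>roots. gB i x = gB i y)"
    and ih: "\<And>x y. x \<in> carrier C \<Longrightarrow> y \<in> carrier C \<Longrightarrow> h' x = h' y \<longleftrightarrow> (\<forall>i\<in>roots. gC i x = gC i y)"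
    and eq: "\<And>x y. x \<in> carrier B \<Longrightarrow> y \<in> carrier C \<Longrightarrow> g' x = h' y \<longleftrightarrow> (\<forall>i\<in>roots. gB i x = gC i y)"
    by (rule subproduct[where I = roots and D = D and g = gB and h = gC and z = z,
        OF inf gsm_class_similar[OF K(1)]]) (assumption | rule D g h that)+
  have leB: "leT B x y" if x: "x \<in> carrier B" "y \<in> carrier B" "g' x = g' y" for x y
  proof (rule ccontr)
    assume "\<not> leT B x y"
    then obtain P where P: "F.C.prime P" "\<not> F.C.lef P x y" using F.C.prime_separate by blast
    then obtain Q where "(P, Q) \<in> roots" using extend_root by blast
    thus False using gl[of "(P, Q)" x y] ig x P(2) by auto
  qed
  have leC: "leT C x y" if x: "x \<in> carrier C" "y \<in> carrier C" "h' x = h' y" for x y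
  proof (rule ccontr)
    assume "\<not> leT C x y"
    then obtain Q where Q: "G.C.prime Q" "\<not> G.C.lef Q x y" using G.C.prime_separate by blast
    then obtain P where "(P, Q) \<in> roots"
      using gsm_span.extend_root[OF gsm_span_swap[OF gsm_span_axioms]] roots_swap by blast
    thus False using hl[of "(P, Q)" x y] ih x Q(2) by auto
  qed
  have "inj_on g' (carrier B)" using leB F.C.eq_iff by (intro inj_onI) metis
  hence gE: "g' \<in> embedding B N" using N(3) unfolding embedding_def rl_hom_iff by blast
  have "inj_on h' (carrier C)" using leC G.C.eq_iff by (intro inj_onI) metis
  hence hE: "h' \<in> embedding C N" using N(4) unfolding embedding_def rl_hom_iff by blast
  have "g' (hB a) = h' (hC a)" if a: "a \<in> carrier A" for a
  proof -
    have "gB i (hB a) = gC i (hC a)" if "i \<in> roots" for i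
      using ag[OF that, of a] a unfolding F.f_def G.f_def by simp
    thus ?thesis using eq F.h_closed[OF a] G.h_closed[OF a] by blast
  qed
  moreover have "\<exists>a\<in>carrier A. hB a = b" if b: "b \<in> carrier B" "c \<in> carrier C" "g' b = h' c" for b c
  proof (rule shared[OF b(1)])
    fix P Q assume r: "(P, Q) \<in> roots"
    hence "gB (P, Q) b = gC (P, Q) c" using eq b by blast
    thus "(b \<in> P \<longleftrightarrow> c \<in> Q) \<and> (F.C.st b \<in> P \<longleftrightarrow> G.C.st c \<in> Q)" using sh[OF r] by simp
  qed
  moreover have "N \<in> gsm_class z" using N unfolding gsm_class_def by blast
  ultimately show ?thesis using gE hE by blast
qed

lemma strong_amalgamation:
  assumes inf: "infinite (UNIV :: 'u set)"
  shows "strong_amalgamation_property (gsm_class z :: 'u rlat set)"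
  unfolding strong_amalgamation_property_def
proof (intro ballI)
  fix A B C :: "'u rlat" and fB fC
  assume K: "A \<in> gsm_class z" "B \<in> gsm_class z" "C \<in> gsm_class z"
    and f: "fB \<in> embedding A B" "fC \<in> embedding A C"
  have g: "gsm_algebra A" "gsm_algebra B" "gsm_algebra C" using K gsm_class_GSM(1) unfolding gsm_algebra_def by blast+
  interpret gsm_span A B C fB fC
    by (intro gsm_span.intro gsm_embedding.intro gsm_embedding_axioms.intro g f)
  obtain D gB gC where D: "D \<in> gsm_class z" "gB \<in> embedding B D" "gC \<in> embedding C D"
    and ag: "\<forall>a\<in>carrier A. gB (fB a) = gC (fC a)"
    and st: "\<forall>b\<in>carrier B. \<forall>c\<in>carrier C. gB b = gC c \<longrightarrow> (\<exists>a\<in>carrier A. fB a = b)"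
    using amalgam[OF inf K(2,3)] by blast
  have "(gB \<circ> fB) ` carrier A = gB ` carrier B \<inter> gC ` carrier C"
  proof (rule subset_antisym; rule subsetI)
    fix x assume "x \<in> (gB \<circ> fB) ` carrier A"
    then obtain a where a: "a \<in> carrier A" "x = gB (fB a)" by auto
    hence "x = gC (fC a)" using ag by simp
    thus "x \<in> gB ` carrier B \<inter> gC ` carrier C" using a F.h_closed G.h_closed by blast
  next
    fix x assume "x \<in> gB ` carrier B \<inter> gC ` carrier C"
    then obtain b c where b: "b \<in> carrier B" "c \<in> carrier C" "x = gB b" "gB b = gC c" by auto
    then obtain a where "a \<in> carrier A" "fB a = b" using st by blast
    thus "x \<in> (gB \<circ> fB) ` carrier A" using b(3) by (intro image_eqI[of _ _ a]) simp_all
  qed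
  thus "\<exists>D\<in>gsm_class z. \<exists>gB\<in>embedding B D. \<exists>gC\<in>embedding C D.
      (\<forall>a\<in>carrier A. gB (fB a) = gC (fC a)) \<and> (gB \<circ> fB) ` carrier A = gB ` carrier B \<inter> gC ` carrier C"
    by (intro bexI[OF _ D(1)] bexI[OF _ D(2)] bexI[OF _ D(3)] conjI ag)
qed

lemma subalgebra_similar: "subclosed B S \<Longrightarrow> similar_algebra (B\<lparr>carrier := S\<rparr>)"
  unfolding subclosed_def similar_algebra_def by simp

lemma subalgebra_hhom: "subclosed B S \<Longrightarrow> hhom (B\<lparr>carrier := S\<rparr>) B id"
  unfolding subclosed_def hhom_def by auto

lemma gsm_class_subalgebra:
  assumes B: "B \<in> gsm_class z" and S: "subclosed B S"
  shows "B\<lparr>carrier := S\<rparr> \<in> gsm_class z"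
proof -
  let ?A = "B\<lparr>carrier := S\<rparr>"
  have "gsm_alg z ?A"
    by (rule gsm_alg_separated[where I = "{()}" and D = "\<lambda>_. B" and p = "\<lambda>_. id"])
      (use B subalgebra_similar[OF S] subalgebra_hhom[OF S] in \<open>auto simp: gsm_class_def\<close>)
  moreover have "semiconic ?A"
  proof (rule semiconicI[OF subalgebra_similar[OF S]])
    fix t assume "\<And>B :: 'a rlat. residuated_lattice B \<Longrightarrow> conic B \<Longrightarrow> satisfies B t"
    hence t: "satisfies B t" using B semiconic_satisfies unfolding gsm_class_def by blast
    have "eval_term ?A v s = eval_term B v s" if "\<forall>n. v n \<in> carrier ?A" for v s
      using hhom_eval[OF subalgebra_similar[OF S] subalgebra_hhom[OF S], of v s] that by simp
    thus "satisfies ?A t" using t S unfolding satisfies_def subclosed_def by (simp add: subset_iff)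
  qed
  ultimately show ?thesis unfolding gsm_class_def by blast
qed

text \<open>The two embeddings of \<open>B\<close> agree on the image of \<open>f\<close>, hence
  everywhere. So the intersection of their ranges is the whole range of \<open>g\<close>, while
  strongness says it is the \<open>g\<close>-image of the range of \<open>f\<close>.\<close>

lemma ES_if_strong_amalgamation:
  assumes sap: "strong_amalgamation_property K"
    and similar: "\<And>A. A \<in> K \<Longrightarrow> similar_algebra A"
    and sub: "\<And>B S. B \<in> K \<Longrightarrow> subclosed B S \<Longrightarrow> B\<lparr>carrier := S\<rparr> \<in> K"
  shows "ES_property K"
  unfolding ES_property_def
proof (intro ballI allI impI)
  fix A B f assume K: "A \<in> K" "B \<in> K" and epi: "epimorphism_in K A B f"
  have f: "hhom A B f" using epi unfolding epimorphism_in_def rl_hom_iff by blast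
  let ?S = "f ` carrier A"
  let ?A = "B\<lparr>carrier := ?S\<rparr>"
  have S: "subclosed B ?S" using similar[OF K(1)] f by (rule image_subclosed)
  have A: "?A \<in> K" using K(2) S by (rule sub)
  have "id \<in> embedding ?A B" unfolding embedding_def rl_hom_iff using subalgebra_hhom[OF S] by simp
  then obtain D g h where D: "D \<in> K" and g: "g \<in> embedding B D" and h: "h \<in> embedding B D"
    and ag: "\<forall>a\<in>carrier ?A. g (id a) = h (id a)"
    and im: "(g \<circ> id) ` carrier ?A = g ` carrier B \<inter> h ` carrier B"
    using sap A K(2) unfolding strong_amalgamation_property_def by meson
  have "g \<in> rl_hom B D" "h \<in> rl_hom B D" using g h unfolding embedding_def by blast+
  moreover have "\<forall>x\<in>carrier A. g (f x) = h (f x)" using ag by simp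
  ultimately have gh: "\<forall>y\<in>carrier B. g y = h y" using epi D unfolding epimorphism_in_def by blast
  have SB: "?S \<subseteq> carrier B" using S unfolding subclosed_def by blast
  show "?S = carrier B"
  proof
    show "carrier B \<subseteq> ?S"
    proof
      fix y assume y: "y \<in> carrier B"
      hence "g y \<in> g ` ?S" using im gh by auto
      then obtain s where "s \<in> ?S" "g y = g s" by blast
      moreover have "inj_on g (carrier B)" using g unfolding embedding_def by blast
      ultimately show "y \<in> ?S" using y SB inj_onD by fastforce
    qed
  qed (rule SB)
qed

theorem corollary5p21:
  assumes "infinite (UNIV :: 'u set)"
  shows "(strong_amalgamation_property (semiconic_GSM :: 'u rlat set) \<and>
          ES_property (semiconic_GSM :: 'u rlat set)) \<and>
         (strong_amalgamation_property (central_semiconic_GSM :: 'u rlat set) \<and>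
          ES_property (central_semiconic_GSM :: 'u rlat set))"
proof -
  have "strong_amalgamation_property (gsm_class z :: 'u rlat set)" for z
    using assms by (rule strong_amalgamation)
  moreover from this have "ES_property (gsm_class z :: 'u rlat set)" for z
    by (rule ES_if_strong_amalgamation) (use gsm_class_similar gsm_class_subalgebra in blast)+
  ultimately show ?thesis unfolding gsm_class_eq by blast
qed

end
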